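(* Let $F$ be a non-archimedean local field of characteristic zero and $\phi\in C_c^\infty(\mathfrak{gl}_n(F)\times\mathfrak{gl}_n(F))$. Set $\widetilde\phi(t)=\int_{\mathrm{GL}_n(F)}\phi(th,h^{-1})\,dh$ for $t\in F^\times$. If $\widetilde\phi(t)=0$ for all non-zero $t$ in some neighborhood of $0$ in $F$, then $\phi(0)=0$.
   Context: $dh$ is a Haar measure on $\mathrm{GL}_n(F)$. *)

theory Defs
  imports "HOL-Analysis.Analysis"
begin

definition (in field) nonarch_absolute_value :: "('a \<Rightarrow> real) \<Rightarrow> bool" where
  "nonarch_absolute_value v \<longleftrightarrow>
     (\<forall>x. 0 \<le> v x) \<and>
     (\<forall>x. v x = 0 \<longleftrightarrow> x = 0) \<and>
     (\<forall>x y. v (x * y) = v x * v y) \<and>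
     (\<forall>x y. v (x + y) \<le> max (v x) (v y)) \<and>
     (\<exists>x. x \<noteq> 0 \<and> v x \<noteq> 1)"

text \<open>
  A non-archimedean local field is a locally compact field whose topology is the metric topology
  of some nontrivial non-archimedean absolute value. The absolute value is not part of the
  structure. Nontriviality makes the topology non-discrete.
\<close>

class nonarch_local_field = field + topological_space +
  assumes ex_nonarch_absolute_value:
    "\<exists>v. nonarch_absolute_value v \<and>
       (\<forall>U. open U \<longleftrightarrow> (\<forall>x\<in>U. \<exists>e>0. \<forall>y. v (y - x) < e \<longrightarrow> y \<in> U))"
  and locally_compact: "\<exists>U K. open U \<and> compact K \<and> x \<in> U \<and> U \<subseteq> K"

text \<open>
  Smooth functions on a totally disconnected space are the locally constant ones.
\<close>

definition Cc_infty :: "('b::topological_space \<Rightarrow> complex) set" where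
  "Cc_infty = {\<phi>. (\<forall>x. \<exists>U. open U \<and> x \<in> U \<and> \<phi> constant_on U) \<and>
                   compact (closure {x. \<phi> x \<noteq> 0})}"

definition GL :: "('a::field ^ 'n ^ 'n) set" where
  "GL = {h. invertible h}"

text \<open>
  A Haar measure on \<open>GL\<close> is a nonzero left-invariant Radon measure. Over a topological field,
  inversion is continuous for the subspace topology inherited from all matrices, so this is the
  group topology.
\<close>

definition haar_measure_GL :: "('a::{field,topological_space} ^ 'n ^ 'n) measure \<Rightarrow> bool" where
  "haar_measure_GL \<mu> \<longleftrightarrow>
     sets \<mu> = sets (restrict_space borel GL) \<and>
     emeasure \<mu> (space \<mu>) \<noteq> 0 \<and>
     (\<forall>g\<in>GL. \<forall>A\<in>sets \<mu>. emeasure \<mu> ((\<lambda>h. g ** h) ` A) = emeasure \<mu> A) \<and>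
     (\<forall>K. compact K \<and> K \<subseteq> GL \<longrightarrow> emeasure \<mu> K < \<infinity>) \<and>
     (\<forall>A\<in>sets \<mu>. emeasure \<mu> A =
        (INF U\<in>{U. openin (top_of_set GL) U \<and> A \<subseteq> U}. emeasure \<mu> U)) \<and>
     (\<forall>U. openin (top_of_set GL) U \<longrightarrow> emeasure \<mu> U =
        (SUP K\<in>{K. compact K \<and> K \<subseteq> U}. emeasure \<mu> K))"

definition phi_tilde ::
  "('a::field ^ 'n ^ 'n) measure \<Rightarrow> (('a ^ 'n ^ 'n) \<times> ('a ^ 'n ^ 'n) \<Rightarrow> complex) \<Rightarrow> 'a \<Rightarrow> complex" where
  "phi_tilde \<mu> \<phi> t = (LINT h|\<mu>. \<phi> ((\<chi> i j. t * h $ i $ j), matrix_inv h))"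

end

theory Submission
  imports Defs
begin

text \<open>
  The germ of \<open>\<phi>~\<close> at \<open>0\<close> depends only on \<open>\<phi>\<close> restricted to the pairs with \<open>X Y = Y X = 0\<close>, and it
  is unchanged under \<open>\<phi> \<mapsto> \<phi> (g X, Y g\<^sup>-\<^sup>1)\<close>, while \<open>\<phi> \<mapsto> \<phi> (\<pi> X, Y)\<close> acts on it as the shift
  \<open>T : f \<mapsto> f (\<pi> t)\<close>. Stratify these pairs by the rank of \<open>X\<close>. On the stratum of rank \<open>r\<close> with
  \<open>0 < r < n\<close> a matrix near a given one is \<open>(1 + b) P X\<close> with \<open>b\<close> in a unipotent block; translations in
  \<open>b\<close> come from \<open>GL\<close>, and scaling \<open>b\<close> multiplies sums over \<open>b\<close> by an index \<open>\<kappa> > 1\<close>. So up to such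
  translations \<open>T - \<kappa>\<close> pushes \<open>\<phi>\<close> to higher rank, and \<open>T - 1\<close> does so for \<open>r = 0\<close>. Applying
  finitely many of these operators leaves a function \<open>\<psi>\<close> supported on invertible \<open>X\<close>, whose germ is the
  constant \<open>\<integral> \<psi> (h, 0) dh\<close>.

  The same operators act on the zeta integral \<open>Z (z) = \<Sum> z ^ k \<integral> \<phi> (h, 0) dh\<close> over \<open>val (det h) = k\<close>
  through factors \<open>z ^ e - \<kappa>\<close> that do not vanish at \<open>1\<close>, and through \<open>z ^ -n - 1\<close> for \<open>T - 1\<close>; the
  constant above is the value at \<open>1\<close> of the resulting Laurent polynomial. If \<open>\<phi> (0, 0) = 0\<close> the factor
  \<open>z ^ -n - 1\<close> is not needed, so this value is \<open>\<phi> (0, 0)\<close> times that for the indicator \<open>\<omega>\<close> of the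
  integral matrices. Since \<open>D Z\<^sub>\<omega>\<close> is a nonzero constant for a Laurent polynomial \<open>D\<close> with
  \<open>D (1) = 0\<close>, the latter value is nonzero, and the vanishing of the germ forces \<open>\<phi> (0, 0) = 0\<close>.
\<close>

subsection \<open>Non-archimedean local fields\<close>

text \<open>The condition \<open>X Y = Y X = 0\<close> arises because the pairs in the integral
  satisfy \<open>X Y = Y X = t\<close> with \<open>t\<close> tending to 0. The obstacle is rank 0:
  the factor of \<open>T - 1\<close> vanishes at \<open>z = 1\<close>, so evaluating there seems to
  lose all information. But the zeta series may have a pole at 1, and this factor turns the value at
  1 into a residue. A function vanishing at the origin is reduced by factors that do not vanish at
  1, so it contributes nothing to the residue. No analytic continuation is involved: residues are
  compared through values and derivatives at 1 of Laurent polynomials. For this, every reduction is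
  carried out on the germ and on the zeta coefficients at once, with one list of operators; lists
  belonging to different summands are merged by commutativity. The second variable matters on the
  intermediate strata: \<open>Y X = 0\<close> makes the contraction that rescales the block act on
  \<open>Y\<close> compatibly with its action on \<open>X\<close>.\<close>

locale nonarch_valuation =
  fixes v :: "'a::nonarch_local_field \<Rightarrow> real"
  assumes nonarch: "nonarch_absolute_value v"
    and open_iff_ball: "open U \<longleftrightarrow> (\<forall>x\<in>U. \<exists>e>0. \<forall>y. v (y - x) < e \<longrightarrow> y \<in> U)"
begin

lemma v_nonneg [simp]: "0 \<le> v x"
  and v_eq_0_iff [simp]: "v x = 0 \<longleftrightarrow> x = 0"
  and v_mult: "v (x * y) = v x * v y"
  and v_add_le_max: "v (x + y) \<le> max (v x) (v y)"
  using nonarch unfolding nonarch_absolute_value_def by blast+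

lemma v_pos_iff [simp]: "0 < v x \<longleftrightarrow> x \<noteq> 0"
  using v_nonneg[of x] v_eq_0_iff[of x] by linarith

lemma v_1 [simp]: "v 1 = 1"
proof -
  have "v 1 = v 1 * v 1" using v_mult[of 1 1] by (simp only: mult_1)
  moreover have "v 1 \<noteq> 0" by simp
  ultimately show ?thesis by (metis mult_cancel_left1)
qed

lemma v_0 [simp]: "v 0 = 0"
  using v_eq_0_iff by blast

lemma v_minus [simp]: "v (- x) = v x"
proof -
  have "v (-1) * v (-1) = 1"
    using v_mult[of "-1" "-1"] by simp
  then have "v (-1) = 1"
    using v_nonneg[of "-1"] by (metis abs_of_nonneg real_sqrt_abs2 real_sqrt_one)
  then show ?thesis
    using v_mult[of "-1" x] by simp
qed

lemma v_minus_commute: "v (x - y) = v (y - x)"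
  using v_minus[of "x - y"] by simp

lemma v_add_le: "v x \<le> c \<Longrightarrow> v y \<le> c \<Longrightarrow> v (x + y) \<le> c"
  using v_add_le_max[of x y] by linarith

lemma v_diff_le: "v x \<le> c \<Longrightarrow> v y \<le> c \<Longrightarrow> v (x - y) \<le> c"
  using v_add_le[of x c "- y"] by simp

lemma v_add_less: "v x < c \<Longrightarrow> v y < c \<Longrightarrow> v (x + y) < c"
  using v_add_le_max[of x y] by linarith

lemma v_sum_le: "(\<And>i. i \<in> I \<Longrightarrow> v (f i) \<le> c) \<Longrightarrow> 0 \<le> c \<Longrightarrow> v (sum f I) \<le> c"
proof (induction I rule: infinite_finite_induct)
  case (insert x F)
  then show ?case using v_add_le[of "f x" c "sum f F"] by simp
qed auto

lemma v_inverse: "v (inverse x) = inverse (v x)"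
proof (cases "x = 0")
  case False
  then have "v x * v (inverse x) = 1"
    using v_mult[of x "inverse x"] by simp
  then show ?thesis
    by (simp add: inverse_unique)
qed simp

lemma v_divide: "v (x / y) = v x / v y"
  by (simp add: divide_inverse v_mult v_inverse)

lemma v_power: "v (x ^ n) = v x ^ n"
  by (induction n) (auto simp: v_mult)

lemma v_power_int: "v (x powi n) = v x powi n"
  by (simp add: power_int_def v_power v_inverse)

lemma v_eq_if_close: "v (x - y) < v y \<Longrightarrow> v x = v y"
proof -
  assume a: "v (x - y) < v y"
  have "v x \<le> max (v (x - y)) (v y)"
    using v_add_le_max[of "x - y" y] by simp
  moreover have "v y \<le> max (v (y - x)) (v x)"
    using v_add_le_max[of "y - x" x] by simp
  ultimately show ?thesis
    using a v_minus_commute[of x y] by linarith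
qed

lemma open_v_le: assumes "0 < c" shows "open {x. v (x - a) \<le> c}"
  unfolding open_iff_ball
proof clarsimp
  fix x assume x: "v (x - a) \<le> c"
  have "v (y - a) \<le> c" if "v (y - x) < c" for y
    using v_add_le[of "y - x" c "x - a"] x that by simp
  then show "\<exists>e>0. \<forall>y. v (y - x) < e \<longrightarrow> v (y - a) \<le> c"
    using assms by blast
qed

lemma closed_v_le: assumes "0 < c" shows "closed {x. v x \<le> c}"
  unfolding closed_def open_iff_ball
proof
  fix x assume "x \<in> - {x. v x \<le> c}"
  then have x: "\<not> v x \<le> c" by simp
  have "\<not> v y \<le> c" if "v (y - x) < c" for y
    using v_eq_if_close[of y x] x that by linarith
  then show "\<exists>e>0. \<forall>y. v (y - x) < e \<longrightarrow> y \<in> - {x. v x \<le> c}"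
    using assms by blast
qed

lemma continuous_on_mult_const: "continuous_on UNIV (\<lambda>x::'a. x * c)"
proof (cases "c = 0")
  case False
  show ?thesis
    unfolding continuous_on_open_vimage[OF open_UNIV]
  proof (intro allI impI)
    fix B :: "'a set" assume B: "open B"
    have "\<exists>e>0. \<forall>y. v (y - x) < e \<longrightarrow> y * c \<in> B" if x: "x * c \<in> B" for x
    proof -
      obtain e where e: "e > 0" "\<forall>y. v (y - x * c) < e \<longrightarrow> y \<in> B"
        using B x open_iff_ball by blast
      have "y * c \<in> B" if "v (y - x) < e / v c" for y
      proof -
        have "v (y * c - x * c) = v (y - x) * v c"
          by (metis left_diff_distrib v_mult)
        also have "\<dots> < e"
          using that False by (simp add: field_simps)
        finally show ?thesis using e by blast
      qed
      then show ?thesis using e False by (intro exI[of _ "e / v c"]) auto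
    qed
    then show "open ((\<lambda>x. x * c) -` B \<inter> UNIV)"
      unfolding open_iff_ball by auto
  qed
qed simp

lemma ex_small: assumes "0 < e" obtains c where "c \<noteq> 0" "v c < e"
proof -
  obtain x where x: "x \<noteq> 0" "v x \<noteq> 1"
    using nonarch unfolding nonarch_absolute_value_def by blast
  define y where "y = (if v x < 1 then x else inverse x)"
  have y: "y \<noteq> 0" "v y < 1"
    using x by (auto simp: y_def v_inverse intro!: inverse_less_1_iff[THEN iffD2])
  obtain n where "v y ^ n < e"
    using real_arch_pow_inv[OF assms y(2)] by blast
  then show thesis
    using y that[of "y ^ n"] by (simp add: v_power)
qed

text \<open>Local compactness only provides some compact neighbourhood of 0. It contains a small
  closed ball, and dividing by a small scalar expands that ball to radius \<open>r\<close>.\<close>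

lemma compact_v_le: assumes "0 < r" shows "compact {x. v x \<le> r}"
proof -
  obtain U K where UK: "open U" "compact K" "0 \<in> U" "U \<subseteq> (K::'a set)"
    using locally_compact by metis
  obtain e where e: "e > 0" "\<forall>y. v (y - 0) < e \<longrightarrow> y \<in> U"
    using UK open_iff_ball by blast
  obtain c where c: "c \<noteq> 0" "v c < e / r"
    using ex_small[of "e / r"] assms e by auto
  have r: "r * v c < e" "0 < r * v c"
    using c assms by (auto simp: field_simps)
  have "K \<inter> {x. v x \<le> r * v c} = {x. v x \<le> r * v c}"
    using e UK r by force
  then have "compact {x. v x \<le> r * v c}"
    using compact_Int_closed[OF UK(2) closed_v_le[OF r(2)]] by simp
  then have "compact ((\<lambda>x. x * inverse c) ` {x. v x \<le> r * v c})"
    by (intro compact_continuous_image continuous_on_subset[OF continuous_on_mult_const] subset_UNIV)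
  moreover have "(\<lambda>x. x * inverse c) ` {x. v x \<le> r * v c} = {x. v x \<le> r}"
  proof (intro set_eqI iffI)
    fix x assume "x \<in> {x. v x \<le> r}"
    then show "x \<in> (\<lambda>x. x * inverse c) ` {x. v x \<le> r * v c}"
      using c by (intro image_eqI[of _ _ "x * c"]) (auto simp: v_mult)
  qed (use c in \<open>auto simp: v_mult v_divide v_inverse field_simps\<close>)
  ultimately show ?thesis by simp
qed

text \<open>Discreteness of the value group comes from compactness of the open unit ball: without a
  maximal absolute value the open sets \<open>{x. v x < v w}\<close> would cover it, and a
  \<open>w\<close> of largest absolute value in a finite subcover would be left uncovered.\<close>

lemma ex_uniformizer: "\<exists>w. w \<noteq> 0 \<and> v w < 1 \<and> (\<forall>x. v x < 1 \<longrightarrow> v x \<le> v w)"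
proof -
  obtain c where c: "c \<noteq> 0" "v c < 1"
    using ex_small[of 1] by auto
  have op: "open {x. v x < d}" for d
    unfolding open_iff_ball
  proof clarsimp
    fix x assume "v x < d"
    then have "\<forall>y. v (y - x) < d \<longrightarrow> v y < d"
      using v_add_less[of _ d x] by fastforce
    then show "\<exists>e>0. \<forall>y. v (y - x) < e \<longrightarrow> v y < d"
      using \<open>v x < d\<close> le_less_trans[OF v_nonneg[of x]] by blast
  qed
  have "open (- {x. v x < 1})"
    unfolding open_iff_ball
  proof
    fix x assume "x \<in> - {x. v x < 1}"
    then have x: "\<not> v x < 1" by simp
    have "\<not> v y < 1" if "v (y - x) < 1" for y
      using v_eq_if_close[of y x] x that by linarith
    then show "\<exists>e>0. \<forall>y. v (y - x) < e \<longrightarrow> y \<in> - {x. v x < 1}"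
      using zero_less_one by blast
  qed
  then have "compact ({x. v x \<le> 1} \<inter> {x. v x < 1})"
    by (intro compact_Int_closed compact_v_le) (auto simp: closed_def)
  also have "{x. v x \<le> 1} \<inter> {x. v x < 1} = {x. v x < 1}" by auto
  finally have comp: "compact {x. v x < 1}" .
  have "\<exists>w\<in>{x. v x < 1}. \<forall>x\<in>{x. v x < 1}. v x \<le> v w"
  proof (rule ccontr)
    assume "\<not> ?thesis"
    then have cov: "{x. v x < 1} \<subseteq> (\<Union>w\<in>{x. v x < 1}. {x. v x < v w})"
      by (force simp: not_le)
    obtain W where W: "W \<subseteq> {x. v x < 1}" "finite W" "{x. v x < 1} \<subseteq> (\<Union>w\<in>W. {x. v x < v w})"
      using compactE_image[OF comp _ cov] op by blast
    have "W \<noteq> {}" using W(3) c by auto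
    then have "Max (v ` W) \<in> v ` W" using W(2) by simp
    then obtain w where w: "w \<in> W" "v w = Max (v ` W)" by auto
    then have "\<forall>x\<in>W. v x \<le> v w" using W(2) by simp
    moreover have "w \<in> (\<Union>w\<in>W. {x. v x < v w})" using w W by blast
    ultimately show False by force
  qed
  then obtain w where w: "v w < 1" "\<And>x. v x < 1 \<Longrightarrow> v x \<le> v w" by blast
  moreover have "w \<noteq> 0" using w(2)[OF c(2)] c(1) by (metis v_0 v_pos_iff not_le)
  ultimately show ?thesis by blast
qed

end

locale uniformized = nonarch_valuation v for v :: "'a::nonarch_local_field \<Rightarrow> real" +
  fixes \<pi> :: 'a
  assumes unif_nz [simp]: "\<pi> \<noteq> 0" and unif_less: "v \<pi> < 1"
    and unif_max: "v x < 1 \<Longrightarrow> v x \<le> v \<pi>"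
begin

text \<open>Radii are indexed by exponents, so a larger index means a smaller ball.\<close>

abbreviation q :: "int \<Rightarrow> real" where "q k \<equiv> v \<pi> powi k"

lemma q_pos [simp]: "0 < q k"
  by (simp add: zero_less_power_int)

lemma q_nonneg [simp]: "0 \<le> q k"
  using q_pos[of k] by linarith

lemma q_add: "q (a + b) = q a * q b"
  by (simp add: power_int_add)

lemma q_less_iff [simp]: "q a < q b \<longleftrightarrow> b < a"
proof (cases a b rule: linorder_cases)
  case less
  then show ?thesis using power_int_strict_decreasing[of a b "v \<pi>"] unif_less by simp
next
  case greater
  then show ?thesis using power_int_strict_decreasing[of b a "v \<pi>"] unif_less by simp
qed simp

lemma q_le_iff [simp]: "q a \<le> q b \<longleftrightarrow> b \<le> a"
  using q_less_iff[of b a] by linarith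

lemma q_eq_iff [simp]: "q a = q b \<longleftrightarrow> a = b"
  using q_le_iff[of a b] q_le_iff[of b a] by linarith

lemma q_arbitrarily_small: assumes "0 < e" shows "\<exists>k\<ge>0. q k < e"
proof -
  obtain n where "v \<pi> ^ n < e"
    using real_arch_pow_inv[OF assms unif_less] by blast
  then show ?thesis by (intro exI[of _ "int n"]) auto
qed

lemma q_arbitrarily_large: "\<exists>k\<ge>0. r < q (- k)"
proof -
  obtain k where k: "k \<ge> 0" "q k < 1 / (\<bar>r\<bar> + 1)"
    using q_arbitrarily_small[of "1 / (\<bar>r\<bar> + 1)"] by (auto simp: add_nonneg_pos)
  have "\<bar>r\<bar> + 1 < 1 / q k"
    using k by (simp add: field_simps)
  then show ?thesis using k(1) by (intro exI[of _ k]) (auto simp: power_int_minus divide_inverse)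
qed

lemma v_eq_q: assumes "x \<noteq> 0" shows "\<exists>k. v x = q k"
proof -
  obtain a where a: "a \<ge> 0" "v x < q (- a)" using q_arbitrarily_large by blast
  obtain b where b: "b \<ge> 0" "q b < v x" using q_arbitrarily_small[of "v x"] assms by auto
  \<comment> \<open>For the largest admissible \<open>k\<close> the quotient
    \<open>x / \<pi> powi k\<close> has absolute value above \<open>q 1\<close> and at most 1, where
    maximality of the uniformizer leaves only 1.\<close>
  define S where "S = {k. v x \<le> q k \<and> - a \<le> k}"
  have "S \<subseteq> {-a..b}"
    using b by (auto simp: S_def) (meson less_le_trans order_less_imp_le q_less_iff not_le)
  then have fin: "finite S" by (rule finite_subset) simp
  have "- a \<in> S" using a by (auto simp: S_def)
  define k where "k = Max S"
  have k: "k \<in> S" "k + 1 \<notin> S"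
    using Max_in[OF fin] Max_ge[OF fin, of "k + 1"] \<open>- a \<in> S\<close> by (auto simp: k_def)
  then have "v x \<le> q k" "q (k + 1) < v x" by (auto simp: S_def)
  then have "q 1 < v x / q k" "v x / q k \<le> 1"
    by (auto simp: q_add field_simps)
  moreover have "v (x / \<pi> powi k) = v x / q k"
    by (simp add: v_divide v_power_int)
  ultimately have "v x / q k = 1"
    using unif_max[of "x / \<pi> powi k"] by (metis linorder_not_le order_antisym_conv power_int_1_right)
  then show ?thesis by (intro exI[of _ k]) (simp add: field_simps)
qed

definition val :: "'a \<Rightarrow> int" where "val x = (SOME k. v x = q k)"

lemma v_eq_q_val: "x \<noteq> 0 \<Longrightarrow> v x = q (val x)"
  unfolding val_def by (rule someI_ex[OF v_eq_q])

lemma val_eqI: "v x = q k \<Longrightarrow> val x = k"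
  unfolding val_def by (rule some_equality) auto

lemma val_mult: "x \<noteq> 0 \<Longrightarrow> y \<noteq> 0 \<Longrightarrow> val (x * y) = val x + val y"
  using v_eq_q_val[of x] v_eq_q_val[of y] by (intro val_eqI) (metis v_mult q_add)

lemma ex_q_less: "0 < e \<Longrightarrow> \<exists>k. q k < e"
  using q_arbitrarily_small by blast

end

subsection \<open>Square matrices over a field\<close>

definition smat :: "'a::field \<Rightarrow> 'a^'n^'n \<Rightarrow> 'a^'n^'n" where
  "smat c A = (\<chi> i j. c * A $ i $ j)"

lemma smat_nth [simp]: "smat c A $ i $ j = c * A $ i $ j"
  by (simp add: smat_def)

lemma matrix_add_rdistrib': "(A + B) ** C = A ** C + B ** (C :: 'a::field^'n^'n)"
  and matrix_diff_ldistrib: "A ** (B - C) = A ** B - A ** C"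
  and matrix_diff_rdistrib: "(A - B) ** C = A ** C - B ** C"
  and matrix_minus_left: "(- A) ** C = - (A ** C)"
  and matrix_minus_right: "A ** (- C) = - (A ** C)"
  by (simp_all add: matrix_matrix_mult_def vec_eq_iff sum.distrib sum_subtractf sum_negf algebra_simps)

lemma smat_mult_left: "smat c A ** B = smat c (A ** B)"
  and smat_mult_right: "A ** smat c B = smat c (A ** B)"
  by (simp_all add: matrix_matrix_mult_def vec_eq_iff sum_distrib_left mult_ac)

lemma smat_add: "smat c (A + B) = smat c A + smat c B"
  and smat_diff: "smat c (A - B) = smat c A - smat c B"
  and smat_smat: "smat c (smat d A) = smat (c * d) A"
  and smat_1 [simp]: "smat 1 A = A"
  and smat_0_left [simp]: "smat 0 A = 0"
  and smat_0 [simp]: "smat c 0 = 0"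
  and smat_minus: "smat c (- A) = - smat c A"
  by (simp_all add: vec_eq_iff algebra_simps)

lemmas mat_algebra = matrix_add_ldistrib matrix_add_rdistrib' matrix_diff_ldistrib matrix_diff_rdistrib
  matrix_minus_left matrix_minus_right smat_mult_left smat_mult_right smat_add smat_diff smat_smat smat_minus
  matrix_mul_assoc[symmetric]

lemma smat_eq_iff: "c \<noteq> 0 \<Longrightarrow> smat c A = smat c B \<longleftrightarrow> A = B"
  by (simp add: vec_eq_iff)

lemma det_smat: "det (smat c (A::'a::field^'n^'n)) = c ^ CARD('n) * det A"
  by (simp add: det_def smat_def prod.distrib sum_distrib_left mult_ac)

lemma invertible_matrix_inv:
  assumes "invertible (A::'a::field^'n^'n)"
  shows "A ** matrix_inv A = mat 1" "matrix_inv A ** A = mat 1"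
  using someI_ex[OF assms[unfolded invertible_def]] by (simp_all add: matrix_inv_def)

lemma matrix_inv_unique':
  assumes "(A::'a::field^'n^'n) ** B = mat 1"
  shows "matrix_inv A = B" "invertible A"
proof -
  show inv: "invertible A"
    using assms by (auto simp: invertible_right_inverse)
  show "matrix_inv A = B"
    by (metis assms inv invertible_matrix_inv(2) matrix_mul_assoc matrix_mul_lid matrix_mul_rid)
qed

lemma GL_iff: "h \<in> GL \<longleftrightarrow> invertible h"
  by (simp add: GL_def)

lemma GL_iff_det: "h \<in> GL \<longleftrightarrow> det h \<noteq> 0"
  by (simp add: GL_def invertible_det_nz)

lemma matrix_inv_GL: "h \<in> GL \<Longrightarrow> matrix_inv h \<in> GL"
  by (metis GL_iff invertible_matrix_inv invertible_left_inverse invertible_right_inverse)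

lemma matrix_inv_mult:
  assumes "g \<in> GL" "h \<in> GL"
  shows "matrix_inv (g ** h) = matrix_inv h ** matrix_inv (g::'a::field^'n^'n)"
  using assms invertible_matrix_inv[of g] invertible_matrix_inv[of h]
  by (intro matrix_inv_unique') (metis GL_iff matrix_mul_assoc matrix_mul_rid)

lemma GL_mult: "g \<in> GL \<Longrightarrow> h \<in> GL \<Longrightarrow> g ** h \<in> (GL :: ('a::field^'n^'n) set)"
  by (simp add: GL_iff invertible_mult)

lemma GL_smat: "c \<noteq> 0 \<Longrightarrow> h \<in> GL \<Longrightarrow> smat c h \<in> GL"
  by (simp add: GL_iff_det det_smat)

lemma matrix_inv_smat:
  assumes "c \<noteq> 0" "h \<in> GL"
  shows "matrix_inv (smat c h) = smat (inverse c) (matrix_inv h)"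
  using assms invertible_matrix_inv[of h]
  by (intro matrix_inv_unique') (simp add: mat_algebra GL_iff)

lemma GL_one: "mat 1 \<in> GL"
  by (simp add: GL_iff_det)

lemma matrix_inv_one: "matrix_inv (mat 1) = (mat 1 :: 'a::field^'n^'n)"
  by (intro matrix_inv_unique') simp

lemma matrix_inv_inv: "h \<in> GL \<Longrightarrow> matrix_inv (matrix_inv h) = h"
  by (intro matrix_inv_unique') (simp add: GL_iff invertible_matrix_inv)

section \<open>Rank, generalized inverses and projections\<close>

definition col_rank :: "'a::field^'n^'n \<Rightarrow> nat" where
  "col_rank X = vec.dim (range ((*v) X))"

lemma col_rank_mult_le_left: "col_rank (A ** B) \<le> col_rank A"
  unfolding col_rank_def by (rule vec.dim_subset) (auto simp: matrix_vector_mul_assoc[symmetric])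

lemma col_rank_mult_le_right: "col_rank (A ** B) \<le> col_rank B"
proof -
  have "range ((*v) (A ** B)) = (*v) A ` range ((*v) B)"
    by (auto simp: matrix_vector_mul_assoc[symmetric])
  then show ?thesis
    unfolding col_rank_def by (simp add: vec.dim_image_le matrix_vector_mul_linear_gen)
qed

lemma col_rank_eq_0_iff: "col_rank X = 0 \<longleftrightarrow> X = 0"
proof -
  have "col_rank X = 0 \<longleftrightarrow> range ((*v) X) \<subseteq> {0}"
    unfolding col_rank_def by simp
  also have "\<dots> \<longleftrightarrow> X = 0"
    by (auto simp: matrix_eq)
  finally show ?thesis .
qed

lemma col_rank_less_iff: "col_rank (X::'a::field^'n^'n) < CARD('n) \<longleftrightarrow> det X = 0"
proof -
  have "col_rank X \<le> CARD('n)"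
    unfolding col_rank_def using vec.dim_subset[of "range ((*v) X)" UNIV] by (simp only: vec_dim_card) simp
  moreover have "col_rank X = CARD('n) \<longleftrightarrow> surj ((*v) X)"
  proof
    assume "col_rank X = CARD('n)"
    then have "range ((*v) X) = UNIV"
      by (intro vec.subspace_dim_equal vec.subspace_UNIV vec.linear_subspace_image
            matrix_vector_mul_linear_gen) (auto simp: col_rank_def vec_dim_card simp del: vec.dim_UNIV)
    then show "surj ((*v) X)" .
  qed (simp add: col_rank_def vec_dim_card del: vec.dim_UNIV)
  moreover have "surj ((*v) X) \<longleftrightarrow> det X \<noteq> 0"
    by (metis invertible_det_nz invertible_right_inverse matrix_right_invertible_surjective)
  ultimately show ?thesis by linarith
qed

lemma col_rank_left_mult_GL:
  assumes "g \<in> GL" shows "col_rank (g ** X) = col_rank X"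
proof (rule antisym[OF col_rank_mult_le_right])
  have "matrix_inv g ** (g ** X) = X"
    using assms by (simp add: matrix_mul_assoc invertible_matrix_inv GL_iff)
  then show "col_rank X \<le> col_rank (g ** X)"
    by (metis col_rank_mult_le_right)
qed

text \<open>A linear section of \<open>X\<close> over its range. It makes \<open>X ** R\<close> a
  projection onto the column space, the \<open>P\<close> of the block coordinates used
  later.\<close>

lemma ex_generalized_inverse: "\<exists>R. X ** R ** X = (X::'a::field^'n^'n)"
proof -
  obtain g where g: "Vector_Spaces.linear (*s) (*s) g" "\<forall>v\<in>range ((*v) X). X *v (g v) = v"
    using vec.linear_exists_right_inverse_on[OF matrix_vector_mul_linear_gen[of X] vec.subspace_UNIV]
    by auto
  have "matrix g *v y = g y" for y
    using matrix_works[OF g(1)] by simp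
  then have "X ** matrix g ** X = X"
    using g(2) by (auto simp: matrix_eq matrix_vector_mul_assoc[symmetric])
  then show ?thesis by blast
qed

lemma inj_on_if_dim_image_ge:
  fixes A :: "'a::field^'n^'n"
  assumes S: "vec.subspace S" and d: "vec.dim S \<le> vec.dim ((*v) A ` S)"
  shows "inj_on ((*v) A) S"
proof -
  obtain B where B: "B \<subseteq> S" "vec.independent B" "S \<subseteq> vec.span B" "card B = vec.dim S"
    using vec.basis_exists by blast
  have fin: "finite B" using B(2) by (rule vec.finiteI_independent)
  have schwartz: "vec.span B = S" using B S by (simp add: vec.span_subspace)
  have sp: "vec.span ((*v) A ` B) = (*v) A ` S"
    using vec.linear_span_image[OF matrix_vector_mul_linear_gen, of A B] schwartz by simp
  have d1: "vec.dim ((*v) A ` S) \<le> card ((*v) A ` B)"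
    using vec.dim_le_card[of "(*v) A ` S" "(*v) A ` B"] sp fin by simp
  have c: "card ((*v) A ` B) \<le> card B" by (rule card_image_le[OF fin])
  then have "card ((*v) A ` B) = card B" using d1 d B(4) by linarith
  then have inj: "inj_on ((*v) A) B" using fin by (simp add: eq_card_imp_inj_on)
  have "vec.independent ((*v) A ` B)"
    using B(1) sp fin d B(4) c
    by (intro vec.card_le_dim_spanning[of _ "(*v) A ` S"]) auto
  then show ?thesis
    using vec.linear_inj_on_span_independent_image[OF matrix_vector_mul_linear_gen _ inj] schwartz by simp
qed

text \<open>\<open>P\<close> maps the column space of \<open>X\<close> onto that of
  \<open>P\<close>, and by the rank bound it does so injectively. Both sides have their columns in
  the column space of \<open>X\<close> and agree after applying \<open>P\<close>.\<close>

lemma factor_through_projection: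
  fixes X :: "'a::field^'n^'n"
  assumes "P ** P = P" "P ** X ** S = P" "col_rank X \<le> col_rank P"
  shows "X ** S ** P ** X = X"
proof -
  have "range ((*v) P) \<subseteq> (*v) P ` range ((*v) X)"
  proof
    fix y assume "y \<in> range ((*v) P)"
    then obtain z where "y = (P ** X ** S) *v z" using assms(2) by auto
    then show "y \<in> (*v) P ` range ((*v) X)"
      by (auto simp: matrix_vector_mul_assoc[symmetric])
  qed
  then have "vec.dim (range ((*v) X)) \<le> vec.dim ((*v) P ` range ((*v) X))"
    using assms(3) vec.dim_subset unfolding col_rank_def by (meson order_trans)
  then have inj: "inj_on ((*v) P) (range ((*v) X))"
    by (intro inj_on_if_dim_image_ge vec.linear_subspace_image matrix_vector_mul_linear_gen vec.subspace_UNIV)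
  have "(X ** S ** P ** X) *v z = X *v z" for z
  proof (rule inj_onD[OF inj])
    have "P ** (X ** S ** P ** X) = P ** X"
      by (metis assms(1,2) matrix_mul_assoc)
    then show "P *v ((X ** S ** P ** X) *v z) = P *v (X *v z)"
      by (simp add: matrix_vector_mul_assoc)
  qed (auto simp: matrix_vector_mul_assoc[symmetric])
  then show ?thesis by (simp add: matrix_eq)
qed

text \<open>A matrix unit joins a nonzero column of \<open>Q\<close> to a nonzero row of
  \<open>P\<close>. For complementary projections this shows that the off-diagonal block is nonzero,
  which is why the index \<kappa> will differ from 1.\<close>

lemma ex_two_sided_mult_nz:
  fixes Q P :: "'a::field^'n^'n"
  assumes "Q \<noteq> 0" "P \<noteq> 0" shows "\<exists>E. Q ** E ** P \<noteq> 0"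
proof -
  obtain i j where ij: "Q $ i $ j \<noteq> 0" using assms(1) by (auto simp: vec_eq_iff)
  obtain k l where kl: "P $ k $ l \<noteq> 0" using assms(2) by (auto simp: vec_eq_iff)
  define E :: "'a^'n^'n" where "E = (\<chi> a b. if a = j \<and> b = k then 1 else 0)"
  have QE: "(Q ** E) $ i $ b = (if b = k then Q $ i $ j else 0)" for b
  proof -
    have "(Q ** E) $ i $ b = (\<Sum>a\<in>UNIV. Q $ i $ a * (if a = j then if b = k then 1 else 0 else 0))"
      unfolding matrix_matrix_mult_def E_def by (simp add: if_distrib cong: if_cong) (auto intro!: sum.cong)
    also have "\<dots> = (if b = k then Q $ i $ j else 0)"
      by (simp add: if_distrib cong: if_cong)
    finally show ?thesis .
  qed
  have "(Q ** E ** P) $ i $ l = (\<Sum>b\<in>UNIV. (Q ** E) $ i $ b * P $ b $ l)"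
    unfolding matrix_matrix_mult_def[of "Q ** E"] by simp
  also have "\<dots> = (\<Sum>b\<in>UNIV. if b = k then Q $ i $ j * P $ b $ l else 0)"
    by (intro sum.cong) (auto simp: QE)
  also have "\<dots> = Q $ i $ j * P $ k $ l" by simp
  finally have "(Q ** E ** P) $ i $ l \<noteq> 0" using ij kl by simp
  then show ?thesis by (metis zero_index)
qed

subsection \<open>Matrices over a local field\<close>

lemma compact_vec_box:
  assumes "compact (S::'a::topological_space set)"
  shows "compact {x::'a^'n. \<forall>i. x $ i \<in> S}"
proof -
  have "compactin (product_topology (\<lambda>_. euclidean) UNIV) (PiE UNIV (\<lambda>_::'n. S))"
    using assms by (simp add: compactin_PiE)
  moreover have "continuous_map (product_topology (\<lambda>_. euclidean) UNIV) euclidean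
      (vec_lambda :: ('n \<Rightarrow> 'a) \<Rightarrow> 'a^'n)"
    unfolding continuous_map_def
  proof (intro conjI allI impI)
    fix U :: "('a^'n) set" assume "openin euclidean U"
    then have U: "open U" by simp
    have "\<exists>A. (\<forall>i\<in>UNIV. openin euclidean (A i)) \<and> f \<in> PiE UNIV A
        \<and> PiE UNIV A \<subseteq> {x. vec_lambda x \<in> U}" if fU: "vec_lambda f \<in> U" for f
    proof -
      obtain A where A: "\<forall>i. open (A i) \<and> vec_lambda f $ i \<in> A i" "\<forall>y. (\<forall>i. y $ i \<in> A i) \<longrightarrow> y \<in> U"
        using U fU unfolding open_vec_def by blast
      then show ?thesis by (intro exI[of _ A]) (auto simp: PiE_iff)
    qed
    then show "openin (product_topology (\<lambda>_. euclidean) UNIV)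
        {x \<in> topspace (product_topology (\<lambda>_. euclidean) UNIV). vec_lambda x \<in> U}"
      by (simp add: openin_product_topology_alt)
  qed simp
  ultimately have "compact (vec_lambda ` (PiE UNIV (\<lambda>_::'n. S)) :: ('a^'n) set)"
    using image_compactin compactin_euclidean_iff by blast
  moreover have "vec_lambda ` (PiE UNIV (\<lambda>_::'n. S)) = {x::'a^'n. \<forall>i. x $ i \<in> S}"
  proof (intro set_eqI iffI)
    fix x :: "'a^'n" assume "x \<in> {x. \<forall>i. x $ i \<in> S}"
    then show "x \<in> vec_lambda ` (PiE UNIV (\<lambda>_::'n. S))"
      by (intro image_eqI[of _ _ "\<lambda>i. x $ i"]) auto
  qed auto
  ultimately show ?thesis by simp
qed

context uniformized
begin

text \<open>The lattice of matrices with entries in the fractional ideal generated by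
  \<open>\<pi> powi k\<close>: \<open>M 0\<close> is the ring of integral matrices,
  \<open>M 1\<close> the kernel of its reduction. These lattices form a neighbourhood basis of
  0.\<close>

definition M :: "int \<Rightarrow> ('a^'n^'n) set" where
  "M k = {X. \<forall>i j. v (X $ i $ j) \<le> q k}"

lemma M_add: "X \<in> M k \<Longrightarrow> Y \<in> M k \<Longrightarrow> X + Y \<in> M k"
  by (auto simp: M_def intro!: v_add_le)

lemma M_diff: "X \<in> M k \<Longrightarrow> Y \<in> M k \<Longrightarrow> X - Y \<in> M k"
  by (auto simp: M_def intro!: v_diff_le)

lemma M_minus: "X \<in> M k \<Longrightarrow> - X \<in> M k"
  by (auto simp: M_def)

lemma M_0 [simp]: "0 \<in> M k"
  by (auto simp: M_def)

lemma M_one [simp]: "mat 1 \<in> M 0"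
  by (auto simp: M_def mat_def)

lemma M_mono: "X \<in> M a \<Longrightarrow> b \<le> a \<Longrightarrow> X \<in> M b"
  unfolding M_def using q_le_iff order_trans by blast

lemma M_minus_commute: "X - Y \<in> M k \<longleftrightarrow> Y - X \<in> M k"
  using M_minus[of "X - Y" k] M_minus[of "Y - X" k] by auto

lemma M_diff_trans: "X - Y \<in> M k \<Longrightarrow> Y - Z \<in> M k \<Longrightarrow> X - Z \<in> M k"
  using M_add[of "X - Y" k "Y - Z"] by simp

lemma M_shift_iff: "X - Y \<in> M k \<Longrightarrow> X \<in> M k \<longleftrightarrow> Y \<in> M k"
  using M_add[of "X - Y" k Y] M_diff[of X k "X - Y"] by auto

lemma M_mult: "X \<in> M a \<Longrightarrow> Y \<in> M b \<Longrightarrow> X ** Y \<in> M (a + b)"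
  unfolding M_def matrix_matrix_mult_def
  by (auto simp: v_mult q_add intro!: v_sum_le mult_mono)

lemma M_mult_0_left: "X \<in> M 0 \<Longrightarrow> Y \<in> M b \<Longrightarrow> X ** Y \<in> M b"
  using M_mult[of X 0 Y b] by simp

lemma M_mult_0_right: "X \<in> M a \<Longrightarrow> Y \<in> M 0 \<Longrightarrow> X ** Y \<in> M a"
  using M_mult[of X a Y 0] by simp

lemma M_smat: "v c \<le> q a \<Longrightarrow> X \<in> M b \<Longrightarrow> smat c X \<in> M (a + b)"
  unfolding M_def by (auto simp: v_mult q_add intro!: mult_mono)

lemma M_smat_powi: "smat (\<pi> powi a) X \<in> M (a + b) \<longleftrightarrow> X \<in> M b"
  unfolding M_def by (auto simp: v_mult v_power_int q_add)

lemma M_smat_unif: "smat \<pi> X \<in> M (b + 1) \<longleftrightarrow> X \<in> M b"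
  using M_smat_powi[of 1 X b] by (simp add: add.commute)

lemma ex_M: "\<exists>k\<ge>0. X \<in> M (- k)"
proof -
  define m where "m = Max (range (\<lambda>(i, j). v (X $ i $ j)))"
  have m: "v (X $ i $ j) \<le> m" for i j
    unfolding m_def by (rule Max_ge) (auto intro: rev_image_eqI[of "(i, j)"])
  obtain k where "k \<ge> 0" "m < q (- k)" using q_arbitrarily_large by blast
  moreover from this have "v (X $ i $ j) \<le> q (- k)" for i j using m[of i j] by linarith
  ultimately show ?thesis by (auto simp: M_def)
qed

lemma ex_M_boundary: assumes "X \<noteq> 0" shows "\<exists>k. X \<in> M k \<and> X \<notin> M (k + 1)"
proof -
  obtain a where a: "a \<ge> 0" "X \<in> M (- a)" using ex_M by blast
  obtain i j where ij: "X $ i $ j \<noteq> 0" using assms by (auto simp: vec_eq_iff)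
  then obtain b where b: "q b < v (X $ i $ j)" using ex_q_less by (metis v_pos_iff)
  define S where "S = {k. X \<in> M k \<and> - a \<le> k}"
  have "S \<subseteq> {-a..b}"
  proof
    fix k assume "k \<in> S"
    then have "v (X $ i $ j) \<le> q k" by (auto simp: S_def M_def)
    then have "q b < q k" using b by linarith
    then show "k \<in> {-a..b}" using \<open>k \<in> S\<close> by (auto simp: S_def)
  qed
  then have fin: "finite S" by (rule finite_subset) simp
  have "- a \<in> S" using a by (auto simp: S_def)
  then have "Max S \<in> S" "Max S + 1 \<notin> S"
    using Max_in[OF fin] Max_ge[OF fin, of "Max S + 1"] by auto
  then show ?thesis by (auto simp: S_def)
qed

text \<open>The determinant is a polynomial with integer coefficients, so it respects congruences
  between integral matrices; the products in its expansion are compared one factor at a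
  time.\<close>

lemma v_det_diff_le:
  assumes "A \<in> M 0" "B \<in> M 0" "A - B \<in> M k" "0 \<le> k"
  shows "v (det A - det B) \<le> q k"
proof -
  have pr: "v (prod f I - prod g I) \<le> q k \<and> v (prod f I) \<le> 1"
    if "finite I" "\<forall>i. v (f i) \<le> 1" "\<forall>i. v (g i) \<le> 1" "\<forall>i. v (f i - g i) \<le> q k" for f g and I :: "'c set"
    using that(1)
  proof (induction I rule: finite_induct)
    case (insert x I)
    have "f x * prod f I - g x * prod g I = (f x - g x) * prod f I + g x * (prod f I - prod g I)"
      by (simp add: algebra_simps)
    moreover have "v ((f x - g x) * prod f I) \<le> q k * 1"
      unfolding v_mult using insert that by (intro mult_mono) auto
    moreover have "v (g x * (prod f I - prod g I)) \<le> 1 * q k"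
      unfolding v_mult using insert that by (intro mult_mono) auto
    moreover have "v (f x * prod f I) \<le> 1 * 1"
      unfolding v_mult using insert that by (intro mult_mono) auto
    ultimately show ?case
      using insert by (auto intro!: v_add_le)
  qed auto
  have "v (of_int (sign p) * (\<Prod>i\<in>UNIV. A $ i $ p i) - of_int (sign p) * (\<Prod>i\<in>UNIV. B $ i $ p i)) \<le> q k" for p
  proof -
    have "v ((\<Prod>i\<in>UNIV. A $ i $ p i) - (\<Prod>i\<in>UNIV. B $ i $ p i)) \<le> q k"
      using pr[of UNIV "\<lambda>i. A $ i $ p i" "\<lambda>i. B $ i $ p i"] assms by (simp add: M_def)
    then show ?thesis
      by (cases "sign p = 1") (auto simp: sign_def v_minus_commute)
  qed
  then show ?thesis
    unfolding det_def sum_subtractf[symmetric] by (intro v_sum_le) auto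
qed

lemma v_det_le_1: assumes "(A::'a^'n^'n) \<in> M 0" shows "v (det A) \<le> 1"
proof -
  have "A - 0 \<in> M 0" using assms by simp
  then have "v (det A - det (0::'a^'n^'n)) \<le> q 0"
    by (intro v_det_diff_le) (use assms in auto)
  moreover have "det (0::'a^'n^'n) = 0" by (rule det_zero_row) (simp add: row_def vec_eq_iff)
  ultimately show ?thesis by simp
qed

lemma det_one_plus: assumes "(C::'a^'n^'n) \<in> M 1" shows "v (det (mat 1 + C)) = 1"
proof -
  have "v (det (mat 1 + C) - det (mat 1 :: 'a^'n^'n)) \<le> q 1"
    using assms by (intro v_det_diff_le) (auto intro!: M_add M_mono[of C 1 0])
  also have "\<dots> < v 1" using unif_less by simp
  finally show ?thesis using v_eq_if_close[of "det (mat 1 + C)" 1] by simp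
qed

text \<open>Cramer's rule: each entry of the inverse is the determinant of an integral matrix
  divided by \<open>det A\<close>.\<close>

lemma matrix_inv_M0:
  assumes "(A::'a^'n^'n) \<in> M 0" "v (det A) \<ge> q b" shows "matrix_inv A \<in> M (- b)"
proof -
  have dnz: "det A \<noteq> 0" using assms(2) q_pos[of b] by (metis not_le v_0)
  have inv: "A ** matrix_inv A = mat 1"
    using dnz by (simp add: invertible_matrix_inv invertible_det_nz)
  have "v (matrix_inv A $ k $ l) \<le> q (- b)" for k l
  proof -
    define x where "x = column l (matrix_inv A)"
    have Ax: "(A *v x) $ i = mat 1 $ i $ l" for i
      using inv by (auto simp: x_def vec_eq_iff matrix_vector_mult_def matrix_matrix_mult_def column_def)
    define D where "D = (\<chi> i j. if j = k then (A *v x) $ i else A $ i $ j)"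
    have "D \<in> M 0" using assms(1) by (auto simp: D_def M_def Ax mat_def)
    then have "v (det D) \<le> 1" by (rule v_det_le_1)
    moreover have "det D = x $ k * det A" unfolding D_def by (rule cramer_lemma)
    ultimately have "v (x $ k) * v (det A) \<le> 1" by (simp add: v_mult)
    then have "v (x $ k) * q b \<le> 1"
      using assms(2) by (meson mult_left_mono order_trans v_nonneg)
    then show ?thesis by (simp add: x_def column_def power_int_minus field_simps)
  qed
  then show ?thesis by (simp add: M_def)
qed

text \<open>Scaling into \<open>M 0\<close> reduces this to the integral case; the multiple of
  \<open>a\<close> reflects that the adjugate is homogeneous of degree
  \<open>CARD('n) - 1\<close>.\<close>

lemma matrix_inv_M:
  assumes "(A::'a^'n^'n) \<in> M a" "v (det A) \<ge> q b"
  shows "matrix_inv A \<in> M ((int CARD('n) - 1) * a - b)"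
proof -
  have dnz: "det A \<noteq> 0" using assms(2) q_pos[of b] by (metis not_le v_0)
  define B where "B = smat (\<pi> powi (- a)) A"
  have "B \<in> M 0" using M_smat_powi[of "-a" A a] assms by (simp add: B_def)
  moreover have "v (det B) = q (- a * int CARD('n)) * v (det A)"
    unfolding B_def det_smat v_mult v_power v_power_int
    by (simp only: power_int_mult power_int_of_nat)
  then have "v (det B) \<ge> q (b - a * int CARD('n))"
    using assms(2) by (simp add: q_add[symmetric] mult_left_mono)
       (metis q_add q_nonneg diff_conv_add_uminus mult.commute mult_left_mono)
  ultimately have "matrix_inv B \<in> M (- (b - a * int CARD('n)))" by (rule matrix_inv_M0)
  moreover have "matrix_inv A = smat (\<pi> powi (- a)) (matrix_inv B)"
    unfolding B_def using dnz
    by (simp add: matrix_inv_smat GL_iff_det smat_smat power_int_minus)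
  ultimately have "matrix_inv A \<in> M (- a + - (b - a * int CARD('n)))"
    by (simp only: M_smat_powi)
  then show ?thesis by (simp add: algebra_simps)
qed

lemma one_plus_GL: "C \<in> M 1 \<Longrightarrow> mat 1 + C \<in> GL"
  using det_one_plus[of C] by (auto simp: GL_iff_det)

lemma matrix_inv_one_plus: "C \<in> M k \<Longrightarrow> 1 \<le> k \<Longrightarrow> matrix_inv (mat 1 + C) - mat 1 \<in> M k"
proof -
  assume C: "C \<in> M k" and k: "1 \<le> k"
  then have C1: "C \<in> M 1" by (rule M_mono)
  have I: "matrix_inv (mat 1 + C) \<in> M 0"
    using matrix_inv_M0[of "mat 1 + C" 0] det_one_plus[OF C1] M_add[OF M_one M_mono[OF C1, of 0]]
    by simp
  have "matrix_inv (mat 1 + C) ** (mat 1 + C) = mat 1"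
    using one_plus_GL[OF C1] by (simp add: GL_iff invertible_matrix_inv)
  then have "matrix_inv (mat 1 + C) - mat 1 = - (matrix_inv (mat 1 + C) ** C)"
    by (simp add: matrix_add_ldistrib algebra_simps eq_neg_iff_add_eq_0)
  then show ?thesis using I C by (simp add: M_minus M_mult_0_left)
qed

lemma open_vec_iff:
  "open (V::('a^'n) set) \<longleftrightarrow> (\<forall>x\<in>V. \<exists>k. \<forall>y. (\<forall>i. v (y $ i - x $ i) \<le> q k) \<longrightarrow> y \<in> V)"
proof
  assume V: "open V"
  show "\<forall>x\<in>V. \<exists>k. \<forall>y. (\<forall>i. v (y $ i - x $ i) \<le> q k) \<longrightarrow> y \<in> V"
  proof
    fix x assume "x \<in> V"
    then obtain A where A: "\<forall>i. open (A i) \<and> x $ i \<in> A i" "\<forall>y. (\<forall>i. y $ i \<in> A i) \<longrightarrow> y \<in> V"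
      using V unfolding open_vec_def by meson
    have "\<exists>k. \<forall>z. v (z - x $ i) \<le> q k \<longrightarrow> z \<in> A i" for i
    proof -
      obtain e where e: "e > 0" "\<forall>z. v (z - x $ i) < e \<longrightarrow> z \<in> A i"
        using A(1) open_iff_ball by blast
      obtain k where "q k < e" using ex_q_less[OF e(1)] by blast
      then show ?thesis using e by (meson le_less_trans)
    qed
    then obtain f where f: "\<And>i z. v (z - x $ i) \<le> q (f i) \<Longrightarrow> z \<in> A i" by metis
    define k where "k = Max (range f)"
    have "q k \<le> q (f i)" for i by (simp add: k_def)
    then have "\<forall>y. (\<forall>i. v (y $ i - x $ i) \<le> q k) \<longrightarrow> y \<in> V"
      using A(2) f by (meson order_trans)
    then show "\<exists>k. \<forall>y. (\<forall>i. v (y $ i - x $ i) \<le> q k) \<longrightarrow> y \<in> V" by blast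
  qed
next
  assume r: "\<forall>x\<in>V. \<exists>k. \<forall>y. (\<forall>i. v (y $ i - x $ i) \<le> q k) \<longrightarrow> y \<in> V"
  show "open V"
    unfolding open_vec_def
  proof
    fix x assume "x \<in> V"
    then obtain k where k: "\<forall>y. (\<forall>i. v (y $ i - x $ i) \<le> q k) \<longrightarrow> y \<in> V" using r by blast
    then show "\<exists>A. (\<forall>i. open (A i) \<and> x $ i \<in> A i) \<and> (\<forall>y. (\<forall>i. y $ i \<in> A i) \<longrightarrow> y \<in> V)"
      by (intro exI[of _ "\<lambda>i. {z. v (z - x $ i) \<le> q k}"]) (auto simp: open_v_le)
  qed
qed

lemma open_mat_iff: "open (U::('a^'n^'n) set) \<longleftrightarrow> (\<forall>X\<in>U. \<exists>k. \<forall>Y. Y - X \<in> M k \<longrightarrow> Y \<in> U)"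
proof
  assume U: "open U"
  show "\<forall>X\<in>U. \<exists>k. \<forall>Y. Y - X \<in> M k \<longrightarrow> Y \<in> U"
  proof
    fix X assume "X \<in> U"
    then obtain A where A: "\<forall>i. open (A i) \<and> X $ i \<in> A i" "\<forall>y. (\<forall>i. y $ i \<in> A i) \<longrightarrow> y \<in> U"
      using U[unfolded open_vec_def[of U]] by blast
    have "\<exists>k. \<forall>y. (\<forall>j. v (y $ j - X $ i $ j) \<le> q k) \<longrightarrow> y \<in> A i" for i
    proof -
      have "open (A i)" "X $ i \<in> A i" using A(1) by auto
      then show ?thesis using open_vec_iff[of "A i"] by simp
    qed
    then obtain f where f: "\<And>i y. (\<forall>j. v (y $ j - X $ i $ j) \<le> q (f i)) \<Longrightarrow> y \<in> A i" by metis
    define k where "k = Max (range f)"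
    have "q k \<le> q (f i)" for i by (simp add: k_def)
    have "Y \<in> U" if Y: "Y - X \<in> M k" for Y
    proof -
      have "v (Y $ i $ j - X $ i $ j) \<le> q k" for i j
        using Y by (simp add: M_def)
      then have "v (Y $ i $ j - X $ i $ j) \<le> q (f i)" for i j
        using \<open>\<And>i. q k \<le> q (f i)\<close> order_trans by blast
      then show ?thesis using A(2) f by blast
    qed
    then show "\<exists>k. \<forall>Y. Y - X \<in> M k \<longrightarrow> Y \<in> U" by blast
  qed
next
  assume r: "\<forall>X\<in>U. \<exists>k. \<forall>Y. Y - X \<in> M k \<longrightarrow> Y \<in> U"
  show "open U"
    unfolding open_vec_def[of U]
  proof
    fix X assume "X \<in> U"
    then obtain k where k: "\<forall>Y. Y - X \<in> M k \<longrightarrow> Y \<in> U" using r by blast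
    have "open {y. \<forall>j. y $ j \<in> {z. v (z - X $ i $ j) \<le> q k}}" for i
      by (intro open_vector_box allI open_v_le) simp
    then show "\<exists>A. (\<forall>i. open (A i) \<and> X $ i \<in> A i) \<and> (\<forall>y. (\<forall>i. y $ i \<in> A i) \<longrightarrow> y \<in> U)"
      using k by (intro exI[of _ "\<lambda>i. {y. \<forall>j. y $ j \<in> {z. v (z - X $ i $ j) \<le> q k}}"])
        (auto simp: M_def)
  qed
qed

lemma open_mat_ball: "open {Y. Y - X \<in> M k}"
  unfolding open_mat_iff using M_add[of _ k] by (force intro: exI[of _ k] simp: M_diff_trans)

lemma open_mat_prod_iff:
  "open (W::(('a^'n^'n) \<times> ('a^'n^'n)) set) \<longleftrightarrow>
     (\<forall>X Y. (X, Y) \<in> W \<longrightarrow> (\<exists>k. \<forall>X' Y'. X' - X \<in> M k \<longrightarrow> Y' - Y \<in> M k \<longrightarrow> (X', Y') \<in> W))"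
proof (intro iffI allI impI)
  fix X Y assume "open W" "(X, Y) \<in> W"
  then obtain A B where AB: "open A" "open B" "(X, Y) \<in> A \<times> B" "A \<times> B \<subseteq> W"
    by (rule open_prod_elim)
  obtain a where a: "\<forall>X'. X' - X \<in> M a \<longrightarrow> X' \<in> A" using AB open_mat_iff by blast
  obtain b where b: "\<forall>Y'. Y' - Y \<in> M b \<longrightarrow> Y' \<in> B" using AB open_mat_iff by blast
  have "\<forall>X' Y'. X' - X \<in> M (max a b) \<longrightarrow> Y' - Y \<in> M (max a b) \<longrightarrow> (X', Y') \<in> W"
    using a b AB M_mono[of _ "max a b" a] M_mono[of _ "max a b" b] by fastforce
  then show "\<exists>k. \<forall>X' Y'. X' - X \<in> M k \<longrightarrow> Y' - Y \<in> M k \<longrightarrow> (X', Y') \<in> W" by blast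
next
  assume r: "\<forall>X Y. (X, Y) \<in> W \<longrightarrow> (\<exists>k. \<forall>X' Y'. X' - X \<in> M k \<longrightarrow> Y' - Y \<in> M k \<longrightarrow> (X', Y') \<in> W)"
  show "open W"
  proof (rule open_prod_intro)
    fix x assume "x \<in> W"
    obtain X Y where x: "x = (X, Y)" by fastforce
    then obtain k where "\<forall>X' Y'. X' - X \<in> M k \<longrightarrow> Y' - Y \<in> M k \<longrightarrow> (X', Y') \<in> W" using r \<open>x \<in> W\<close> by blast
    then show "\<exists>A B. open A \<and> open B \<and> x \<in> A \<times> B \<and> A \<times> B \<subseteq> W"
      using x by (intro exI[of _ "{Z. Z - X \<in> M k}"] exI[of _ "{Z. Z - Y \<in> M k}"]) (auto simp: open_mat_ball)
  qed
qed

lemma compact_M: "compact (M k :: ('a^'n^'n) set)"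
proof -
  have "compact {X::'a^'n^'n. \<forall>i. X $ i \<in> {x. \<forall>j. x $ j \<in> {z. v z \<le> q k}}}"
    by (intro compact_vec_box compact_v_le) simp
  then show ?thesis by (simp add: M_def)
qed

lemma finite_net: "\<exists>F::('a^'n^'n) set. finite F \<and> F \<subseteq> M a \<and> (\<forall>X\<in>M a. \<exists>Y\<in>F. X - Y \<in> M b)"
proof -
  have "(M a :: ('a^'n^'n) set) \<subseteq> (\<Union>Y\<in>M a. {X. X - Y \<in> M b})" by force
  then obtain F :: "('a^'n^'n) set" where "F \<subseteq> M a" "finite F" "M a \<subseteq> (\<Union>Y\<in>F. {X. X - Y \<in> M b})"
    using compactE_image[OF compact_M, of "M a" "\<lambda>Y. {X. X - Y \<in> M b}" a] open_mat_ball by blast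
  then show ?thesis by (intro exI[of _ F]) auto
qed

text \<open>A Lebesgue number argument on the compact set \<open>M a \<times> M a\<close>. The
  hypothesis lets the property survive moving the centre and raising the exponent, so the largest
  exponent of a finite subcover works everywhere.\<close>

lemma uniform_radius:
  fixes Pr :: "'a^'n^'n \<Rightarrow> 'a^'n^'n \<Rightarrow> int \<Rightarrow> bool"
  assumes "\<And>X Y. X \<in> M a \<Longrightarrow> Y \<in> M a \<Longrightarrow>
    \<exists>m. \<forall>X' Y' m'. X' - X \<in> M m \<longrightarrow> Y' - Y \<in> M m \<longrightarrow> m \<le> m' \<longrightarrow> Pr X' Y' m'"
  shows "\<exists>m. \<forall>X\<in>M a. \<forall>Y\<in>M a. \<forall>m'\<ge>m. Pr X Y m'"
proof -
  obtain f where f: "\<And>X Y X' Y' m'. X \<in> M a \<Longrightarrow> Y \<in> M a \<Longrightarrow>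
     X' - X \<in> M (f X Y) \<Longrightarrow> Y' - Y \<in> M (f X Y) \<Longrightarrow> f X Y \<le> m' \<Longrightarrow> Pr X' Y' m'"
    using assms by metis
  define B where "B = (\<lambda>(X, Y). {Z. Z - X \<in> M (f X Y)} \<times> {Z. Z - Y \<in> M (f X Y)})"
  have "compact (M a \<times> M a :: (('a^'n^'n) \<times> ('a^'n^'n)) set)"
    by (intro compact_Times compact_M)
  moreover have "open (B x)" if "x \<in> M a \<times> M a" for x
    unfolding B_def by (auto split: prod.split intro!: open_Times open_mat_ball)
  moreover have "M a \<times> M a \<subseteq> (\<Union>x\<in>M a \<times> M a. B x)"
    unfolding B_def by fastforce
  ultimately obtain F where F: "F \<subseteq> M a \<times> M a" "finite F" "M a \<times> M a \<subseteq> (\<Union>x\<in>F. B x)"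
    by (rule compactE_image)
  define m where "m = Max ((\<lambda>(X, Y). f X Y) ` F)"
  have "Pr X Y m'" if XY: "X \<in> M a" "Y \<in> M a" "m \<le> m'" for X Y m'
  proof -
    obtain X0 Y0 where 0: "(X0, Y0) \<in> F" "(X, Y) \<in> B (X0, Y0)" using F(3) XY by fastforce
    then have "f X0 Y0 \<le> m" unfolding m_def using F(2) by (auto intro!: Max_ge)
    then show ?thesis using 0 F(1) XY f[of X0 Y0 X Y m'] by (auto simp: B_def)
  qed
  then show ?thesis by blast
qed

end

subsection \<open>Transversals\<close>

definition add_subgroup :: "'g::ab_group_add set \<Rightarrow> bool" where
  "add_subgroup H \<longleftrightarrow> 0 \<in> H \<and> (\<forall>x\<in>H. \<forall>y\<in>H. x - y \<in> H)"

lemma add_subgroupD: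
  assumes "add_subgroup H"
  shows "0 \<in> H" "x \<in> H \<Longrightarrow> y \<in> H \<Longrightarrow> x - y \<in> H" "x \<in> H \<Longrightarrow> - x \<in> H"
    "x \<in> H \<Longrightarrow> y \<in> H \<Longrightarrow> x + y \<in> H" "x - y \<in> H \<Longrightarrow> y - x \<in> H"
    "x - y \<in> H \<Longrightarrow> y - z \<in> H \<Longrightarrow> x - z \<in> H"
proof -
  have 0: "0 \<in> H" and d: "\<And>x y. x \<in> H \<Longrightarrow> y \<in> H \<Longrightarrow> x - y \<in> H"
    using assms by (auto simp: add_subgroup_def)
  have m: "- x \<in> H" if "x \<in> H" for x using d[OF 0 that] by simp
  show "0 \<in> H" "x \<in> H \<Longrightarrow> y \<in> H \<Longrightarrow> x - y \<in> H" "x \<in> H \<Longrightarrow> - x \<in> H"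
    by (fact 0, fact d, fact m)
  show "x \<in> H \<Longrightarrow> y \<in> H \<Longrightarrow> x + y \<in> H" using d[of x "- y"] m[of y] by simp
  show "x - y \<in> H \<Longrightarrow> y - x \<in> H" using m[of "x - y"] by simp
  show "x - y \<in> H \<Longrightarrow> y - z \<in> H \<Longrightarrow> x - z \<in> H"
    using d[of "x - y" "- (y - z)"] m[of "y - z"] by simp
qed

definition transversal :: "'g::ab_group_add set \<Rightarrow> 'g set \<Rightarrow> 'g set \<Rightarrow> bool" where
  "transversal R H H' \<longleftrightarrow> finite R \<and> R \<subseteq> H \<and> (\<forall>x\<in>H. \<exists>!r. r \<in> R \<and> x - r \<in> H')"

text \<open>The points of \<open>F\<close> need not lie in \<open>H\<close>. A coset
  \<open>c x\<close> is instead recognized by the set \<open>d x\<close> of points of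
  \<open>F\<close> congruent to \<open>x\<close>, and \<open>F\<close> has only finitely many
  subsets.\<close>

lemma ex_transversal:
  assumes H': "add_subgroup H'" and F: "finite F" "\<And>x. x \<in> H \<Longrightarrow> \<exists>y\<in>F. x - y \<in> H'"
  shows "\<exists>R. transversal R H H'"
proof -
  define c where "c x = {y \<in> H. x - y \<in> H'}" for x
  have c_eq: "c x = c y" if "x - y \<in> H'" for x y
    using add_subgroupD(5,6)[OF H'] that unfolding c_def by blast
  have in_c: "x \<in> c x" if "x \<in> H" for x
    using add_subgroupD(1)[OF H'] that by (auto simp: c_def)
  define d where "d x = {f \<in> F. x - f \<in> H'}" for x
  have cd: "c x = c y" if xy: "x \<in> H" "d x = d y" for x y
  proof -
    obtain f where "f \<in> F" "x - f \<in> H'" using F(2) xy by blast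
    then have "x - f \<in> H'" "y - f \<in> H'" using xy by (auto simp: d_def)
    then show ?thesis using c_eq by metis
  qed
  moreover have "finite (d ` H)"
    by (rule finite_subset[of _ "Pow F"]) (auto simp: d_def F(1))
  moreover have "c ` H \<subseteq> (\<lambda>D. c (SOME x. x \<in> H \<and> d x = D)) ` d ` H"
  proof
    fix C assume "C \<in> c ` H"
    then obtain x where x: "x \<in> H" "C = c x" by blast
    define x' where "x' = (SOME y. y \<in> H \<and> d y = d x)"
    have "x' \<in> H \<and> d x' = d x" unfolding x'_def by (rule someI[of _ x]) (use x in simp)
    then have "c x' = C" using cd x by metis
    then show "C \<in> (\<lambda>D. c (SOME x. x \<in> H \<and> d x = D)) ` d ` H"
      using x by (auto simp: x'_def image_iff)
  qed
  ultimately have "finite (c ` H)" by (meson finite_imageI finite_subset)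
  define R where "R = (\<lambda>C. SOME y. y \<in> C) ` (c ` H)"
  have rep: "(SOME y. y \<in> c x) \<in> c x" if "x \<in> H" for x
    using in_c[OF that] by (rule someI)
  have "finite R" using \<open>finite (c ` H)\<close> by (simp add: R_def)
  moreover have "R \<subseteq> H" using rep by (auto simp: R_def c_def)
  moreover have "\<exists>!r. r \<in> R \<and> x - r \<in> H'" if x: "x \<in> H" for x
  proof (rule ex1I[of _ "SOME y. y \<in> c x"])
    show "(SOME y. y \<in> c x) \<in> R \<and> x - (SOME y. y \<in> c x) \<in> H'"
    proof
      show "(SOME y. y \<in> c x) \<in> R" using x unfolding R_def by blast
      show "x - (SOME y. y \<in> c x) \<in> H'" using rep[OF x] unfolding c_def by blast
    qed
    fix r assume r: "r \<in> R \<and> x - r \<in> H'"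
    then obtain x0 where x0: "x0 \<in> H" "r = (SOME y. y \<in> c x0)" by (auto simp: R_def)
    then have "x0 - r \<in> H'" using rep[of x0] by (auto simp: c_def)
    then have "c x0 = c x" using r c_eq by metis
    then show "r = (SOME y. y \<in> c x)" using x0 by simp
  qed
  ultimately have "transversal R H H'" unfolding transversal_def by blast
  then show ?thesis ..
qed

lemma transversal_sum_eq:
  assumes H': "add_subgroup H'" and R: "transversal R H H'" "transversal R' H H'"
    and f: "\<And>x y. x \<in> H \<Longrightarrow> y \<in> H \<Longrightarrow> x - y \<in> H' \<Longrightarrow> f x = f y"
  shows "sum f R = sum f R'"
proof -
  define s where "s A x = (THE r. r \<in> A \<and> x - r \<in> H')" for A x
  have s: "s A x \<in> A \<and> x - s A x \<in> H'" "\<And>r. r \<in> A \<Longrightarrow> x - r \<in> H' \<Longrightarrow> s A x = r"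
    if "transversal A H H'" "x \<in> H" for A x
  proof -
    have "\<exists>!r. r \<in> A \<and> x - r \<in> H'" using that by (auto simp: transversal_def)
    then show "s A x \<in> A \<and> x - s A x \<in> H'" "\<And>r. r \<in> A \<Longrightarrow> x - r \<in> H' \<Longrightarrow> s A x = r"
      unfolding s_def by (rule theI', auto)
  qed
  have sub: "R \<subseteq> H" "R' \<subseteq> H" using R by (auto simp: transversal_def)
  show ?thesis
  proof (rule sum.reindex_bij_witness[of _ "s R" "s R'"])
    fix a assume a: "a \<in> R"
    have "s R' a \<in> R'" "a - s R' a \<in> H'" using s(1)[OF R(2), of a] a sub by auto
    then show "s R' a \<in> R'" "s R (s R' a) = a" "f (s R' a) = f a"
      using s(2)[OF R(1), of "s R' a" a] a sub add_subgroupD(5)[OF H'] f[of a "s R' a"] by (auto simp: subset_iff)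
  next
    fix a assume a: "a \<in> R'"
    have "s R a \<in> R" "a - s R a \<in> H'" using s(1)[OF R(1), of a] a sub by auto
    then show "s R a \<in> R" "s R' (s R a) = a"
      using s(2)[OF R(2), of "s R a" a] a sub add_subgroupD(5)[OF H'] by auto
  qed
qed

lemma transversal_shift:
  assumes H: "add_subgroup H" and R: "transversal R H H'" and y: "y \<in> H"
  shows "transversal ((+) y ` R) H H'"
  unfolding transversal_def
proof (intro conjI ballI)
  show "finite ((+) y ` R)" "(+) y ` R \<subseteq> H"
    using R y add_subgroupD(4)[OF H] by (auto simp: transversal_def)
  fix x assume x: "x \<in> H"
  then have "\<exists>!r. r \<in> R \<and> (x - y) - r \<in> H'"
    using R add_subgroupD(2)[OF H x y] by (auto simp: transversal_def)
  then show "\<exists>!r. r \<in> (+) y ` R \<and> x - r \<in> H'"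
    by (auto simp: algebra_simps)
qed

lemma transversal_restrict:
  assumes K: "add_subgroup K" "H' \<subseteq> K" "K \<subseteq> H" and R: "transversal R H H'"
  shows "transversal (R \<inter> K) K H'"
  unfolding transversal_def
proof (intro conjI ballI)
  fix x assume x: "x \<in> K"
  have "r \<in> K" if "x - r \<in> H'" for r
    using add_subgroupD(2)[OF K(1) x, of "x - r"] K(2) that by auto
  moreover have "\<exists>!r. r \<in> R \<and> x - r \<in> H'" using R x K unfolding transversal_def by blast
  ultimately show "\<exists>!r. r \<in> R \<inter> K \<and> x - r \<in> H'" by (metis Int_iff)
next
  show "finite (R \<inter> K)" using R by (simp add: transversal_def)
qed simp

lemma transversal_tower:
  assumes H: "add_subgroup H" "add_subgroup H'" "add_subgroup H''" "H'' \<subseteq> H'" "H' \<subseteq> H"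
    and R: "transversal R H H'" "transversal R' H' H''"
  shows "transversal ((\<lambda>(a, b). a + b) ` (R \<times> R')) H H''" "inj_on (\<lambda>(a, b). a + b) (R \<times> R')"
proof -
  have sub: "finite R" "finite R'" "R \<subseteq> H" "R' \<subseteq> H'" using R by (auto simp: transversal_def)
  have uniq: "r1 = r2" if "x \<in> H" "r1 \<in> R" "r2 \<in> R" "x - r1 \<in> H'" "x - r2 \<in> H'" for x r1 r2
    using R(1) that unfolding transversal_def by blast
  have uniq': "r1 = r2" if "x \<in> H'" "r1 \<in> R'" "r2 \<in> R'" "x - r1 \<in> H''" "x - r2 \<in> H''" for x r1 r2
    using R(2) that unfolding transversal_def by blast
  have key: "a = a' \<and> b = b'"
    if x: "x \<in> H" "a \<in> R" "a' \<in> R" "b \<in> R'" "b' \<in> R'" "x - (a + b) \<in> H''" "x - (a' + b') \<in> H''"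
    for x a a' b b'
  proof -
    have "x - a \<in> H'" using add_subgroupD(4)[OF H(2), of "x - (a + b)" b] x H sub by auto
    moreover have "x - a' \<in> H'" using add_subgroupD(4)[OF H(2), of "x - (a' + b')" b'] x H sub by auto
    ultimately have "a = a'" using uniq x by blast
    moreover from this have "b = b'"
      using uniq'[OF \<open>x - a \<in> H'\<close>, of b b'] x by (simp add: algebra_simps)
    ultimately show ?thesis by simp
  qed
  show "inj_on (\<lambda>(a, b). a + b) (R \<times> R')"
  proof (rule inj_onI, clarify)
    fix a b a' b' assume *: "a \<in> R" "b \<in> R'" "a' \<in> R" "b' \<in> R'" "a + b = a' + b'"
    then have "a + b \<in> H" using sub H add_subgroupD(4)[OF H(1)] by blast
    then show "a = a' \<and> b = b'" using key[of "a + b" a a' b b'] * add_subgroupD(1)[OF H(3)] by simp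
  qed
  show "transversal ((\<lambda>(a, b). a + b) ` (R \<times> R')) H H''"
    unfolding transversal_def
  proof (intro conjI ballI)
    show "finite ((\<lambda>(a, b). a + b) ` (R \<times> R'))" using sub by simp
    show "(\<lambda>(a, b). a + b) ` (R \<times> R') \<subseteq> H"
    proof clarify
      fix a b assume "a \<in> R" "b \<in> R'"
      then show "a + b \<in> H" using sub H(5) by (intro add_subgroupD(4)[OF H(1)]) auto
    qed
    fix x assume x: "x \<in> H"
    then obtain a where a: "a \<in> R" "x - a \<in> H'" using R(1) unfolding transversal_def by blast
    then obtain b where b: "b \<in> R'" "x - a - b \<in> H''" using R(2) unfolding transversal_def by blast
    show "\<exists>!r. r \<in> (\<lambda>(a, b). a + b) ` (R \<times> R') \<and> x - r \<in> H''"
    proof (rule ex1I[of _ "a + b"])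
      show "a + b \<in> (\<lambda>(a, b). a + b) ` (R \<times> R') \<and> x - (a + b) \<in> H''"
        using a b by (auto simp: algebra_simps intro!: image_eqI[of _ _ "(a, b)"])
      fix r assume r: "r \<in> (\<lambda>(a, b). a + b) ` (R \<times> R') \<and> x - r \<in> H''"
      then obtain a' b' where "r = a' + b'" "a' \<in> R" "b' \<in> R'" by auto
      then show "r = a + b" using key[OF x, of a a' b b'] a b r by (simp add: algebra_simps)
    qed
  qed
qed

text \<open>Rescaling the argument of a function on the lattice \<open>B\<close> multiplies its sum by the index
  \<open>[C : D]\<close>, because \<open>sc\<close> carries \<open>A / C\<close> onto \<open>B / D\<close>.\<close>

lemma transversal_scaled_sum:
  fixes \<eta> :: "'g::ab_group_add \<Rightarrow> complex"
  assumes sg: "add_subgroup A" "add_subgroup B" "add_subgroup C" "add_subgroup D"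
    and sub: "D \<subseteq> C" "C \<subseteq> B" "B \<subseteq> A"
    and sc: "\<And>x y. sc (x - y) = sc x - sc y" "sc ` A = B" "\<And>x. x \<in> A \<Longrightarrow> sc x \<in> D \<longleftrightarrow> x \<in> C" "inj sc"
    and R: "transversal R A C" and R2: "transversal R2 C D" and y: "y \<in> A"
    and supp: "\<And>x. x \<in> A \<Longrightarrow> x \<notin> B \<Longrightarrow> \<eta> x = 0"
    and inv: "\<And>x z. x \<in> A \<Longrightarrow> z \<in> A \<Longrightarrow> x - z \<in> C \<Longrightarrow> \<eta> x = \<eta> z"
  shows "(\<Sum>c\<in>R. \<eta> (sc (y + c))) = of_nat (card R2) * (\<Sum>c\<in>R. \<eta> (y + c))"
proof -
  have finR: "finite R" "R \<subseteq> A" using R by (auto simp: transversal_def)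
  have RB: "transversal (R \<inter> B) B C"
    using transversal_restrict[OF sg(2) sub(2,3) R] .
  have Ry: "transversal ((+) y ` R) A C" by (rule transversal_shift[OF sg(1) R y])
  have "(\<Sum>c\<in>R. \<eta> (y + c)) = sum \<eta> ((+) y ` R)"
    by (subst sum.reindex) (auto simp: inj_on_def)
  also have "\<dots> = sum \<eta> R"
    by (rule transversal_sum_eq[OF sg(3) Ry R]) (rule inv)
  also have "\<dots> = sum \<eta> (R \<inter> B)"
    using finR supp by (intro sum.mono_neutral_right) auto
  finally have r: "(\<Sum>c\<in>R. \<eta> (y + c)) = sum \<eta> (R \<inter> B)" .
  have T1: "transversal (sc ` (+) y ` R) B D"
    unfolding transversal_def
  proof (intro conjI ballI)
    show "finite (sc ` (+) y ` R)" "sc ` (+) y ` R \<subseteq> B"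
      using Ry sc(2) by (auto simp: transversal_def)
    fix x assume "x \<in> B"
    then obtain z where z: "z \<in> A" "x = sc z" using sc(2) by auto
    have iff: "x - sc r \<in> D \<longleftrightarrow> z - r \<in> C" if "r \<in> A" for r
      using sc(1)[of z r] sc(3)[of "z - r"] add_subgroupD(2)[OF sg(1) z(1) that] z by simp
    have "\<exists>!r. r \<in> (+) y ` R \<and> z - r \<in> C" using Ry z(1) unfolding transversal_def by metis
    then obtain r where r: "r \<in> (+) y ` R" "z - r \<in> C"
      "\<And>r'. r' \<in> (+) y ` R \<Longrightarrow> z - r' \<in> C \<Longrightarrow> r' = r" by metis
    have subA: "(+) y ` R \<subseteq> A" using Ry by (simp add: transversal_def)
    show "\<exists>!r. r \<in> sc ` (+) y ` R \<and> x - r \<in> D"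
    proof (rule ex1I[of _ "sc r"])
      show "sc r \<in> sc ` (+) y ` R \<and> x - sc r \<in> D" using r(1,2) iff subA by auto
      fix s assume s: "s \<in> sc ` (+) y ` R \<and> x - s \<in> D"
      then obtain r' where r': "r' \<in> (+) y ` R" "s = sc r'" by (metis imageE)
      then have "z - r' \<in> C" using s iff[of r'] subA by auto
      then show "s = sc r" using r(3)[OF r'(1)] r'(2) by simp
    qed
  qed
  \<comment> \<open>A second transversal for \<open>B\<close> modulo \<open>D\<close>: the first is
    the \<open>sc\<close>-image of one for \<open>A\<close> modulo \<open>C\<close>, this one passes
    through \<open>C\<close>. As \<eta> is constant modulo \<open>C\<close>, comparing the two sums
    produces the factor \<open>card R2\<close>.\<close>
  have T2: "transversal ((\<lambda>(a, b). a + b) ` ((R \<inter> B) \<times> R2)) B D"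
    and inj2: "inj_on (\<lambda>(a, b). a + b) ((R \<inter> B) \<times> R2)"
    using transversal_tower[OF sg(2,3,4) sub(1,2) RB R2] by auto
  have R2C: "R2 \<subseteq> C" using R2 by (simp add: transversal_def)
  have "(\<Sum>c\<in>R. \<eta> (sc (y + c))) = sum \<eta> (sc ` (+) y ` R)"
    using sc(4) by (subst sum.reindex, force simp: inj_on_def, subst sum.reindex) (auto simp: inj_on_def)
  also have "\<dots> = sum \<eta> ((\<lambda>(a, b). a + b) ` ((R \<inter> B) \<times> R2))"
  proof (rule transversal_sum_eq[OF sg(4) T1 T2])
    fix x z assume "x \<in> B" "z \<in> B" "x - z \<in> D"
    then show "\<eta> x = \<eta> z" using sub by (intro inv) auto
  qed
  also have "\<dots> = (\<Sum>(a, b)\<in>(R \<inter> B) \<times> R2. \<eta> (a + b))"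
    by (subst sum.reindex[OF inj2]) (auto simp: case_prod_unfold)
  also have "\<dots> = (\<Sum>a\<in>R \<inter> B. \<Sum>b\<in>R2. \<eta> (a + b))"
    by (rule sum.cartesian_product[symmetric])
  also have "\<dots> = (\<Sum>a\<in>R \<inter> B. \<Sum>b\<in>R2. \<eta> a)"
  proof (intro sum.cong refl)
    fix a b assume "a \<in> R \<inter> B" "b \<in> R2"
    then show "\<eta> (a + b) = \<eta> a"
      using R2C sub add_subgroupD(4)[OF sg(1), of a b] by (intro inv) auto
  qed
  also have "\<dots> = of_nat (card R2) * sum \<eta> (R \<inter> B)"
    by (simp add: sum_distrib_left)
  finally show ?thesis by (simp add: r)
qed

section \<open>Schwartz functions on pairs of matrices\<close>

context uniformized
begin

text \<open>Level \<open>N\<close> bounds the support by \<open>M (- N)\<close> and makes the function \<open>M N\<close>-periodic; by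
  compactness every member of \<open>Cc_infty\<close> has a level.\<close>

definition schwartz_level :: "int \<Rightarrow> (('a^'n^'n) \<times> ('a^'n^'n) \<Rightarrow> complex) \<Rightarrow> bool" where
  "schwartz_level N \<phi> \<longleftrightarrow> (\<forall>X Y. \<phi> (X, Y) \<noteq> 0 \<longrightarrow> X \<in> M (- N) \<and> Y \<in> M (- N)) \<and>
     (\<forall>X Y X' Y'. X' - X \<in> M N \<longrightarrow> Y' - Y \<in> M N \<longrightarrow> \<phi> (X', Y') = \<phi> (X, Y))"

definition schwartz :: "(('a^'n^'n) \<times> ('a^'n^'n) \<Rightarrow> complex) \<Rightarrow> bool" where
  "schwartz \<phi> \<longleftrightarrow> (\<exists>N. schwartz_level N \<phi>)"

lemma schwartz_level_mono: "schwartz_level N \<phi> \<Longrightarrow> N \<le> N' \<Longrightarrow> schwartz_level N' \<phi>"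
proof -
  assume s: "schwartz_level N \<phi>" and l: "N \<le> N'"
  have 1: "X \<in> M (- N')" if "X \<in> M (- N)" for X :: "'a^'n^'n" using M_mono[OF that] l by simp
  have 2: "X \<in> M N" if "X \<in> M N'" for X :: "'a^'n^'n" using M_mono[OF that] l by simp
  show ?thesis using s unfolding schwartz_level_def by (meson 1 2)
qed

lemma schwartz_levelE: assumes "schwartz \<phi>" obtains N where "schwartz_level N \<phi>" "N \<ge> k"
  using assms schwartz_level_mono unfolding schwartz_def by (metis nle_le)

lemma schwartz_zero: "schwartz (\<lambda>_. 0)"
  by (auto simp: schwartz_def schwartz_level_def)

lemma schwartz_add: assumes "schwartz \<phi>" "schwartz \<psi>" shows "schwartz (\<lambda>p. \<phi> p + \<psi> p)"
proof -
  obtain N where N: "schwartz_level N \<phi>" using assms by (auto simp: schwartz_def)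
  obtain N' where N': "schwartz_level N' \<psi>" "N' \<ge> N" using schwartz_levelE[OF assms(2)] by blast
  have "schwartz_level N' \<phi>" by (rule schwartz_level_mono[OF N N'(2)])
  then have "schwartz_level N' (\<lambda>p. \<phi> p + \<psi> p)"
    using N'(1) unfolding schwartz_level_def by (smt (verit) add_eq_0_iff_both_eq_0 add_0)
  then show ?thesis by (auto simp: schwartz_def)
qed

lemma schwartz_scale: assumes "schwartz \<phi>" shows "schwartz (\<lambda>p. c * \<phi> p)"
  using assms unfolding schwartz_def schwartz_level_def by (metis mult_zero_right)

lemma schwartz_sum: "(\<And>i. i \<in> I \<Longrightarrow> schwartz (\<phi> i)) \<Longrightarrow> schwartz (\<lambda>p. \<Sum>i\<in>I. \<phi> i p)"
  by (induction I rule: infinite_finite_induct) (auto intro!: schwartz_zero schwartz_add)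

lemma schwartz_diff: assumes "schwartz \<phi>" "schwartz \<psi>" shows "schwartz (\<lambda>p. \<phi> p - \<psi> p)"
  using schwartz_add[OF assms(1) schwartz_scale[OF assms(2), of "-1"]] by simp

lemma schwartz_act:
  assumes "schwartz \<phi>" "g \<in> GL" "g' \<in> GL"
  shows "schwartz (\<lambda>(X, Y). \<phi> (g ** X, Y ** g'))"
proof -
  obtain N where N: "schwartz_level N \<phi>" using assms by (auto simp: schwartz_def)
  obtain a where a: "a \<ge> 0" "g \<in> M (- a)" using ex_M by blast
  obtain a' where a': "a' \<ge> 0" "g' \<in> M (- a')" using ex_M by blast
  obtain b where b: "b \<ge> 0" "matrix_inv g \<in> M (- b)" using ex_M by blast
  obtain b' where b': "b' \<ge> 0" "matrix_inv g' \<in> M (- b')" using ex_M by blast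
  define L where "L = N + a + a' + b + b'"
  have s: "X \<in> M (- L) \<and> Y \<in> M (- L)" if "\<phi> (g ** X, Y ** g') \<noteq> 0" for X Y
  proof -
    have "g ** X \<in> M (- N)" "Y ** g' \<in> M (- N)" using N that by (auto simp: schwartz_level_def)
    then have "matrix_inv g ** (g ** X) \<in> M (- b + - N)" "(Y ** g') ** matrix_inv g' \<in> M (- N + - b')"
      using b b' M_mult by blast+
    moreover have "matrix_inv g ** (g ** X) = X" "(Y ** g') ** matrix_inv g' = Y"
      using assms by (simp_all add: matrix_mul_assoc GL_iff invertible_matrix_inv)
        (metis matrix_mul_assoc invertible_matrix_inv(1) matrix_mul_rid)
    ultimately show ?thesis using a a' b b' by (auto simp: L_def intro: M_mono)
  qed
  have i: "\<phi> (g ** X', Y' ** g') = \<phi> (g ** X, Y ** g')" if "X' - X \<in> M L" "Y' - Y \<in> M L" for X Y X' Y'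
  proof -
    have "g ** (X' - X) \<in> M (- a + L)" "(Y' - Y) ** g' \<in> M (L + - a')"
      using that a a' M_mult by blast+
    then have "g ** X' - g ** X \<in> M N" "Y' ** g' - Y ** g' \<in> M N"
      using a a' b b' by (auto simp: L_def matrix_diff_ldistrib matrix_diff_rdistrib intro: M_mono)
    then show ?thesis using N by (simp add: schwartz_level_def)
  qed
  show ?thesis unfolding schwartz_def schwartz_level_def using s i by (intro exI[of _ L]) auto
qed

lemma schwartz_ball: "schwartz (\<lambda>(X, Y). if X - X0 \<in> M m \<and> Y - Y0 \<in> M m then c else 0)"
proof -
  obtain a where a: "a \<ge> 0" "X0 \<in> M (- a)" using ex_M by blast
  obtain b where b: "b \<ge> 0" "Y0 \<in> M (- b)" using ex_M by blast
  define L where "L = a + b + \<bar>m\<bar>"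
  have s: "X \<in> M (- L)" if "X - X0 \<in> M m" for X
    using M_add[OF M_mono[OF that, of "-L"] M_mono[OF a(2), of "-L"]] a b by (simp add: L_def)
  have s': "X \<in> M (- L)" if "X - Y0 \<in> M m" for X
    using M_add[OF M_mono[OF that, of "-L"] M_mono[OF b(2), of "-L"]] a b by (simp add: L_def)
  have i: "X' - Z \<in> M m \<longleftrightarrow> X - Z \<in> M m" if "X' - X \<in> M L" for X X' Z :: "'a^'n^'n"
    using M_shift_iff[of "X' - Z" "X - Z" m] M_mono[OF that, of m] a b by (simp add: L_def)
  show ?thesis unfolding schwartz_def schwartz_level_def using s s' i by (intro exI[of _ L]) (auto simp: i)
qed

text \<open>On the support box \<open>X\<close> lies in \<open>M (- N)\<close>, so
  \<open>c ** X\<close> lies in \<open>M (b - N)\<close>; the bound \<open>2 * N\<close> puts this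
  inside the period lattice \<open>M N\<close>. Off the box both values vanish, because
  \<open>mat 1 + c\<close> and its inverse are integral and preserve the box.\<close>

lemma schwartz_level_invariant:
  assumes "schwartz_level N \<phi>" "c \<in> M b" "c' \<in> M b" "b \<ge> 2 * N" "b \<ge> 0"
    and inv: "(mat 1 + c) ** (mat 1 + c') = mat 1" "(mat 1 + c') ** (mat 1 + c) = mat 1"
  shows "\<phi> ((mat 1 + c) ** X, Y ** (mat 1 + c')) = \<phi> (X, Y)"
proof -
  have u: "mat 1 + c \<in> M 0" "mat 1 + c' \<in> M 0"
    using assms by (auto intro!: M_add intro: M_mono)
  show ?thesis
  proof (cases "X \<in> M (- N) \<and> Y \<in> M (- N)")
    case True
    then have "c ** X \<in> M (b + - N)" "Y ** c' \<in> M (- N + b)" using assms M_mult by blast+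
    then have "c ** X \<in> M N" "Y ** c' \<in> M N" using assms by (auto intro: M_mono)
    then have "(mat 1 + c) ** X - X \<in> M N" "Y ** (mat 1 + c') - Y \<in> M N"
      by (simp_all add: matrix_add_rdistrib' matrix_add_ldistrib)
    then show ?thesis using assms(1) by (simp add: schwartz_level_def)
  next
    case False
    then have "\<phi> (X, Y) = 0" using assms(1) by (auto simp: schwartz_level_def)
    moreover have "\<phi> ((mat 1 + c) ** X, Y ** (mat 1 + c')) = 0"
    proof (rule ccontr)
      assume "\<not> ?thesis"
      then have "(mat 1 + c) ** X \<in> M (- N)" "Y ** (mat 1 + c') \<in> M (- N)"
        using assms(1) by (auto simp: schwartz_level_def)
      then have "(mat 1 + c') ** ((mat 1 + c) ** X) \<in> M (- N)" "(Y ** (mat 1 + c')) ** (mat 1 + c) \<in> M (- N)"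
        using u M_mult_0_left M_mult_0_right by blast+
      then have "X \<in> M (- N)" "Y \<in> M (- N)"
        by (metis inv(2) matrix_mul_assoc matrix_mul_lid, metis inv(2) matrix_mul_assoc matrix_mul_rid)
      then show False using False by simp
    qed
    ultimately show ?thesis by simp
  qed
qed

lemma Cc_infty_imp_schwartz:
  fixes \<phi> :: "('a^'n^'n) \<times> ('a^'n^'n) \<Rightarrow> complex"
  assumes "\<phi> \<in> Cc_infty" shows "schwartz \<phi>"
proof -
  define S where "S = closure {x. \<phi> x \<noteq> 0}"
  have S: "compact S" and lc: "\<And>x. \<exists>U. open U \<and> x \<in> U \<and> \<phi> constant_on U"
    using assms by (auto simp: Cc_infty_def S_def)
  have op: "open (M (- int k) \<times> M (- int k) :: (('a^'n^'n) \<times> ('a^'n^'n)) set)" for k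
    using open_mat_ball[of 0 "- int k"] by (intro open_Times) simp_all
  have cov: "S \<subseteq> (\<Union>k\<in>UNIV. M (- int k) \<times> M (- int k))"
  proof clarsimp
    fix X Y :: "'a^'n^'n"
    obtain a where a: "a \<ge> 0" "X \<in> M (- a)" using ex_M by blast
    obtain b where b: "b \<ge> 0" "Y \<in> M (- b)" using ex_M by blast
    have "X \<in> M (- int (nat (a + b)))" "Y \<in> M (- int (nat (a + b)))"
      using a b by (auto intro: M_mono)
    then show "\<exists>k. X \<in> M (- int k) \<and> Y \<in> M (- int k)" by blast
  qed
  obtain F where F: "finite F" "S \<subseteq> (\<Union>k\<in>F. M (- int k) \<times> M (- int k))"
    by (rule compactE_image[OF S op cov])
  define N where "N = int (Max (insert 0 F))"
  have supp: "X \<in> M (- N) \<and> Y \<in> M (- N)" if nz: "\<phi> (X, Y) \<noteq> 0" for X Y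
  proof -
    have "(X, Y) \<in> S" unfolding S_def by (rule subsetD[OF closure_subset]) (simp add: nz)
    then obtain k where k: "k \<in> F" "X \<in> M (- int k)" "Y \<in> M (- int k)" using F(2) by blast
    then have "k \<le> Max (insert 0 F)" using F(1) by simp
    then show ?thesis using k by (auto simp: N_def intro: M_mono)
  qed
  \<comment> \<open>Every point of an ultrametric ball is a centre of it, so local constancy at one
    pair passes to nearby pairs and smaller radii, as \<open>uniform_radius\<close> demands.\<close>
  have "\<exists>m. \<forall>X\<in>M (- N). \<forall>Y\<in>M (- N). \<forall>m'\<ge>m. \<forall>X' Y'. X' - X \<in> M m' \<longrightarrow> Y' - Y \<in> M m' \<longrightarrow> \<phi> (X', Y') = \<phi> (X, Y)"
  proof (rule uniform_radius)
    fix X Y :: "'a^'n^'n"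
    obtain U where U: "open U" "(X, Y) \<in> U" "\<phi> constant_on U" using lc by blast
    then obtain m where m: "\<And>X' Y'. X' - X \<in> M m \<Longrightarrow> Y' - Y \<in> M m \<Longrightarrow> (X', Y') \<in> U"
      using open_mat_prod_iff[of U] by metis
    have c: "\<phi> (X', Y') = \<phi> (X, Y)" if "X' - X \<in> M m" "Y' - Y \<in> M m" for X' Y'
      using m[OF that] U(2,3) unfolding constant_on_def by metis
    show "\<exists>m. \<forall>X' Y' m'. X' - X \<in> M m \<longrightarrow> Y' - Y \<in> M m \<longrightarrow> m \<le> m' \<longrightarrow>
        (\<forall>X'' Y''. X'' - X' \<in> M m' \<longrightarrow> Y'' - Y' \<in> M m' \<longrightarrow> \<phi> (X'', Y'') = \<phi> (X', Y'))"
    proof (intro exI[of _ m] allI impI)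
      fix X' Y' m' X'' Y''
      assume *: "X' - X \<in> M m" "Y' - Y \<in> M m" "m \<le> m'" "X'' - X' \<in> M m'" "Y'' - Y' \<in> M m'"
      then have "X'' - X \<in> M m" "Y'' - Y \<in> M m"
        using M_diff_trans[OF M_mono[OF *(4) *(3)] *(1)] M_diff_trans[OF M_mono[OF *(5) *(3)] *(2)] by simp_all
      then show "\<phi> (X'', Y'') = \<phi> (X', Y')" using c * by metis
    qed
  qed
  then obtain m where m: "\<And>X Y m' X' Y'. X \<in> M (- N) \<Longrightarrow> Y \<in> M (- N) \<Longrightarrow> m \<le> m' \<Longrightarrow>
      X' - X \<in> M m' \<Longrightarrow> Y' - Y \<in> M m' \<Longrightarrow> \<phi> (X', Y') = \<phi> (X, Y)" by blast
  define L where "L = max m N"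
  have "N \<ge> 0" by (simp add: N_def)
  have "\<phi> (X', Y') = \<phi> (X, Y)" if d: "X' - X \<in> M L" "Y' - Y \<in> M L" for X Y X' Y'
  proof (cases "X \<in> M (- N) \<and> Y \<in> M (- N)")
    case True
    then show ?thesis using m[of X Y L X' Y'] d by (simp add: L_def)
  next
    case False
    have "X' - X \<in> M (- N)" "Y' - Y \<in> M (- N)" using d \<open>N \<ge> 0\<close> by (auto simp: L_def intro: M_mono)
    then have "\<not> (X' \<in> M (- N) \<and> Y' \<in> M (- N))" using False M_shift_iff by blast
    then show ?thesis using False supp by metis
  qed
  moreover have "X \<in> M (- L) \<and> Y \<in> M (- L)" if "\<phi> (X, Y) \<noteq> 0" for X Y
    using supp[OF that] by (auto simp: L_def intro: M_mono)
  ultimately show ?thesis unfolding schwartz_def schwartz_level_def by blast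
qed

end

section \<open>Compact open subsets of the general linear group and test functions on it\<close>

context uniformized
begin

text \<open>These sets are compact and open and exhaust \<open>GL\<close>; bounding the inverse as
  well keeps them away from the singular matrices.\<close>

definition GL_ball :: "int \<Rightarrow> ('a^'n^'n) set" where
  "GL_ball N = {h \<in> GL. h \<in> M (- N) \<and> matrix_inv h \<in> M (- N)}"

text \<open>Write \<open>h' = h ** (mat 1 + C)\<close> with
  \<open>C = matrix_inv h ** (h' - h)\<close>. The bound \<open>N + 1\<close> puts \<open>C\<close>
  into \<open>M 1\<close>, where \<open>mat 1 + C\<close> has an integral inverse and a determinant
  of absolute value 1; the bound \<open>- N\<close> keeps \<open>h'\<close> in
  \<open>M (- N)\<close>.\<close>

lemma GL_ball_absorb:
  assumes h: "h \<in> GL_ball N" and d: "h' - h \<in> M k" and k: "k \<ge> N + 1" "k \<ge> - N"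
  shows "h' \<in> GL_ball N" "val (det h') = val (det h)"
proof -
  have hG: "h \<in> GL" and hM: "h \<in> M (- N)" and hi: "matrix_inv h \<in> M (- N)"
    using h by (auto simp: GL_ball_def)
  define C where "C = matrix_inv h ** (h' - h)"
  have "C \<in> M (- N + k)" unfolding C_def using hi d by (rule M_mult)
  then have C: "C \<in> M 1" using k by (auto intro: M_mono)
  have h': "h' = h ** (mat 1 + C)"
    using hG by (simp add: C_def matrix_add_ldistrib matrix_mul_assoc invertible_matrix_inv GL_iff)
  have G': "h' \<in> GL" unfolding h' by (intro GL_mult hG one_plus_GL C)
  have "matrix_inv (mat 1 + C) - mat 1 \<in> M 1" using C by (rule matrix_inv_one_plus) simp
  then have "matrix_inv (mat 1 + C) - mat 1 \<in> M 0" by (rule M_mono) simp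
  then have "matrix_inv (mat 1 + C) \<in> M 0" by (simp add: M_shift_iff)
  then have "matrix_inv h' \<in> M (- N)"
    unfolding h' by (simp add: matrix_inv_mult hG one_plus_GL C M_mult_0_left hi)
  moreover have "h' \<in> M (- N)"
    using M_shift_iff[of h' h "- N"] M_mono[OF d, of "- N"] hM k by simp
  ultimately show "h' \<in> GL_ball N" using G' by (simp add: GL_ball_def)
  have "v (det h') = v (det h)" unfolding h' det_mul v_mult using det_one_plus[OF C] by simp
  then show "val (det h') = val (det h)" by (simp add: val_def)
qed

lemma GL_ball_absorb_iff:
  assumes "h' - h \<in> M k" "k \<ge> N + 1" "k \<ge> - N" shows "h' \<in> GL_ball N \<longleftrightarrow> h \<in> GL_ball N"
proof
  have "h - h' \<in> M k" using assms(1) M_minus_commute by blast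
  then show "h' \<in> GL_ball N \<Longrightarrow> h \<in> GL_ball N" using GL_ball_absorb(1)[of h' N h k] assms by simp
  show "h \<in> GL_ball N \<Longrightarrow> h' \<in> GL_ball N" by (rule GL_ball_absorb(1)[OF _ assms])
qed

lemma ex_GL_ball: assumes "h \<in> GL" shows "\<exists>N\<ge>0. h \<in> GL_ball N"
proof -
  obtain a where "a \<ge> 0" "h \<in> M (- a)" using ex_M by blast
  moreover obtain b where "b \<ge> 0" "matrix_inv h \<in> M (- b)" using ex_M by blast
  ultimately show ?thesis using assms
    by (intro exI[of _ "a + b"]) (auto simp: GL_ball_def intro: M_mono)
qed

lemma open_GL_ball: "open (GL_ball N :: ('a^'n^'n) set)"
  unfolding open_mat_iff
proof
  fix X :: "'a^'n^'n" assume X: "X \<in> GL_ball N"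
  have "Y \<in> GL_ball N" if "Y - X \<in> M (max (N + 1) (- N))" for Y
    using GL_ball_absorb(1)[OF X that] by simp
  then show "\<exists>k. \<forall>Y. Y - X \<in> M k \<longrightarrow> Y \<in> GL_ball N" by blast
qed

lemma compact_GL_ball: "compact (GL_ball N :: ('a^'n^'n) set)"
proof -
  have "open (- GL_ball N :: ('a^'n^'n) set)"
    unfolding open_mat_iff
  proof
    fix X :: "'a^'n^'n" assume X: "X \<in> - GL_ball N"
    have "Y \<in> - GL_ball N" if "Y - X \<in> M (max (N + 1) (- N))" for Y
      using GL_ball_absorb_iff[OF that, of N] X by simp
    then show "\<exists>k. \<forall>Y. Y - X \<in> M k \<longrightarrow> Y \<in> - GL_ball N" by blast
  qed
  then have "compact (M (- N) \<inter> GL_ball N :: ('a^'n^'n) set)" by (intro compact_Int_closed compact_M) (simp add: closed_def)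
  moreover have "M (- N) \<inter> GL_ball N = (GL_ball N :: ('a^'n^'n) set)" by (auto simp: GL_ball_def)
  ultimately show ?thesis by simp
qed

lemma open_GL: "open (GL :: ('a^'n^'n) set)"
  unfolding open_mat_iff
proof
  fix X :: "'a^'n^'n" assume "X \<in> GL"
  then obtain N where N: "X \<in> GL_ball N" using ex_GL_ball by blast
  have "Y \<in> GL" if "Y - X \<in> M (max (N + 1) (- N))" for Y
    using GL_ball_absorb(1)[OF N that] by (simp add: GL_ball_def)
  then show "\<exists>k. \<forall>Y. Y - X \<in> M k \<longrightarrow> Y \<in> GL" by blast
qed

lemma continuous_left_mult: "continuous_on UNIV (\<lambda>h::'a^'n^'n. (g::'a^'n^'n) ** h)"
  unfolding continuous_on_open_vimage[OF open_UNIV]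
proof (intro allI impI)
  fix U :: "('a^'n^'n) set" assume U: "open U"
  obtain a where a: "g \<in> M (- a)" using ex_M by blast
  have "\<exists>k. \<forall>Y. Y - X \<in> M k \<longrightarrow> g ** Y \<in> U" if X: "g ** X \<in> U" for X
  proof -
    obtain k where k: "\<And>Y. Y - g ** X \<in> M k \<Longrightarrow> Y \<in> U"
      using U X open_mat_iff[of U] by metis
    have "g ** Y \<in> U" if "Y - X \<in> M (k + a)" for Y
      using M_mult[OF a that] by (intro k) (simp add: matrix_diff_ldistrib)
    then show ?thesis by blast
  qed
  then show "open ((\<lambda>h. g ** h) -` U \<inter> UNIV)"
    by (simp add: open_mat_iff)
qed

text \<open>Locally constant with compact support inside \<open>GL\<close>, at a uniform scale.
  Values off \<open>GL\<close> are left free, since the measure lives on \<open>GL\<close>.\<close>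

definition tame :: "('a^'n^'n \<Rightarrow> complex) \<Rightarrow> bool" where
  "tame f \<longleftrightarrow> (\<exists>N k. (\<forall>h\<in>GL. f h \<noteq> 0 \<longrightarrow> h \<in> GL_ball N) \<and>
      (\<forall>h\<in>GL_ball N. \<forall>h'\<in>GL_ball N. h' - h \<in> M k \<longrightarrow> f h' = f h))"

text \<open>The second argument bounds the inverse of \<open>h\<close>, and the first bounds
  \<open>h\<close> once divided by \<open>t\<close>; together they confine \<open>h\<close> to a
  \<open>GL_ball\<close>. Local constancy in \<open>h\<close> uses that a difference of inverses
  factors through the difference of the matrices.\<close>

lemma tame_integrand:
  assumes "schwartz \<phi>" "t \<noteq> 0"
  shows "tame (\<lambda>h. \<phi> (smat t h, matrix_inv h))"
proof -
  obtain N where N: "schwartz_level N \<phi>" "N \<ge> 0" using schwartz_levelE[OF assms(1), of 0] by blast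
  define L where "L = N + \<bar>val t\<bar>"
  define k where "k = N + 2 * L + \<bar>val t\<bar>"
  have vt: "v t = q (val t)" "v (inverse t) = q (- val t)"
    using v_eq_q_val[OF assms(2)] by (simp_all add: v_inverse power_int_minus)
  have s: "h \<in> GL_ball L" if "h \<in> GL" "\<phi> (smat t h, matrix_inv h) \<noteq> 0" for h
  proof -
    have "smat t h \<in> M (- N)" and hi: "matrix_inv h \<in> M (- N)"
      using N that by (auto simp: schwartz_level_def)
    then have "smat (inverse t) (smat t h) \<in> M (- val t + - N)" using vt by (intro M_smat) auto
    then have "h \<in> M (- val t - N)" using assms by (simp add: smat_smat)
    then show ?thesis using hi that by (auto simp: GL_ball_def L_def intro: M_mono)
  qed
  have "\<phi> (smat t h', matrix_inv h') = \<phi> (smat t h, matrix_inv h)"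
    if hh: "h \<in> GL_ball L" "h' \<in> GL_ball L" "h' - h \<in> M k" for h h'
  proof -
    have "smat t (h' - h) \<in> M (val t + k)" using hh vt by (intro M_smat) auto
    then have 1: "smat t h' - smat t h \<in> M N"
      using N by (auto simp: smat_diff k_def L_def intro: M_mono)
    have G: "h \<in> GL" "h' \<in> GL" using hh by (auto simp: GL_ball_def)
    have "matrix_inv h' ** (h - h') ** matrix_inv h \<in> M ((- L + k) + - L)"
      using hh M_minus_commute by (intro M_mult) (auto simp: GL_ball_def)
    moreover have "matrix_inv h' ** (h - h') ** matrix_inv h = matrix_inv h' - matrix_inv h"
      using G by (simp add: mat_algebra invertible_matrix_inv GL_iff)
    ultimately have 2: "matrix_inv h' - matrix_inv h \<in> M N"
      by (auto simp: k_def intro: M_mono)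
    show ?thesis using N(1) 1 2 by (simp add: schwartz_level_def)
  qed
  note c = this
  show ?thesis unfolding tame_def
    by (intro exI[of _ L] exI[of _ k] conjI ballI impI) (rule s, assumption+, rule c, assumption+)
qed

text \<open>With second argument 0 nothing bounds the inverse directly. An upper bound on the
  valuation of the determinant does so instead, through Cramer's rule.\<close>

lemma tame_restricted:
  fixes \<phi> :: "('a^'n^'n) \<times> ('a^'n^'n) \<Rightarrow> complex"
  assumes "schwartz \<phi>" "\<And>k. k \<in> D \<Longrightarrow> k \<le> m"
  shows "tame (\<lambda>h. if val (det h) \<in> D then \<phi> (h, 0) else 0)"
proof -
  obtain N where N: "schwartz_level N \<phi>" "N \<ge> 0" using schwartz_levelE[OF assms(1), of 0] by blast
  define L where "L = max N (m + (int CARD('n) - 1) * N)"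
  have s: "h \<in> GL_ball L" if h: "h \<in> GL" "(if val (det h) \<in> D then \<phi> (h, 0) else 0) \<noteq> 0" for h
  proof -
    have k: "val (det h) \<in> D" "\<phi> (h, 0) \<noteq> 0" using h(2) by (auto split: if_splits)
    then have hM: "h \<in> M (- N)" using N(1) unfolding schwartz_level_def by blast
    have "v (det h) = q (val (det h))" using h by (intro v_eq_q_val) (simp add: GL_iff_det)
    then have "v (det h) \<ge> q m" using assms(2)[OF k(1)] by simp
    then have "matrix_inv h \<in> M ((int CARD('n) - 1) * (- N) - m)" using hM by (intro matrix_inv_M)
    then have "matrix_inv h \<in> M (- L)" by (rule M_mono) (simp add: L_def)
    moreover have "h \<in> M (- L)" using hM by (rule M_mono) (simp add: L_def)
    ultimately show ?thesis using h by (simp add: GL_ball_def)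
  qed
  define k where "k = max N (max (L + 1) (- L))"
  have "(if val (det h') \<in> D then \<phi> (h', 0) else 0) = (if val (det h) \<in> D then \<phi> (h, 0) else 0)"
    if hh: "h \<in> GL_ball L" "h' \<in> GL_ball L" "h' - h \<in> M k" for h h'
  proof -
    have "val (det h') = val (det h)" using hh by (intro GL_ball_absorb(2)[of h L h' k]) (auto simp: k_def)
    moreover have "\<phi> (h', 0) = \<phi> (h, 0)"
      using N(1) hh M_mono[of "h' - h" k N] by (simp add: schwartz_level_def k_def)
    ultimately show ?thesis by simp
  qed
  note c = this
  show ?thesis unfolding tame_def
    by (intro exI[of _ L] exI[of _ k] conjI ballI impI) (rule s, assumption+, rule c, assumption+)
qed

end

subsection \<open>Haar measure\<close>

locale haar = uniformized v \<pi> for v :: "'a::nonarch_local_field \<Rightarrow> real" and \<pi> +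
  fixes \<mu> :: "('a^'n^'n) measure"
  assumes haar: "haar_measure_GL \<mu>"
begin

lemma sets_mu: "sets \<mu> = sets (restrict_space borel GL)"
  and left_inv: "g \<in> GL \<Longrightarrow> A \<in> sets \<mu> \<Longrightarrow> emeasure \<mu> ((\<lambda>h. g ** h) ` A) = emeasure \<mu> A"
  and finite_compact: "compact K \<Longrightarrow> K \<subseteq> GL \<Longrightarrow> emeasure \<mu> K < \<infinity>"
proof -
  note H = haar[unfolded haar_measure_GL_def]
  show "sets \<mu> = sets (restrict_space borel GL)" using H by (elim conjE)
  have "\<forall>g\<in>GL. \<forall>A\<in>sets \<mu>. emeasure \<mu> ((\<lambda>h. g ** h) ` A) = emeasure \<mu> A" using H by (elim conjE)
  then show "g \<in> GL \<Longrightarrow> A \<in> sets \<mu> \<Longrightarrow> emeasure \<mu> ((\<lambda>h. g ** h) ` A) = emeasure \<mu> A" by simp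
  have "\<forall>K. compact K \<and> K \<subseteq> GL \<longrightarrow> emeasure \<mu> K < \<infinity>" using H by (elim conjE)
  then show "compact K \<Longrightarrow> K \<subseteq> GL \<Longrightarrow> emeasure \<mu> K < \<infinity>" by simp
qed

lemma space_mu: "space \<mu> = GL"
  using sets_eq_imp_space_eq[OF sets_mu] by (simp add: space_restrict_space)

lemma open_in_sets: assumes "open U" "U \<subseteq> GL" shows "U \<in> sets \<mu>"
proof -
  have "GL \<inter> U \<in> sets (restrict_space borel GL)"
    unfolding sets_restrict_space using assms(1) by (intro imageI) simp
  then show ?thesis using assms(2) by (simp add: sets_mu Int_absorb1)
qed

lemma GL_ball_sets: "GL_ball N \<in> sets \<mu>"
  by (intro open_in_sets open_GL_ball) (auto simp: GL_ball_def)

lemma tame_measurable: assumes "tame f" shows "f \<in> borel_measurable \<mu>"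
proof (rule measurableI)
  fix S :: "complex set" assume "S \<in> sets borel"
  obtain N k where "\<forall>h\<in>GL. f h \<noteq> 0 \<longrightarrow> h \<in> GL_ball N"
    "\<forall>h\<in>GL_ball N. \<forall>h'\<in>GL_ball N. h' - h \<in> M k \<longrightarrow> f h' = f h"
    using assms unfolding tame_def by (elim exE conjE)
  note s = this(1)[rule_format] and c = this(2)[rule_format]
  define m where "m = max k (max (N + 1) (- N))"
  have const: "f h' = f h" if "h \<in> GL" "h' \<in> GL" "h' - h \<in> M m" for h h'
  proof (cases "h \<in> GL_ball N")
    case True
    then have "h' \<in> GL_ball N" using GL_ball_absorb(1)[OF True that(3)] by (simp add: m_def)
    then show ?thesis using c[OF True] M_mono[OF that(3), of k] by (simp add: m_def)
  next
    case False
    then have "h' \<notin> GL_ball N" using GL_ball_absorb_iff[OF that(3), of N] by (simp add: m_def)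
    then have "f h' = 0" using s[OF that(2)] by blast
    moreover have "f h = 0" using s[OF that(1)] False by blast
    ultimately show ?thesis by simp
  qed
  have "open (f -` S \<inter> GL)"
    unfolding open_mat_iff
  proof
    fix X assume X: "X \<in> f -` S \<inter> GL"
    then have "X \<in> GL" by simp
    then obtain a where a: "\<forall>Y. Y - X \<in> M a \<longrightarrow> Y \<in> GL"
      using open_GL[unfolded open_mat_iff] by (elim ballE exE) auto
    have "Y \<in> f -` S \<inter> GL" if Y: "Y - X \<in> M (max a m)" for Y
    proof -
      have "Y \<in> GL" using a M_mono[OF Y, of a] by simp
      moreover have "f Y = f X" using const[of X Y] X M_mono[OF Y, of m] \<open>Y \<in> GL\<close> by simp
      ultimately show ?thesis using X by simp
    qed
    then show "\<exists>k. \<forall>Y. Y - X \<in> M k \<longrightarrow> Y \<in> f -` S \<inter> GL" by blast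
  qed
  then show "f -` S \<inter> space \<mu> \<in> sets \<mu>"
    unfolding space_mu by (intro open_in_sets) auto
qed simp

lemma tame_integrable: assumes "tame f" shows "integrable \<mu> f"
proof -
  obtain N k where "\<forall>h\<in>GL. f h \<noteq> 0 \<longrightarrow> h \<in> GL_ball N"
    "\<forall>h\<in>GL_ball N. \<forall>h'\<in>GL_ball N. h' - h \<in> M k \<longrightarrow> f h' = f h"
    using assms unfolding tame_def by (elim exE conjE)
  note s = this(1)[rule_format] and c = this(2)[rule_format]
  define m where "m = max k (max (N + 1) (- N))"
  obtain F :: "('a^'n^'n) set" where F: "finite F" "\<forall>X\<in>M (- N). \<exists>Y\<in>F. X - Y \<in> M m"
    using finite_net[of "- N" m] by (elim exE conjE)
  define b where "b = (\<Sum>Y\<in>F. norm (f Y))"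
  have bd: "norm (f h) \<le> b" if "h \<in> GL_ball N" for h
  proof -
    have "h \<in> M (- N)" using that by (simp add: GL_ball_def)
    then obtain Y where Y: "Y \<in> F" "h - Y \<in> M m" using F by blast
    then have "Y \<in> GL_ball N" using that GL_ball_absorb_iff[of h Y m N] by (simp add: m_def)
    then have "f h = f Y" using c[of Y h] that M_mono[OF Y(2), of k] by (simp add: m_def)
    then show ?thesis unfolding b_def using member_le_sum[of Y F "\<lambda>Y. norm (f Y)"] Y(1) F(1) by simp
  qed
  show ?thesis
  proof (rule integrableI_bounded_set[of "GL_ball N" _ _ b])
    show "emeasure \<mu> (GL_ball N) < \<infinity>" by (rule finite_compact[OF compact_GL_ball]) (auto simp: GL_ball_def)
    show "AE x in \<mu>. x \<in> GL_ball N \<longrightarrow> norm (f x) \<le> b" using bd by simp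
    show "AE x in \<mu>. x \<notin> GL_ball N \<longrightarrow> f x = 0"
      by (rule AE_I2) (use s in \<open>auto simp: space_mu\<close>)
  qed (use GL_ball_sets tame_measurable[OF assms] in auto)
qed

lemma left_mult_measurable: assumes "g \<in> GL" shows "(\<lambda>h. g ** h) \<in> measurable \<mu> \<mu>"
proof -
  have "(\<lambda>h::'a^'n^'n. g ** h) \<in> measurable borel borel"
    by (rule borel_measurable_continuous_onI[OF continuous_left_mult])
  then have "(\<lambda>h::'a^'n^'n. g ** h) \<in> measurable (restrict_space borel GL) (restrict_space borel GL)"
    using assms by (intro measurable_restrict_space2 measurable_restrict_space1)
      (auto simp: space_restrict_space GL_mult)
  then show ?thesis
    using measurable_cong_sets[OF sets_mu sets_mu] by blast
qed

lemma left_mult_image: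
  assumes "g \<in> GL" shows "(\<lambda>h. g ** h) -` A \<inter> GL = (\<lambda>h. matrix_inv g ** h) ` (A \<inter> GL)"
proof (intro set_eqI iffI)
  fix h assume "h \<in> (\<lambda>h. g ** h) -` A \<inter> GL"
  moreover have "matrix_inv g ** (g ** h) = h"
    using assms by (simp add: matrix_mul_assoc invertible_matrix_inv GL_iff)
  ultimately show "h \<in> (\<lambda>h. matrix_inv g ** h) ` (A \<inter> GL)"
    using assms by (auto intro!: image_eqI[of _ _ "g ** h"] GL_mult)
next
  fix h assume "h \<in> (\<lambda>h. matrix_inv g ** h) ` (A \<inter> GL)"
  then obtain y where y: "h = matrix_inv g ** y" "y \<in> A" "y \<in> GL" by auto
  have "g ** (matrix_inv g ** y) = y"
    using assms by (simp add: matrix_mul_assoc invertible_matrix_inv GL_iff)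
  then show "h \<in> (\<lambda>h. g ** h) -` A \<inter> GL"
    using y assms by (auto intro!: GL_mult matrix_inv_GL)
qed

lemma distr_left_mult: assumes "g \<in> GL" shows "distr \<mu> \<mu> (\<lambda>h. g ** h) = \<mu>"
proof (rule measure_eqI)
  fix A assume "A \<in> sets (distr \<mu> \<mu> (\<lambda>h. g ** h))"
  then have A: "A \<in> sets \<mu>" by simp
  then have "A \<inter> GL = A" using sets.sets_into_space[OF A] by (auto simp: space_mu)
  then have "emeasure (distr \<mu> \<mu> (\<lambda>h. g ** h)) A = emeasure \<mu> ((\<lambda>h. matrix_inv g ** h) ` A)"
    using emeasure_distr[OF left_mult_measurable[OF assms] A] left_mult_image[OF assms, of A]
    by (simp add: space_mu)
  also have "\<dots> = emeasure \<mu> A" using left_inv[OF matrix_inv_GL[OF assms] A] .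
  finally show "emeasure (distr \<mu> \<mu> (\<lambda>h. g ** h)) A = emeasure \<mu> A" .
qed simp

lemma integral_left_mult:
  assumes "g \<in> GL" "tame f" shows "(LINT h|\<mu>. f (g ** h)) = (LINT h|\<mu>. f h)"
  using integral_distr[OF left_mult_measurable[OF assms(1)] tame_measurable[OF assms(2)]]
  unfolding distr_left_mult[OF assms(1)] by (rule sym)

definition vol :: real where "vol = measure \<mu> (GL_ball 0)"

text \<open>Finitely many translates of the open set \<open>GL_ball 0\<close> cover any compact
  subset of \<open>GL\<close>. If it were null, all compact sets would be null, and inner regularity
  on \<open>GL\<close> would make the measure zero.\<close>

lemma vol_pos: "0 < vol"
proof (rule ccontr)
  assume "\<not> 0 < vol"
  moreover have "0 \<le> vol" by (simp add: vol_def)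
  ultimately have "vol = 0" by linarith
  moreover have "emeasure \<mu> (GL_ball 0) < \<infinity>" by (rule finite_compact[OF compact_GL_ball]) (auto simp: GL_ball_def)
  ultimately have z: "emeasure \<mu> (GL_ball 0) = 0"
    unfolding vol_def by (simp add: emeasure_eq_ennreal_measure)
  have one: "mat 1 \<in> GL_ball 0" by (simp add: GL_ball_def GL_one matrix_inv_one)
  have zC: "emeasure \<mu> C = 0" if C: "compact C" "C \<subseteq> GL" for C :: "('a^'n^'n) set"
  proof -
    define U :: "'a^'n^'n \<Rightarrow> ('a^'n^'n) set" where "U g = (\<lambda>h. matrix_inv g ** h) -` GL_ball 0" for g
    have opU: "open (U g)" for g
      using open_vimage[OF open_GL_ball continuous_left_mult[of "matrix_inv g"]] by (simp add: U_def)
    have Ueq: "U g \<inter> GL = (\<lambda>h. g ** h) ` GL_ball 0" if "g \<in> GL" for g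
      using left_mult_image[OF matrix_inv_GL[OF that], of "GL_ball 0"] matrix_inv_inv[OF that]
      by (simp add: U_def GL_ball_def Int_absorb2)
    have "C \<subseteq> (\<Union>g\<in>C. U g)"
    proof
      fix x assume "x \<in> C"
      moreover from this have "matrix_inv x ** x = mat 1" using C by (auto simp: GL_iff invertible_matrix_inv)
      ultimately show "x \<in> (\<Union>g\<in>C. U g)" using one by (auto simp: U_def intro!: bexI[of _ x])
    qed
    then obtain F where F: "F \<subseteq> C" "finite F" "C \<subseteq> (\<Union>g\<in>F. U g)"
      by (rule compactE_image[OF C(1) opU])
    have FU: "(\<lambda>g. U g \<inter> GL) ` F \<subseteq> sets \<mu>"
      using opU by (auto intro!: open_in_sets open_Int open_GL)
    have "emeasure \<mu> C \<le> emeasure \<mu> (\<Union>g\<in>F. U g \<inter> GL)"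
      using F C FU by (intro emeasure_mono sets.finite_UN) auto
    also have "\<dots> \<le> (\<Sum>g\<in>F. emeasure \<mu> (U g \<inter> GL))"
      by (rule emeasure_subadditive_finite[OF F(2) FU])
    also have "\<dots> = 0"
    proof (rule sum.neutral, rule ballI)
      fix g assume "g \<in> F"
      then have "g \<in> GL" using F C by blast
      then show "emeasure \<mu> (U g \<inter> GL) = 0" using left_inv[OF _ GL_ball_sets, of g 0] z Ueq by simp
    qed
    finally show ?thesis by simp
  qed
  have "emeasure \<mu> GL = (SUP K\<in>{K. compact K \<and> K \<subseteq> GL}. emeasure \<mu> K)"
  proof -
    have "\<forall>U. openin (top_of_set GL) U \<longrightarrow>
        emeasure \<mu> U = (SUP K\<in>{K. compact K \<and> K \<subseteq> U}. emeasure \<mu> K)"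
      using haar[unfolded haar_measure_GL_def] by (elim conjE)
    then show ?thesis by simp
  qed
  also have "\<dots> \<le> 0" by (rule SUP_least) (simp add: zC)
  finally have "emeasure \<mu> GL \<le> 0" .
  moreover have "emeasure \<mu> (space \<mu>) \<noteq> 0" using haar[unfolded haar_measure_GL_def] by (elim conjE)
  ultimately show False by (simp add: space_mu)
qed

end

section \<open>The transform, the zeta coefficients and the operators on them\<close>

context haar
begin

definition tilde :: "(('a^'n^'n) \<times> ('a^'n^'n) \<Rightarrow> complex) \<Rightarrow> 'a \<Rightarrow> complex" where
  "tilde \<phi> t = (LINT h|\<mu>. \<phi> (smat t h, matrix_inv h))"

text \<open>The coefficient of \<open>z ^ k\<close> in the Godement-Jacquet zeta integral of \<open>\<phi> (\<cdot>, 0)\<close>, graded by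
  the valuation of the determinant; no convergence question arises coefficientwise.\<close>

definition zeta :: "(('a^'n^'n) \<times> ('a^'n^'n) \<Rightarrow> complex) \<Rightarrow> int \<Rightarrow> complex" where
  "zeta \<phi> k = (LINT h|\<mu>. (if val (det h) = k then \<phi> (h, 0) else 0))"

lemma phi_tilde_eq_tilde: "phi_tilde \<mu> \<phi> t = tilde \<phi> t"
  by (simp add: phi_tilde_def tilde_def smat_def)

lemma tame_zeta: "schwartz \<phi> \<Longrightarrow> tame (\<lambda>h. if val (det h) = k then \<phi> (h, 0) else 0)"
  using tame_restricted[of \<phi> "{k}" k] by simp

lemma tilde_add: "schwartz \<phi> \<Longrightarrow> schwartz \<psi> \<Longrightarrow> t \<noteq> 0 \<Longrightarrow> tilde (\<lambda>p. \<phi> p + \<psi> p) t = tilde \<phi> t + tilde \<psi> t"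
  unfolding tilde_def by (intro Bochner_Integration.integral_add tame_integrable tame_integrand)

lemma tilde_scale: "tilde (\<lambda>p. c * \<phi> p) t = c * tilde \<phi> t"
  unfolding tilde_def by simp

lemma zeta_add: "schwartz \<phi> \<Longrightarrow> schwartz \<psi> \<Longrightarrow> zeta (\<lambda>p. \<phi> p + \<psi> p) k = zeta \<phi> k + zeta \<psi> k"
proof -
  assume "schwartz \<phi>" "schwartz \<psi>"
  then have "integrable \<mu> (\<lambda>h. if val (det h) = k then \<phi> (h, 0) else 0)"
    "integrable \<mu> (\<lambda>h. if val (det h) = k then \<psi> (h, 0) else 0)"
    by (auto intro!: tame_integrable tame_zeta)
  then have "zeta \<phi> k + zeta \<psi> k = (LINT h|\<mu>. (if val (det h) = k then \<phi> (h, 0) else 0) +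
      (if val (det h) = k then \<psi> (h, 0) else 0))"
    unfolding zeta_def by (rule Bochner_Integration.integral_add[symmetric])
  also have "\<dots> = zeta (\<lambda>p. \<phi> p + \<psi> p) k"
    unfolding zeta_def by (intro Bochner_Integration.integral_cong) auto
  finally show ?thesis by simp
qed

lemma zeta_scale: "zeta (\<lambda>p. c * \<phi> p) k = c * zeta \<phi> k"
proof -
  have "zeta (\<lambda>p. c * \<phi> p) k = (LINT h|\<mu>. c * (if val (det h) = k then \<phi> (h, 0) else 0))"
    unfolding zeta_def by (intro Bochner_Integration.integral_cong) auto
  then show ?thesis by (simp add: zeta_def)
qed

lemma tilde_zero [simp]: "tilde (\<lambda>_. 0) t = 0"
  by (simp add: tilde_def)

lemma zeta_zero [simp]: "zeta (\<lambda>_. 0) k = 0"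
  by (simp add: zeta_def)

lemma tilde_sum: "finite I \<Longrightarrow> (\<And>i. i \<in> I \<Longrightarrow> schwartz (\<phi> i)) \<Longrightarrow> t \<noteq> 0 \<Longrightarrow>
    tilde (\<lambda>p. \<Sum>i\<in>I. \<phi> i p) t = (\<Sum>i\<in>I. tilde (\<phi> i) t)"
  by (induction I rule: finite_induct) (auto simp: tilde_add schwartz_sum)

lemma zeta_sum: "finite I \<Longrightarrow> (\<And>i. i \<in> I \<Longrightarrow> schwartz (\<phi> i)) \<Longrightarrow>
    zeta (\<lambda>p. \<Sum>i\<in>I. \<phi> i p) k = (\<Sum>i\<in>I. zeta (\<phi> i) k)"
  by (induction I rule: finite_induct) (auto simp: zeta_add schwartz_sum)

lemma tilde_diff: "schwartz \<phi> \<Longrightarrow> schwartz \<psi> \<Longrightarrow> t \<noteq> 0 \<Longrightarrow> tilde (\<lambda>p. \<phi> p - \<psi> p) t = tilde \<phi> t - tilde \<psi> t"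
  using tilde_add[of \<phi> "\<lambda>p. (- 1) * \<psi> p" t] tilde_scale[of "-1" \<psi> t] schwartz_scale[of \<psi> "-1"] by simp

lemma zeta_diff: "schwartz \<phi> \<Longrightarrow> schwartz \<psi> \<Longrightarrow> zeta (\<lambda>p. \<phi> p - \<psi> p) k = zeta \<phi> k - zeta \<psi> k"
  using zeta_add[of \<phi> "\<lambda>p. (- 1) * \<psi> p" k] zeta_scale[of "-1" \<psi> k] schwartz_scale[of \<psi> "-1"] by simp

text \<open>The substitution of \<open>g ** h\<close> for \<open>h\<close> absorbs \<open>g\<close>
  in both arguments; the scalar \<open>c\<close> enters only the first one and is left over as a
  dilation of \<open>t\<close>.\<close>

lemma tilde_act:
  assumes "schwartz \<phi>" "g \<in> GL" "c \<noteq> 0" "t \<noteq> 0"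
  shows "tilde (\<lambda>(X, Y). \<phi> (smat c g ** X, Y ** matrix_inv g)) t = tilde \<phi> (c * t)"
proof -
  have "tilde (\<lambda>(X, Y). \<phi> (smat c g ** X, Y ** matrix_inv g)) t
      = (LINT h|\<mu>. \<phi> (smat (c * t) (g ** h), matrix_inv (g ** h)))"
    unfolding tilde_def
  proof (intro Bochner_Integration.integral_cong refl)
    fix h assume "h \<in> space \<mu>"
    then have "matrix_inv h ** matrix_inv g = matrix_inv (g ** h)"
      using matrix_inv_mult[OF assms(2)] by (simp add: space_mu)
    moreover have "smat c g ** smat t h = smat (c * t) (g ** h)" by (simp add: mat_algebra mult.commute)
    ultimately show "(case (smat t h, matrix_inv h) of (X, Y) \<Rightarrow> \<phi> (smat c g ** X, Y ** matrix_inv g))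
        = \<phi> (smat (c * t) (g ** h), matrix_inv (g ** h))" by simp
  qed
  also have "\<dots> = tilde \<phi> (c * t)"
    unfolding tilde_def using integral_left_mult[OF assms(2) tame_integrand[OF assms(1), of "c * t"]] assms
    by simp
  finally show ?thesis .
qed

text \<open>The second argument is 0, so an arbitrary \<open>g'\<close> is allowed. This freedom is
  used both for the operators and for translating \<omega> in the first variable alone.\<close>

lemma zeta_act:
  assumes "schwartz \<phi>" "g \<in> GL"
  shows "zeta (\<lambda>(X, Y). \<phi> (g ** X, Y ** g')) k = zeta \<phi> (k + val (det g))"
proof -
  have "zeta (\<lambda>(X, Y). \<phi> (g ** X, Y ** g')) k
     = (LINT h|\<mu>. (if val (det (g ** h)) = k + val (det g) then \<phi> (g ** h, 0) else 0))"
    unfolding zeta_def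
  proof (intro Bochner_Integration.integral_cong refl)
    fix h assume "h \<in> space \<mu>"
    then have "val (det (g ** h)) = val (det g) + val (det h)"
      using assms by (simp add: det_mul space_mu GL_iff_det val_mult)
    then show "(if val (det h) = k then case (h, 0) of (X, Y) \<Rightarrow> \<phi> (g ** X, Y ** g') else 0)
       = (if val (det (g ** h)) = k + val (det g) then \<phi> (g ** h, 0) else 0)" by simp
  qed
  also have "\<dots> = zeta \<phi> (k + val (det g))"
    unfolding zeta_def by (rule integral_left_mult[OF assms(2) tame_zeta[OF assms(1)]])
  finally show ?thesis .
qed

text \<open>The operator \<open>fop g \<kappa>\<close> on test functions induces \<open>gop \<kappa>\<close> on germs at \<open>0\<close> and \<open>zop\<close> on
  zeta coefficients. Only left invariance enters, and all induced operators commute.\<close>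

definition gop :: "complex \<Rightarrow> ('a \<Rightarrow> complex) \<Rightarrow> 'a \<Rightarrow> complex" where
  "gop \<kappa> f t = f (\<pi> * t) - \<kappa> * f t"

definition zop :: "int \<Rightarrow> complex \<Rightarrow> (int \<Rightarrow> complex) \<Rightarrow> int \<Rightarrow> complex" where
  "zop e \<kappa> a k = a (k + e) - \<kappa> * a k"

definition fop :: "'a^'n^'n \<Rightarrow> complex \<Rightarrow> (('a^'n^'n) \<times> ('a^'n^'n) \<Rightarrow> complex) \<Rightarrow> ('a^'n^'n) \<times> ('a^'n^'n) \<Rightarrow> complex" where
  "fop g \<kappa> \<phi> p = (case p of (X, Y) \<Rightarrow> \<phi> (smat \<pi> g ** X, Y ** matrix_inv g)) - \<kappa> * \<phi> p"

definition op_shift :: "'a^'n^'n \<Rightarrow> int" where "op_shift g = val (det (smat \<pi> g))"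

lemma schwartz_fop: assumes "schwartz \<phi>" "g \<in> GL" shows "schwartz (fop g \<kappa> \<phi>)"
proof -
  have "schwartz (\<lambda>p. (\<lambda>(X, Y). \<phi> (smat \<pi> g ** X, Y ** matrix_inv g)) p - (\<lambda>p. \<kappa> * \<phi> p) p)"
    using assms by (intro schwartz_diff schwartz_act schwartz_scale GL_smat matrix_inv_GL) auto
  then show ?thesis by (simp add: fop_def[abs_def])
qed

lemma tilde_fop: assumes "schwartz \<phi>" "g \<in> GL" "t \<noteq> 0" shows "tilde (fop g \<kappa> \<phi>) t = gop \<kappa> (tilde \<phi>) t"
proof -
  have "tilde (fop g \<kappa> \<phi>) t = tilde (\<lambda>(X, Y). \<phi> (smat \<pi> g ** X, Y ** matrix_inv g)) t - tilde (\<lambda>p. \<kappa> * \<phi> p) t"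
    unfolding fop_def[abs_def] using assms
    by (intro tilde_diff schwartz_act schwartz_scale GL_smat matrix_inv_GL) auto
  then show ?thesis using assms by (simp add: tilde_act tilde_scale gop_def)
qed

lemma zeta_fop: assumes "schwartz \<phi>" "g \<in> GL" shows "zeta (fop g \<kappa> \<phi>) = zop (op_shift g) \<kappa> (zeta \<phi>)"
proof
  fix k
  have "zeta (fop g \<kappa> \<phi>) k = zeta (\<lambda>(X, Y). \<phi> (smat \<pi> g ** X, Y ** matrix_inv g)) k - zeta (\<lambda>p. \<kappa> * \<phi> p) k"
    unfolding fop_def[abs_def] using assms
    by (intro zeta_diff schwartz_act schwartz_scale GL_smat matrix_inv_GL) auto
  then show "zeta (fop g \<kappa> \<phi>) k = zop (op_shift g) \<kappa> (zeta \<phi>) k"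
    using assms by (simp add: zeta_act zeta_scale zop_def op_shift_def GL_smat)
qed

definition gops :: "(('a^'n^'n) \<times> complex) list \<Rightarrow> ('a \<Rightarrow> complex) \<Rightarrow> 'a \<Rightarrow> complex" where
  "gops es = foldr (\<lambda>(g, \<kappa>). gop \<kappa>) es"

definition zops :: "(('a^'n^'n) \<times> complex) list \<Rightarrow> (int \<Rightarrow> complex) \<Rightarrow> int \<Rightarrow> complex" where
  "zops es = foldr (\<lambda>(g, \<kappa>). zop (op_shift g) \<kappa>) es"

lemma gops_simps [simp]: "gops [] f = f" "gops ((g, \<kappa>) # es) f = gop \<kappa> (gops es f)"
  "gops (es @ es') f = gops es (gops es' f)"
  by (simp_all add: gops_def)

lemma zops_simps [simp]: "zops [] a = a" "zops ((g, \<kappa>) # es) a = zop (op_shift g) \<kappa> (zops es a)"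
  "zops (es @ es') a = zops es (zops es' a)"
  by (simp_all add: zops_def)

lemma gop_commute: "gop \<kappa> (gop \<kappa>' f) = gop \<kappa>' (gop \<kappa> f)"
  by (rule ext) (simp add: gop_def algebra_simps)

lemma zop_commute: "zop e \<kappa> (zop e' \<kappa>' a) = zop e' \<kappa>' (zop e \<kappa> a)"
  by (rule ext) (simp add: zop_def algebra_simps)

lemma gops_gop: "gops es (gop \<kappa> f) = gop \<kappa> (gops es f)"
  by (induction es) (auto simp: gop_commute)

lemma zops_zop: "zops es (zop e \<kappa> a) = zop e \<kappa> (zops es a)"
  by (induction es) (auto simp: zop_commute)

lemma gops_commute: "gops es (gops es' f) = gops es' (gops es f)"
  by (induction es) (auto simp: gops_gop)

lemma zops_commute: "zops es (zops es' a) = zops es' (zops es a)"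
  by (induction es) (auto simp: zops_zop)

lemma gops_add: "gops es (\<lambda>t. f t + f' t) = (\<lambda>t. gops es f t + gops es f' t)"
  by (induction es) (auto simp: gop_def fun_eq_iff algebra_simps)

lemma zops_add: "zops es (\<lambda>t. f t + f' t) = (\<lambda>t. zops es f t + zops es f' t)"
  by (induction es) (auto simp: zop_def fun_eq_iff algebra_simps)

lemma gops_scale: "gops es (\<lambda>t. c * f t) = (\<lambda>t. c * gops es f t)"
  by (induction es) (auto simp: gop_def fun_eq_iff algebra_simps)

lemma zops_scale: "zops es (\<lambda>t. c * f t) = (\<lambda>t. c * zops es f t)"
  by (induction es) (auto simp: zop_def fun_eq_iff algebra_simps)

section \<open>Germs at zero and their reduction by operators\<close>

definition near0 :: "('a \<Rightarrow> complex) \<Rightarrow> ('a \<Rightarrow> complex) \<Rightarrow> bool" where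
  "near0 f f' \<longleftrightarrow> (\<exists>m. \<forall>t. t \<noteq> 0 \<longrightarrow> v t \<le> q m \<longrightarrow> f t = f' t)"

lemma near0_refl [simp]: "near0 f f"
  by (simp add: near0_def)

lemma near0_trans: assumes "near0 f g" "near0 g h" shows "near0 f h"
proof -
  obtain m where m: "\<And>t. t \<noteq> 0 \<Longrightarrow> v t \<le> q m \<Longrightarrow> f t = g t" using assms(1) unfolding near0_def by blast
  obtain m' where m': "\<And>t. t \<noteq> 0 \<Longrightarrow> v t \<le> q m' \<Longrightarrow> g t = h t" using assms(2) unfolding near0_def by blast
  have "f t = h t" if t: "t \<noteq> 0" "v t \<le> q (max m m')" for t
  proof -
    have "v t \<le> q m" "v t \<le> q m'"
      using t(2) order_trans[OF t(2)] by (simp_all add: order_trans[OF t(2)])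
    then show ?thesis using m m' t(1) by simp
  qed
  then show ?thesis unfolding near0_def by blast
qed

lemma near0_add: assumes "near0 f g" "near0 f' g'" shows "near0 (\<lambda>t. f t + f' t) (\<lambda>t. g t + g' t)"
proof -
  obtain m where m: "\<And>t. t \<noteq> 0 \<Longrightarrow> v t \<le> q m \<Longrightarrow> f t = g t" using assms(1) unfolding near0_def by blast
  obtain m' where m': "\<And>t. t \<noteq> 0 \<Longrightarrow> v t \<le> q m' \<Longrightarrow> f' t = g' t" using assms(2) unfolding near0_def by blast
  have "f t + f' t = g t + g' t" if t: "t \<noteq> 0" "v t \<le> q (max m m')" for t
  proof -
    have "v t \<le> q m" "v t \<le> q m'"
      using t(2) order_trans[OF t(2)] by (simp_all add: order_trans[OF t(2)])
    then show ?thesis using m m' t(1) by simp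
  qed
  then show ?thesis unfolding near0_def by blast
qed

lemma near0_scale: "near0 f g \<Longrightarrow> near0 (\<lambda>t. c * f t) (\<lambda>t. c * g t)"
  unfolding near0_def by metis

lemma near0_gop: assumes "near0 f g" shows "near0 (gop \<kappa> f) (gop \<kappa> g)"
proof -
  obtain m where m: "\<And>t. t \<noteq> 0 \<Longrightarrow> v t \<le> q m \<Longrightarrow> f t = g t" using assms(1) unfolding near0_def by blast
  have "gop \<kappa> f t = gop \<kappa> g t" if "t \<noteq> 0" "v t \<le> q m" for t
  proof -
    have "v (\<pi> * t) \<le> v t" using unif_less by (simp add: v_mult mult_left_le_one_le)
    then show ?thesis using m[of t] m[of "\<pi> * t"] that by (simp add: gop_def)
  qed
  then show ?thesis unfolding near0_def by blast
qed

lemma near0_gops: "near0 f g \<Longrightarrow> near0 (gops es f) (gops es g)"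
  by (induction es) (auto intro: near0_gop)

text \<open>The filtration by rank on the limit set \<open>X Y = Y X = 0\<close>. Index 0 imposes
  nothing beyond being Schwartz, index 1 asks for vanishing at all pairs \<open>(0, Y)\<close>, and
  index \<open>CARD('n)\<close> leaves only invertible \<open>X\<close> on that set.\<close>

definition vanishing :: "nat \<Rightarrow> (('a^'n^'n) \<times> ('a^'n^'n) \<Rightarrow> complex) \<Rightarrow> bool" where
  "vanishing r \<phi> \<longleftrightarrow> schwartz \<phi> \<and> (\<forall>X Y. X ** Y = 0 \<longrightarrow> Y ** X = 0 \<longrightarrow> col_rank X < r \<longrightarrow> \<phi> (X, Y) = 0)"

lemma vanishing_schwartz: "vanishing r \<phi> \<Longrightarrow> schwartz \<phi>"
  by (simp add: vanishing_def)

lemma vanishing_fop: assumes "vanishing r \<phi>" "g \<in> GL" shows "vanishing r (fop g \<kappa> \<phi>)"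
  unfolding vanishing_def
proof (intro conjI allI impI)
  show "schwartz (fop g \<kappa> \<phi>)" using assms by (simp add: schwartz_fop vanishing_schwartz)
  fix X Y :: "'a^'n^'n" assume *: "X ** Y = 0" "Y ** X = 0" "col_rank X < r"
  have g: "smat \<pi> g \<in> GL" using assms by (simp add: GL_smat)
  have i: "matrix_inv g ** smat \<pi> g = smat \<pi> (mat 1)"
    using assms by (simp add: mat_algebra invertible_matrix_inv GL_iff)
  have "(Y ** matrix_inv g) ** (smat \<pi> g ** X) = Y ** (matrix_inv g ** smat \<pi> g) ** X"
    by (simp add: matrix_mul_assoc)
  also have "\<dots> = 0" using * unfolding i by (simp add: mat_algebra)
  finally have 2: "(Y ** matrix_inv g) ** (smat \<pi> g ** X) = 0" .
  have "(smat \<pi> g ** X) ** (Y ** matrix_inv g) = smat \<pi> g ** (X ** Y) ** matrix_inv g"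
    by (simp add: matrix_mul_assoc)
  then have 1: "(smat \<pi> g ** X) ** (Y ** matrix_inv g) = 0" using * by simp
  have "col_rank (smat \<pi> g ** X) < r" using * col_rank_left_mult_GL[OF g] by simp
  then show "fop g \<kappa> \<phi> (X, Y) = 0"
    using assms * 1 2 by (simp add: fop_def vanishing_def)
qed

lemma vanishing_add: "vanishing r \<phi> \<Longrightarrow> vanishing r \<psi> \<Longrightarrow> vanishing r (\<lambda>p. \<phi> p + \<psi> p)"
  by (simp add: vanishing_def schwartz_add)

lemma vanishing_scale: "vanishing r \<phi> \<Longrightarrow> vanishing r (\<lambda>p. c * \<phi> p)"
  by (simp add: vanishing_def schwartz_scale)

lemma vanishing_zero: "vanishing r (\<lambda>_. 0)"
  by (simp add: vanishing_def schwartz_zero)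

text \<open>Germ and zeta series are required to come from the same function: the constant that the
  germ becomes at top rank is read off from the zeta side.\<close>

definition realized :: "nat \<Rightarrow> ('a \<Rightarrow> complex) \<Rightarrow> (int \<Rightarrow> complex) \<Rightarrow> bool" where
  "realized r f a \<longleftrightarrow> (\<exists>\<phi>. vanishing r \<phi> \<and> near0 f (tilde \<phi>) \<and> a = zeta \<phi>)"

lemma realized_near0: "realized r f a \<Longrightarrow> near0 f' f \<Longrightarrow> realized r f' a"
  unfolding realized_def using near0_trans by blast

lemma realized_add:
  assumes "realized r f a" "realized r f' a'" shows "realized r (\<lambda>t. f t + f' t) (\<lambda>k. a k + a' k)"
proof -
  obtain \<phi> \<psi> where p: "vanishing r \<phi>" "near0 f (tilde \<phi>)" "a = zeta \<phi>" "vanishing r \<psi>" "near0 f' (tilde \<psi>)" "a' = zeta \<psi>"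
    using assms by (auto simp: realized_def)
  have "near0 (\<lambda>t. f t + f' t) (\<lambda>t. tilde \<phi> t + tilde \<psi> t)" using p by (intro near0_add)
  moreover have "near0 (\<lambda>t. tilde \<phi> t + tilde \<psi> t) (tilde (\<lambda>p. \<phi> p + \<psi> p))"
    unfolding near0_def using p by (auto simp: tilde_add vanishing_schwartz)
  ultimately have "near0 (\<lambda>t. f t + f' t) (tilde (\<lambda>p. \<phi> p + \<psi> p))" by (rule near0_trans)
  then show ?thesis unfolding realized_def using p
    by (intro exI[of _ "\<lambda>p. \<phi> p + \<psi> p"]) (auto simp: zeta_add vanishing_schwartz vanishing_add)
qed

lemma realized_scale:
  assumes "realized r f a" shows "realized r (\<lambda>t. c * f t) (\<lambda>k. c * a k)"
proof -
  obtain \<phi> where p: "vanishing r \<phi>" "near0 f (tilde \<phi>)" "a = zeta \<phi>" using assms by (auto simp: realized_def)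
  then show ?thesis unfolding realized_def
    by (intro exI[of _ "\<lambda>p. c * \<phi> p"]) (auto simp: zeta_scale tilde_scale[abs_def] vanishing_scale near0_scale)
qed

lemma realized_op:
  assumes "realized r f a" "g \<in> GL" shows "realized r (gop \<kappa> f) (zop (op_shift g) \<kappa> a)"
proof -
  obtain \<phi> where p: "vanishing r \<phi>" "near0 f (tilde \<phi>)" "a = zeta \<phi>" using assms by (auto simp: realized_def)
  have "near0 (gop \<kappa> f) (gop \<kappa> (tilde \<phi>))" using p by (intro near0_gop)
  moreover have "near0 (gop \<kappa> (tilde \<phi>)) (tilde (fop g \<kappa> \<phi>))"
    unfolding near0_def using p assms by (auto simp: tilde_fop vanishing_schwartz)
  ultimately have "near0 (gop \<kappa> f) (tilde (fop g \<kappa> \<phi>))" by (rule near0_trans)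
  then show ?thesis unfolding realized_def using p assms
    by (intro exI[of _ "fop g \<kappa> \<phi>"]) (auto simp: zeta_fop vanishing_schwartz vanishing_fop)
qed

lemma realized_ops:
  assumes "realized r f a" "\<forall>(g, \<kappa>)\<in>set es. g \<in> GL" shows "realized r (gops es f) (zops es a)"
  using assms(2) by (induction es) (auto intro: realized_op assms(1))

text \<open>The condition \<open>\<kappa> \<noteq> 1\<close> keeps the factors \<open>z ^ e - \<kappa>\<close> from vanishing at \<open>z = 1\<close>.\<close>

definition admissible :: "(('a^'n^'n) \<times> complex) list \<Rightarrow> bool" where
  "admissible es \<longleftrightarrow> (\<forall>(g, \<kappa>)\<in>set es. g \<in> GL \<and> \<kappa> \<noteq> 1)"

definition reducible :: "nat \<Rightarrow> ('a \<Rightarrow> complex) \<Rightarrow> (int \<Rightarrow> complex) \<Rightarrow> bool" where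
  "reducible r f a \<longleftrightarrow> (\<exists>es. admissible es \<and> realized r (gops es f) (zops es a))"

lemma reducible_if_realized: "realized r f a \<Longrightarrow> reducible r f a"
  unfolding reducible_def by (intro exI[of _ "[]"]) (simp add: admissible_def)

lemma reducible_scale: "reducible r f a \<Longrightarrow> reducible r (\<lambda>t. c * f t) (\<lambda>k. c * a k)"
  unfolding reducible_def using realized_scale by (auto simp: gops_scale zops_scale)

lemma reducible_near0: "reducible r f a \<Longrightarrow> near0 f' f \<Longrightarrow> reducible r f' a"
  unfolding reducible_def using near0_gops realized_near0 by blast

text \<open>The summands may need different operators. As these commute and preserve realizability,
  the concatenated list serves both.\<close>

lemma reducible_add:
  assumes "reducible r f a" "reducible r f' a'" shows "reducible r (\<lambda>t. f t + f' t) (\<lambda>k. a k + a' k)"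
proof -
  obtain es where es: "admissible es" "realized r (gops es f) (zops es a)"
    using assms(1) by (auto simp: reducible_def)
  obtain es' where es': "admissible es'" "realized r (gops es' f') (zops es' a')"
    using assms(2) by (auto simp: reducible_def)
  have "realized r (gops es' (gops es f)) (zops es' (zops es a))"
    by (rule realized_ops) (use es es' in \<open>auto simp: admissible_def\<close>)
  moreover have "realized r (gops es (gops es' f')) (zops es (zops es' a'))"
    by (rule realized_ops) (use es es' in \<open>auto simp: admissible_def\<close>)
  ultimately have "realized r (\<lambda>t. gops es (gops es' f) t + gops es (gops es' f') t)
      (\<lambda>k. zops es (zops es' a) k + zops es (zops es' a') k)"
    unfolding gops_commute[of es' es] zops_commute[of es' es] by (rule realized_add)
  then have "realized r (gops (es @ es') (\<lambda>t. f t + f' t)) (zops (es @ es') (\<lambda>k. a k + a' k))"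
    by (simp add: gops_add zops_add)
  moreover have "admissible (es @ es')" using es es' by (auto simp: admissible_def)
  ultimately show ?thesis unfolding reducible_def by blast
qed

lemma reducible_sum:
  assumes "finite I" "\<And>i. i \<in> I \<Longrightarrow> reducible r (f i) (a i)"
  shows "reducible r (\<lambda>t. \<Sum>i\<in>I. f i t) (\<lambda>k. \<Sum>i\<in>I. a i k)"
  using assms
proof (induction I rule: finite_induct)
  case empty
  have "realized r (\<lambda>_. 0) (\<lambda>_. 0)"
    unfolding realized_def near0_def by (intro exI[of _ "\<lambda>_. 0"]) (auto simp: vanishing_zero fun_eq_iff)
  then show ?case using reducible_if_realized by simp
next
  case (insert x I)
  then show ?case using reducible_add[of r "f x" "a x"] by simp
qed

lemma reducible_trans:
  assumes "reducible r f a" "\<And>\<phi>. vanishing r \<phi> \<Longrightarrow> reducible r' (tilde \<phi>) (zeta \<phi>)"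
  shows "reducible r' f a"
proof -
  obtain es \<phi> where es: "admissible es" "vanishing r \<phi>" "near0 (gops es f) (tilde \<phi>)" "zops es a = zeta \<phi>"
    using assms(1) by (auto simp: reducible_def realized_def)
  obtain es' where es': "admissible es'" "realized r' (gops es' (tilde \<phi>)) (zops es' (zeta \<phi>))"
    using assms(2)[OF es(2)] by (auto simp: reducible_def)
  have "realized r' (gops es' (gops es f)) (zops es' (zops es a))"
    unfolding es(4) by (rule realized_near0[OF es'(2) near0_gops[OF es(3)]])
  moreover have "admissible (es' @ es)" using es es' by (auto simp: admissible_def)
  ultimately show ?thesis unfolding reducible_def by (metis gops_simps(3) zops_simps(3))
qed

end

section \<open>Local coordinates around a matrix of given rank\<close>

context uniformized
begin

text \<open>Coordinates near a matrix \<open>X0\<close>: \<open>P\<close> is the projection onto the column space of \<open>X0\<close>, and a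
  matrix \<open>X\<close> close to \<open>X0\<close> of the same rank is \<open>(1 + b) P X\<close> for a unique \<open>b = Q b P\<close>.\<close>

lemma near_projection:
  fixes X X0 R P Q :: "'a^'n^'n"
  defines "P \<equiv> X0 ** R" and "Q \<equiv> mat 1 - P"
  assumes R: "X0 ** R ** X0 = X0"
    and C: "P ** (X - X0) ** R ** P \<in> M 1" and E: "Q ** (X - X0) ** R ** P \<in> M 0"
  obtains S where "P ** X ** S = P" "S ** P = S"
    "\<And>c. c ** P = c \<Longrightarrow> c ** P ** X = Q ** X \<Longrightarrow> c \<in> M 0"
proof -
  have PX0: "P ** X0 = X0" by (simp add: P_def R)
  have PP: "P ** P = P" using PX0 by (simp add: P_def matrix_mul_assoc)
  define C0 where "C0 = P ** (X - X0) ** R ** P"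
  define W where "W = matrix_inv (mat 1 + C0)"
  \<comment> \<open>The product \<open>P ** X ** R ** P\<close> equals
    \<open>P ** (mat 1 + C0)\<close>; undoing the factor \<open>mat 1 + C0\<close> by
    \<open>W\<close> turns the section \<open>R\<close> of \<open>X0\<close> into a section of
    \<open>P ** X\<close>.\<close>
  define S where "S = R ** P ** W"
  have C1: "C0 \<in> M 1" using C by (simp add: C0_def)
  have u: "mat 1 + C0 \<in> GL" by (rule one_plus_GL[OF C1])
  have W: "(mat 1 + C0) ** W = mat 1" "W ** (mat 1 + C0) = mat 1"
    using u by (simp_all add: W_def invertible_matrix_inv GL_iff)
  have "W - mat 1 \<in> M 1" unfolding W_def using C1 by (rule matrix_inv_one_plus) simp
  then have "W - mat 1 \<in> M 0" by (rule M_mono) simp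
  then have W0: "W \<in> M 0" by (simp add: M_shift_iff)
  have CP: "P ** C0 = C0" "C0 ** P = C0"
    unfolding C0_def by (metis PP matrix_mul_assoc)+
  have "(mat 1 + C0) ** P = P ** (mat 1 + C0)" by (simp add: matrix_add_rdistrib' matrix_add_ldistrib CP)
  then have PW: "W ** P = P ** W"
    by (metis W matrix_mul_assoc matrix_mul_lid matrix_mul_rid)
  have "P ** X ** R ** P = P + C0"
  proof -
    have "P ** X0 ** R ** P = P" by (metis PP PX0 P_def)
    then show ?thesis by (simp add: C0_def matrix_diff_ldistrib matrix_diff_rdistrib)
  qed
  also have "\<dots> = P ** (mat 1 + C0)" by (simp add: matrix_add_ldistrib CP)
  finally have "P ** X ** R ** P ** W = P" by (metis W(1) matrix_mul_assoc matrix_mul_rid)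
  then have 1: "P ** X ** S = P" by (simp add: S_def matrix_mul_assoc)
  have 2: "S ** P = S" unfolding S_def by (metis PP PW matrix_mul_assoc)
  have 3: "c \<in> M 0" if c: "c ** P = c" "c ** P ** X = Q ** X" for c
  proof -
    \<comment> \<open>As \<open>Q ** X0 = 0\<close>, only the displacement \<open>X - X0\<close>
      survives below, and its smallness makes the coordinate integral.\<close>
    have "c = c ** P ** X ** S" using 1 c(1) by (metis matrix_mul_assoc)
    also have "\<dots> = Q ** X ** S" by (simp add: c(2))
    also have "\<dots> = Q ** (X - X0) ** S"
      by (simp add: Q_def matrix_diff_ldistrib matrix_diff_rdistrib PX0)
    also have "\<dots> = (Q ** (X - X0) ** R ** P) ** W" by (simp add: S_def matrix_mul_assoc)
    also have "\<dots> \<in> M 0" using E W0 by (rule M_mult_0_right)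
    finally show ?thesis .
  qed
  show thesis using that 1 2 3 by blast
qed

lemma ex_near_projection:
  fixes X0 R P Q :: "'a^'n^'n"
  defines "P \<equiv> X0 ** R" and "Q \<equiv> mat 1 - P"
  assumes R: "X0 ** R ** X0 = X0"
  shows "\<exists>m. \<forall>X. X - X0 \<in> M m \<longrightarrow> (\<exists>S. P ** X ** S = P \<and> S ** P = S \<and>
    (\<forall>c. c ** P = c \<longrightarrow> c ** P ** X = Q ** X \<longrightarrow> c \<in> M 0))"
proof -
  obtain a1 where a1: "a1 \<ge> 0" "P \<in> M (- a1)" using ex_M by blast
  obtain a2 where a2: "a2 \<ge> 0" "Q \<in> M (- a2)" using ex_M by blast
  obtain a3 where a3: "a3 \<ge> 0" "R \<in> M (- a3)" using ex_M by blast
  define m where "m = 2 * a1 + a2 + a3 + 1"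
  have "\<exists>S. P ** X ** S = P \<and> S ** P = S \<and> (\<forall>c. c ** P = c \<longrightarrow> c ** P ** X = Q ** X \<longrightarrow> c \<in> M 0)"
    if X: "X - X0 \<in> M m" for X
  proof -
    have "P ** (X - X0) ** R ** P \<in> M (((- a1 + m) + - a3) + - a1)"
      using a1 a3 X by (intro M_mult)
    then have 1: "P ** (X - X0) ** R ** P \<in> M 1" by (rule M_mono) (use a1 a2 a3 in \<open>simp add: m_def\<close>)
    have "Q ** (X - X0) ** R ** P \<in> M (((- a2 + m) + - a3) + - a1)"
      using a1 a2 a3 X by (intro M_mult)
    then have 2: "Q ** (X - X0) ** R ** P \<in> M 0" by (rule M_mono) (use a1 a2 a3 in \<open>simp add: m_def\<close>)
    show ?thesis
      by (rule near_projection[OF R, of X]) (use 1 2 in \<open>auto simp: P_def Q_def\<close>)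
  qed
  then show ?thesis by blast
qed

text \<open>For \<open>X\<close> near \<open>X0\<close> the product \<open>P ** X\<close> still has
  a right factor \<open>S\<close> giving \<open>P\<close>, so \<open>X\<close> has at least the rank
  of \<open>P\<close>, which is that of \<open>X0\<close>.\<close>

lemma col_rank_lower_semicontinuous: "\<exists>m. \<forall>X. X - X0 \<in> M m \<longrightarrow> col_rank X0 \<le> col_rank X"
proof -
  obtain R where R: "X0 ** R ** X0 = X0" using ex_generalized_inverse by blast
  have "col_rank X0 \<le> col_rank X" if "X0 ** R ** X ** S = X0 ** R" for X S
  proof -
    have "col_rank X0 \<le> col_rank (X0 ** R)" using col_rank_mult_le_left[of "X0 ** R" X0] R by simp
    also have "\<dots> \<le> col_rank (X0 ** R ** X)" using col_rank_mult_le_left[of "X0 ** R ** X" S] that by simp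
    also have "\<dots> \<le> col_rank X" by (rule col_rank_mult_le_right)
    finally show ?thesis .
  qed
  note * = this
  obtain m where m: "\<And>X. X - X0 \<in> M m \<Longrightarrow> \<exists>S. X0 ** R ** X ** S = X0 ** R"
    using ex_near_projection[OF R] by (elim exE) blast
  then show ?thesis using * by (intro exI[of _ m]) meson
qed

text \<open>A whole lattice is excluded rather than just 0, because the pairs met at top rank have a
  scalar product \<open>t\<close> that is small but nonzero.\<close>

lemma mult_nz_stable:
  fixes V V' :: "'a^'n^'n"
  assumes nz: "V ** V' \<noteq> 0"
  shows "\<exists>m. \<forall>U U' m'. U - V \<in> M m \<longrightarrow> U' - V' \<in> M m \<longrightarrow> m \<le> m' \<longrightarrow> U ** U' \<notin> M m'"
proof -
  obtain a where a: "a \<ge> 0" "V \<in> M (- a)" using ex_M by blast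
  obtain b where b: "b \<ge> 0" "V' \<in> M (- b)" using ex_M by blast
  obtain k where k: "V ** V' \<notin> M (k + 1)" using ex_M_boundary[OF nz] by blast
  define m where "m = \<bar>k + 1\<bar> + a + b"
  have "U ** U' \<notin> M m'" if U: "U - V \<in> M m" "U' - V' \<in> M m" "m \<le> m'" for U U' m'
  proof
    assume "U ** U' \<in> M m'"
    then have z: "U ** U' \<in> M (k + 1)" by (rule M_mono) (use U a b in \<open>simp add: m_def\<close>)
    have "U' \<in> M (- b)" using M_shift_iff[of U' V' "- b"] M_mono[OF U(2), of "- b"] a b
      by (simp add: m_def)
    then have "(U - V) ** U' \<in> M (m + - b)" using U by (intro M_mult)
    then have 1: "(U - V) ** U' \<in> M (k + 1)" by (rule M_mono) (use a b in \<open>simp add: m_def\<close>)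
    have "V ** (U' - V') \<in> M (- a + m)" using U a by (intro M_mult)
    then have 2: "V ** (U' - V') \<in> M (k + 1)" by (rule M_mono) (use a b in \<open>simp add: m_def\<close>)
    have "V ** V' = U ** U' - ((U - V) ** U' + V ** (U' - V'))"
      by (simp add: matrix_diff_ldistrib matrix_diff_rdistrib)
    then show False using k M_diff[OF z M_add[OF 1 2]] by simp
  qed
  then show ?thesis by blast
qed

end

section \<open>Pushing functions off an intermediate rank stratum\<close>

context haar
begin

text \<open>Small balls around a pair outside the limit set miss that set, so every vanishing
  condition holds vacuously.\<close>

lemma ball_reducible_outside:
  assumes "X0 ** Y0 \<noteq> 0 \<or> Y0 ** X0 \<noteq> 0"
  shows "\<exists>m. \<forall>X1 Y1 m'. X1 - X0 \<in> M m \<longrightarrow> Y1 - Y0 \<in> M m \<longrightarrow> m \<le> m' \<longrightarrow>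
     vanishing r (\<lambda>(X, Y). if X - X1 \<in> M m' \<and> Y - Y1 \<in> M m' then 1 else 0)"
proof -
  have stable: "\<exists>m. \<forall>U U'. U - V \<in> M m \<longrightarrow> U' - V' \<in> M m \<longrightarrow> U ** U' \<noteq> 0"
    if nz: "V ** V' \<noteq> 0" for V V' :: "'a^'n^'n"
  proof -
    obtain m where "\<forall>U U' m'. U - V \<in> M m \<longrightarrow> U' - V' \<in> M m \<longrightarrow> m \<le> m' \<longrightarrow> U ** U' \<notin> M m'"
      using mult_nz_stable[OF nz] by blast
    then show ?thesis by (intro exI[of _ m]) (metis M_0 order_refl)
  qed
  have "\<exists>m. \<forall>X Y. X - X0 \<in> M m \<longrightarrow> Y - Y0 \<in> M m \<longrightarrow> X ** Y \<noteq> 0 \<or> Y ** X \<noteq> 0"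
    using assms
  proof
    assume "X0 ** Y0 \<noteq> 0"
    then show ?thesis using stable[of X0 Y0] by blast
  next
    assume "Y0 ** X0 \<noteq> 0"
    then show ?thesis using stable[of Y0 X0] by blast
  qed
  then obtain m where m: "\<And>X Y. X - X0 \<in> M m \<Longrightarrow> Y - Y0 \<in> M m \<Longrightarrow> X ** Y \<noteq> 0 \<or> Y ** X \<noteq> 0" by blast
  show ?thesis
  proof (intro exI[of _ m] allI impI)
    fix X1 Y1 m' assume *: "X1 - X0 \<in> M m" "Y1 - Y0 \<in> M m" "m \<le> m'"
    have "\<not> (X - X1 \<in> M m' \<and> Y - Y1 \<in> M m')" if "X ** Y = 0" "Y ** X = 0" for X Y
      using m[of X Y] that M_diff_trans[OF M_mono[OF _ *(3)] *(1), of X] M_diff_trans[OF M_mono[OF _ *(3)] *(2), of Y]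
      by auto
    then show "vanishing r (\<lambda>(X, Y). if X - X1 \<in> M m' \<and> Y - Y1 \<in> M m' then 1 else 0)"
      unfolding vanishing_def using schwartz_ball by auto
  qed
qed

text \<open>Any two elements of the off-diagonal block multiply to 0. Hence \<open>mat 1 + c\<close>
  has inverse \<open>mat 1 - c\<close>, and multiplying such matrices adds their blocks.\<close>

lemma block_relations:
  fixes P Q :: "'a^'n^'n"
  assumes PP: "P ** P = P" and Q: "Q = mat 1 - P"
  shows "Q ** Q = Q" "P ** Q = 0" "Q ** P = 0"
    "Q ** c ** P = c \<Longrightarrow> Q ** c = c" "Q ** c ** P = c \<Longrightarrow> c ** P = c"
    "Q ** c ** P = c \<Longrightarrow> P ** c = 0" "Q ** c ** P = c \<Longrightarrow> c ** Q = 0"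
    "Q ** c ** P = c \<Longrightarrow> Q ** c' ** P = c' \<Longrightarrow> c ** c' = 0"
proof -
  show QQ: "Q ** Q = Q" and PQ: "P ** Q = 0" and QP: "Q ** P = 0"
    by (simp_all add: Q matrix_diff_ldistrib matrix_diff_rdistrib PP)
  show a: "Q ** c = c" if "Q ** c ** P = c" for c by (metis QQ that matrix_mul_assoc)
  show b: "c ** P = c" if "Q ** c ** P = c" for c by (metis PP that matrix_mul_assoc)
  show d: "P ** c = 0" if "Q ** c ** P = c" for c by (metis PQ a that matrix_mul_assoc times0_left)
  show e: "c ** Q = 0" if "Q ** c ** P = c" for c by (metis PQ b that matrix_mul_assoc times0_right)
  show "c ** c' = 0" if "Q ** c ** P = c" "Q ** c' ** P = c'"
    by (metis a[OF that(2)] e[OF that(1)] matrix_mul_assoc times0_left)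
qed

text \<open>Conjugation by \<open>P + \<pi> Q\<close> contracts \<open>c\<close>, so \<open>c\<close> may be assumed to lie in \<open>M 1\<close>.\<close>

lemma det_unipotent_block:
  fixes P Q :: "'a^'n^'n"
  assumes PP: "P ** P = P" and Q: "Q = mat 1 - P" and c: "Q ** c ** P = c"
  shows "val (det (mat 1 + c)) = 0" "mat 1 + c \<in> GL"
proof -
  note rel = block_relations[OF PP Q]
  define d where "d = P + smat \<pi> Q"
  have "d ** (P + smat (inverse \<pi>) Q) = mat 1"
    unfolding d_def by (simp add: mat_algebra PP rel(1-3) Q)
  then have dG: "d \<in> GL" using matrix_inv_unique'(2) by (auto simp: GL_iff)
  have step: "det (mat 1 + c) = det (mat 1 + smat \<pi> c)" if "Q ** c ** P = c" for c
  proof -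
    have "d ** (mat 1 + c) = (mat 1 + smat \<pi> c) ** d"
      unfolding d_def using rel(4-7)[OF that] by (simp add: mat_algebra)
    then have "det d * det (mat 1 + c) = det (mat 1 + smat \<pi> c) * det d" by (metis det_mul)
    then show ?thesis using dG by (simp add: GL_iff_det)
  qed
  have steps: "det (mat 1 + c) = det (mat 1 + smat (\<pi> ^ k) c)" for k
  proof (induction k)
    case (Suc k)
    have "Q ** smat (\<pi> ^ k) c ** P = smat (\<pi> ^ k) c" using c by (simp add: mat_algebra)
    then show ?case using step[of "smat (\<pi> ^ k) c"] Suc by (simp add: smat_smat)
  qed simp
  obtain a where a: "a \<ge> 0" "c \<in> M (- a)" using ex_M by blast
  have "smat (\<pi> powi (a + 1)) c \<in> M (a + 1 + - a)" using a by (simp only: M_smat_powi)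
  moreover have "\<pi> powi (a + 1) = \<pi> ^ nat (a + 1)" using a by (simp add: power_int_def)
  ultimately have "v (det (mat 1 + c)) = 1" using steps[of "nat (a + 1)"] det_one_plus by simp
  then show "val (det (mat 1 + c)) = 0" "mat 1 + c \<in> GL"
    using val_eqI[of "det (mat 1 + c)" 0] by (auto simp: GL_iff_det)
qed

lemma mult_assoc_eq: "U ** W = D \<Longrightarrow> U ** (W ** C) = D ** (C::'a^'n^'n)"
  by (simp add: matrix_mul_assoc)

text \<open>In coordinates \<open>X = (1 + B) Z0\<close> with \<open>Z0 = P X\<close>, translation
  by \<open>1 + c\<close> shifts \<open>B\<close>, while \<open>P + \<pi> Q\<close> fixes
  \<open>Z0\<close> and multiplies the block by \<pi>. Both sums become sums of one function of the
  block, the left one with rescaled argument, and \<open>transversal_scaled_sum\<close> supplies the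
  index \<open>card R2\<close>.\<close>

lemma block_average_vanishes:
  fixes P Q :: "'a^'n^'n" and \<psi> :: "('a^'n^'n) \<times> ('a^'n^'n) \<Rightarrow> complex"
  assumes PP: "P ** P = P" and Q: "Q = mat 1 - P"
    and near: "\<And>X Y. \<psi> (X, Y) \<noteq> 0 \<Longrightarrow> \<exists>S. P ** X ** S = P \<and> S ** P = S \<and>
        (\<forall>c. c ** P = c \<longrightarrow> c ** P ** X = Q ** X \<longrightarrow> c \<in> M 0)"
    and lev: "schwartz_level N \<psi>" and b: "b \<ge> 2 * N" "b \<ge> 0"
    and R1: "transversal R1 {c \<in> M (-1). Q ** c ** P = c} {c \<in> M b. Q ** c ** P = c}"
    and R2: "transversal R2 {c \<in> M b. Q ** c ** P = c} {c \<in> M (b + 1). Q ** c ** P = c}"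
    and XY: "Y ** X = 0" "col_rank X \<le> col_rank P"
  shows "(\<Sum>c\<in>R1. \<psi> ((P + smat \<pi> Q) ** ((mat 1 + c) ** X), Y ** (mat 1 - c) ** (smat \<pi> P + Q))) =
     of_nat (card R2) * (\<Sum>c\<in>R1. \<psi> ((mat 1 + c) ** X, Y ** (mat 1 - c)))" (is "?L = _ * ?R")
proof -
  note rel = block_relations[OF PP Q]
  define d where "d = P + smat \<pi> Q"
  define d' where "d' = smat \<pi> P + Q"
  define V where "V = {c. Q ** c ** P = c}"
  define \<Lambda> where "\<Lambda> k = {c \<in> M k. Q ** c ** P = c}" for k
  have relV: "Q ** c = c" "c ** P = c" "P ** c = 0" "c ** Q = 0" if "c \<in> V" for c
    using rel(4-7)[of c] that by (auto simp: V_def)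
  have relVV: "c ** c' = 0" if "c \<in> V" "c' \<in> V" for c c'
    using rel(8)[of c c'] that by (auto simp: V_def)
  have V_add: "c + c' \<in> V" and V_diff: "c - c' \<in> V" and V_smat: "smat x c \<in> V"
    if "c \<in> V" "c' \<in> V" for c c' x
    using that by (auto simp: V_def mat_algebra)
  have P1: "P + Q = mat 1" by (simp add: Q)
  have R1V: "R1 \<subseteq> V" using R1 by (auto simp: transversal_def V_def)
  show ?thesis
  proof (cases "\<exists>B\<in>V. \<exists>S. X = (mat 1 + B) ** (P ** X) \<and> P ** X ** S = P")
    \<comment> \<open>Points of the support with rank at most that of \<open>P\<close> do have
      coordinates, and these could be carried back through \<open>mat 1 + c\<close> and
      \<open>d\<close> to \<open>X\<close> itself. So without coordinates for \<open>X\<close> every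
      term vanishes.\<close>
    case False
    have factor: "\<exists>B\<in>V. \<exists>S. X' = (mat 1 + B) ** (P ** X') \<and> P ** X' ** S = P"
      if nz: "\<psi> (X', Y') \<noteq> 0" and cr: "col_rank X' \<le> col_rank P" for X' Y'
    proof -
      obtain S where S: "P ** X' ** S = P" "S ** P = S" using near[OF nz] by blast
      have "X' ** S ** P ** X' = X'" by (rule factor_through_projection[OF PP S(1) cr])
      then have XS: "X' ** (S ** (P ** X')) = X'" by (simp add: matrix_mul_assoc)
      define B0 where "B0 = Q ** X' ** S"
      have "B0 \<in> V" by (simp add: B0_def V_def mat_algebra S(2) mult_assoc_eq[OF rel(1)])
      moreover have "(mat 1 + B0) ** (P ** X') = P ** X' + Q ** (X' ** (S ** (P ** X')))"
        by (simp add: B0_def mat_algebra)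
      then have "X' = (mat 1 + B0) ** (P ** X')"
        using P1 unfolding XS by (metis matrix_add_rdistrib' matrix_mul_lid)
      ultimately show ?thesis using S(1) by blast
    qed
    have dG: "d ** (P + smat (inverse \<pi>) Q) = mat 1" "(P + smat (inverse \<pi>) Q) ** d = mat 1"
      unfolding d_def by (simp_all add: mat_algebra PP rel(1-3) P1)
    have z1: "\<psi> ((mat 1 + c) ** X, Y'') = 0" if c: "c \<in> V" for c Y''
    proof (rule ccontr)
      assume nz: "\<psi> ((mat 1 + c) ** X, Y'') \<noteq> 0"
      have "col_rank ((mat 1 + c) ** X) \<le> col_rank P" using col_rank_mult_le_right XY(2) order_trans by blast
      from factor[OF nz this] obtain B S where BS: "B \<in> V"
        "(mat 1 + c) ** X = (mat 1 + B) ** (P ** ((mat 1 + c) ** X))" "P ** ((mat 1 + c) ** X) ** S = P" by blast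
      have PX: "P ** ((mat 1 + c) ** X) = P ** X"
        using relV[OF c] by (simp add: mat_algebra mult_assoc_eq[OF relV(3)[OF c]])
      have "X = (mat 1 - c) ** ((mat 1 + c) ** X)"
        using relVV[OF c c] by (simp add: mat_algebra mult_assoc_eq[OF relVV[OF c c]])
      also have "\<dots> = (mat 1 - c) ** ((mat 1 + B) ** (P ** X))" using BS(2)[unfolded PX] by (simp only:)
      also have "\<dots> = (mat 1 + (B - c)) ** (P ** X)"
        using relVV[OF c BS(1)] by (simp add: mat_algebra mult_assoc_eq[OF relVV[OF c BS(1)]])
      finally show False using False BS(3) PX V_diff[OF BS(1) c] by metis
    qed
    have z2: "\<psi> (d ** ((mat 1 + c) ** X), Y'') = 0" if c: "c \<in> V" for c Y''
    proof (rule ccontr)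
      assume nz: "\<psi> (d ** ((mat 1 + c) ** X), Y'') \<noteq> 0"
      have "col_rank (d ** ((mat 1 + c) ** X)) \<le> col_rank P" using col_rank_mult_le_right XY(2) order_trans by meson
      from factor[OF nz this] obtain B S where BS: "B \<in> V"
        "d ** ((mat 1 + c) ** X) = (mat 1 + B) ** (P ** (d ** ((mat 1 + c) ** X)))"
        "P ** (d ** ((mat 1 + c) ** X)) ** S = P" by blast
      have Pd: "P ** d = P" unfolding d_def by (simp add: mat_algebra PP rel(1-3))
      have PX: "P ** (d ** ((mat 1 + c) ** X)) = P ** X"
        using relV[OF c] by (simp add: mult_assoc_eq[OF Pd]) (simp add: mat_algebra mult_assoc_eq[OF relV(3)[OF c]])
      have "X = (mat 1 - c) ** ((P + smat (inverse \<pi>) Q) ** (d ** ((mat 1 + c) ** X)))"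
        using relVV[OF c c] by (simp add: mult_assoc_eq[OF dG(2)]) (simp add: mat_algebra mult_assoc_eq[OF relVV[OF c c]])
      also have "\<dots> = (mat 1 - c) ** ((P + smat (inverse \<pi>) Q) ** ((mat 1 + B) ** (P ** X)))"
        using BS(2)[unfolded PX] by (simp only:)
      also have "(P + smat (inverse \<pi>) Q) ** ((mat 1 + B) ** (P ** X)) = (mat 1 + smat (inverse \<pi>) B) ** (P ** X)"
        by (simp add: mat_algebra mult_assoc_eq[OF rel(3)] mult_assoc_eq[OF relV(3)[OF BS(1)]]
            mult_assoc_eq[OF relV(1)[OF BS(1)]] mult_assoc_eq[OF PP] rel(1-3))
      also have "(mat 1 - c) ** \<dots> = (mat 1 + (smat (inverse \<pi>) B - c)) ** (P ** X)"
        using relVV[OF c BS(1)] by (simp add: mat_algebra mult_assoc_eq[OF relVV[OF c BS(1)]])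
      finally show False using False BS(3) PX V_diff[OF V_smat[OF BS(1) BS(1)] c] by metis
    qed
    have "?L = 0" "?R = 0" using z1 z2 R1V unfolding d_def by (auto intro!: sum.neutral)
    then show ?thesis by simp
  next
    case True
    then obtain B S where BS: "B \<in> V" "X = (mat 1 + B) ** (P ** X)" "P ** X ** S = P" by blast
    define Z0 where "Z0 = P ** X"
    define Y' where "Y' = Y ** (mat 1 + B)"
    define \<eta> where "\<eta> b = \<psi> ((mat 1 + b) ** Z0, Y' ** (mat 1 - b))" for b
    have PZ: "P ** Z0 = Z0" by (simp add: Z0_def mult_assoc_eq[OF PP])
    have QZ: "Q ** Z0 = 0" by (simp add: Z0_def mult_assoc_eq[OF rel(3)])
    have X: "X = (mat 1 + B) ** Z0" unfolding Z0_def by (rule BS(2))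
    \<comment> \<open>Here \<open>Y X = 0\<close> enters. Since \<open>P ** X\<close> has the right
      factor \<open>S\<close>, it forces \<open>Y' ** P = 0\<close>, so \<open>d'\<close> fixes
      \<open>Y'\<close> and acts on the second argument only by scaling the block.\<close>
    have "Y ** ((mat 1 + B) ** (P ** X)) = 0" using XY(1) unfolding BS(2)[symmetric] .
    then have "Y' ** (P ** X) ** S = 0" by (simp add: Y'_def matrix_mul_assoc)
    then have YP: "Y' ** P = 0" using BS(3) by (metis matrix_mul_assoc)
    then have YQ: "Y' ** Q = Y'" by (simp add: Q mat_algebra)
    have Y: "Y = Y' ** (mat 1 - B)"
      using relVV[OF BS(1) BS(1)] by (simp add: Y'_def mat_algebra)
    have e1: "\<psi> ((mat 1 + c) ** X, Y ** (mat 1 - c)) = \<eta> (B + c)" if c: "c \<in> V" for c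
    proof -
      have "(mat 1 + c) ** X = (mat 1 + (B + c)) ** Z0"
        unfolding X using relVV[OF c BS(1)] by (simp add: mat_algebra mult_assoc_eq[OF relVV[OF c BS(1)]])
      moreover have "Y ** (mat 1 - c) = Y' ** (mat 1 - (B + c))"
        unfolding Y using relVV[OF BS(1) c] by (simp add: mat_algebra)
      ultimately show ?thesis by (simp add: \<eta>_def)
    qed
    have e2: "\<psi> (d ** ((mat 1 + c) ** X), Y ** (mat 1 - c) ** d') = \<eta> (smat \<pi> (B + c))" if c: "c \<in> V" for c
    proof -
      have bV: "B + c \<in> V" by (rule V_add[OF BS(1) c])
      have "(mat 1 + c) ** X = (mat 1 + (B + c)) ** Z0"
        unfolding X using relVV[OF c BS(1)] by (simp add: mat_algebra mult_assoc_eq[OF relVV[OF c BS(1)]])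
      then have "d ** ((mat 1 + c) ** X) = d ** ((mat 1 + (B + c)) ** Z0)" by simp
      also have "\<dots> = (mat 1 + smat \<pi> (B + c)) ** Z0"
        unfolding d_def using relV[OF BS(1)] relV[OF c] PZ QZ
        by (simp add: mat_algebra mult_assoc_eq[OF relV(3)[OF BS(1)]] mult_assoc_eq[OF relV(3)[OF c]] mult_assoc_eq[OF relV(1)[OF BS(1)]] mult_assoc_eq[OF relV(1)[OF c]])
      finally have 1: "d ** ((mat 1 + c) ** X) = (mat 1 + smat \<pi> (B + c)) ** Z0" .
      have "Y ** (mat 1 - c) = Y' ** (mat 1 - (B + c))"
        unfolding Y using relVV[OF BS(1) c] by (simp add: mat_algebra)
      then have "Y ** (mat 1 - c) ** d' = Y' ** (mat 1 - (B + c)) ** d'" by simp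
      also have "\<dots> = Y' ** (mat 1 - smat \<pi> (B + c))"
        unfolding d'_def using relV[OF BS(1)] relV[OF c] YP YQ by (simp add: mat_algebra)
      finally show ?thesis using 1 by (simp add: \<eta>_def)
    qed
    have supp: "c \<in> M 0" if c: "c \<in> V" "\<eta> c \<noteq> 0" for c
    proof -
      have nz: "\<psi> ((mat 1 + c) ** Z0, Y' ** (mat 1 - c)) \<noteq> 0" using c by (simp add: \<eta>_def)
      have "c ** P ** ((mat 1 + c) ** Z0) = Q ** ((mat 1 + c) ** Z0)"
        using relV[OF c(1)] PZ QZ relVV[OF c(1) c(1)]
        by (simp add: mat_algebra mult_assoc_eq[OF relV(3)[OF c(1)]] mult_assoc_eq[OF relV(1)[OF c(1)]] mult_assoc_eq[OF relVV[OF c(1) c(1)]])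
      then show ?thesis using near[OF nz] relV(2)[OF c(1)] by blast
    qed
    have inv: "\<eta> x = \<eta> z" if xz: "x \<in> V" "z \<in> V" "x - z \<in> M b" for x z
    proof -
      have 1: "(mat 1 + x) ** Z0 = (mat 1 + (x - z)) ** ((mat 1 + z) ** Z0)"
        using relVV[OF xz(1,2)] relVV[OF xz(2,2)]
        by (simp add: mat_algebra mult_assoc_eq[OF relVV[OF xz(1,2)]] mult_assoc_eq[OF relVV[OF xz(2,2)]])
      have 2: "Y' ** (mat 1 - x) = (Y' ** (mat 1 - z)) ** (mat 1 + - (x - z))"
        using relVV[OF xz(2,1)] relVV[OF xz(2,2)] by (simp add: mat_algebra)
      show ?thesis
        unfolding \<eta>_def 1 2
        by (rule schwartz_level_invariant[OF lev xz(3) M_minus[OF xz(3)] b])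
          (use relVV[OF xz(1,1)] relVV[OF xz(1,2)] relVV[OF xz(2,1)] relVV[OF xz(2,2)] in \<open>simp_all add: mat_algebra\<close>)
    qed
    have sg: "add_subgroup (\<Lambda> k)" for k
      by (auto simp: add_subgroup_def \<Lambda>_def mat_algebra intro: M_diff)
    have \<Lambda>V: "\<Lambda> k \<subseteq> V" for k by (auto simp: \<Lambda>_def V_def)
    have L: "?L = (\<Sum>c\<in>R1. \<eta> (smat \<pi> (B + c)))"
      using e2 R1V unfolding d_def d'_def by (intro sum.cong) auto
    have Rr: "?R = (\<Sum>c\<in>R1. \<eta> (B + c))"
      using e1 R1V by (intro sum.cong) auto
    \<comment> \<open>The function \<eta> is supported on blocks in \<open>M 0\<close>, and its
      rescaled version on blocks in \<open>M (-1)\<close>. This is why \<open>R1\<close> represents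
      the larger lattice; if \<open>B\<close> lies outside it, so does every \<open>B + c\<close>,
      and both sums are 0.\<close>
    show ?thesis
    proof (cases "B \<in> M (-1)")
      case True
      have sc3: "smat \<pi> x \<in> \<Lambda> (k + 1) \<longleftrightarrow> x \<in> \<Lambda> k" for x k
        by (simp add: \<Lambda>_def M_smat_unif mat_algebra smat_eq_iff)
      have im: "smat \<pi> ` \<Lambda> (-1) = \<Lambda> 0"
      proof (intro set_eqI iffI)
        fix x assume "x \<in> \<Lambda> 0"
        moreover have "x = smat \<pi> (smat (inverse \<pi>) x)" by (simp add: smat_smat)
        ultimately show "x \<in> smat \<pi> ` \<Lambda> (-1)" using sc3[of "smat (inverse \<pi>) x" "-1"] by (intro image_eqI) auto
      qed (use sc3[of _ "-1"] in auto)
      have "(\<Sum>c\<in>R1. \<eta> (smat \<pi> (B + c))) = of_nat (card R2) * (\<Sum>c\<in>R1. \<eta> (B + c))"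
      proof (rule transversal_scaled_sum[of "\<Lambda> (-1)" "\<Lambda> 0" "\<Lambda> b" "\<Lambda> (b + 1)"])
        show "transversal R1 (\<Lambda> (-1)) (\<Lambda> b)" "transversal R2 (\<Lambda> b) (\<Lambda> (b + 1))"
          using R1 R2 by (simp_all add: \<Lambda>_def)
        show "\<Lambda> (b + 1) \<subseteq> \<Lambda> b" "\<Lambda> b \<subseteq> \<Lambda> 0" "\<Lambda> 0 \<subseteq> \<Lambda> (-1)"
          using b by (auto simp: \<Lambda>_def intro: M_mono)
        show "B \<in> \<Lambda> (-1)" using True BS(1) by (simp add: \<Lambda>_def V_def)
        show "inj (smat \<pi> :: 'a^'n^'n \<Rightarrow> _)" by (auto simp: inj_def smat_eq_iff)
        show "\<eta> x = 0" if "x \<in> \<Lambda> (-1)" "x \<notin> \<Lambda> 0" for x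
          using supp[of x] that by (auto simp: \<Lambda>_def V_def)
        show "\<eta> x = \<eta> z" if "x \<in> \<Lambda> (-1)" "z \<in> \<Lambda> (-1)" "x - z \<in> \<Lambda> b" for x z
          by (rule inv) (use that in \<open>auto simp: \<Lambda>_def V_def\<close>)
        show "smat \<pi> (x - y) = smat \<pi> x - smat \<pi> y" for x y :: "'a^'n^'n" by (rule smat_diff)
        show "smat \<pi> ` \<Lambda> (-1) = \<Lambda> 0" by (rule im)
        show "smat \<pi> x \<in> \<Lambda> (b + 1) \<longleftrightarrow> x \<in> \<Lambda> b" if "x \<in> \<Lambda> (-1)" for x by (rule sc3)
      qed (rule sg)+
      then show ?thesis using L Rr by simp
    next
      case False
      have out: "B + c \<notin> M (-1)" if "c \<in> R1" for c
        using False M_diff[of "B + c" "-1" c] that R1 by (auto simp: transversal_def)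
      have "\<eta> (B + c) = 0" "\<eta> (smat \<pi> (B + c)) = 0" if c: "c \<in> R1" for c
      proof -
        have V: "B + c \<in> V" "smat \<pi> (B + c) \<in> V" using V_add V_smat BS(1) R1V c by blast+
        have "B + c \<notin> M 0" using out[OF c] M_mono[of "B + c" 0 "-1"] by auto
        then show "\<eta> (B + c) = 0" using supp[OF V(1)] by blast
        have "smat \<pi> (B + c) \<notin> M 0" using out[OF c] M_smat_unif[of "B + c" "-1"] by simp
        then show "\<eta> (smat \<pi> (B + c)) = 0" using supp[OF V(2)] by blast
      qed
      then show ?thesis using L Rr by simp
    qed
  qed
qed

text \<open>Up to the factor \<open>card R1\<close>, averaging over \<open>R1\<close> is invisible
  to the germ and, as \<open>det (mat 1 + c)\<close> has valuation 0, to the zeta coefficients. The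
  average of \<open>fop g \<kappa> \<psi>\<close> however vanishes up to rank \<open>r\<close>, by
  \<open>block_average_vanishes\<close>, so one admissible operator raises the rank.\<close>

lemma supported_near_reducible:
  fixes X0 :: "'a^'n^'n"
  assumes rk: "col_rank X0 = r" "1 \<le> r" "r < CARD('n)"
  shows "\<exists>m. \<forall>\<psi>. schwartz \<psi> \<longrightarrow> (\<forall>X Y. \<psi> (X, Y) \<noteq> 0 \<longrightarrow> X - X0 \<in> M m) \<longrightarrow>
    reducible (Suc r) (tilde \<psi>) (zeta \<psi>)"
proof -
  obtain R where R: "X0 ** R ** X0 = X0" using ex_generalized_inverse by blast
  define P where "P = X0 ** R"
  define Q where "Q = mat 1 - P"
  have PX0: "P ** X0 = X0" using R by (simp add: P_def)
  have PP: "P ** P = P" using PX0 by (simp add: P_def matrix_mul_assoc)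
  have crP: "col_rank P = r"
    using col_rank_mult_le_left[of X0 R] col_rank_mult_le_left[of P X0] PX0 rk by (simp add: P_def)
  have "P \<noteq> 0" using crP rk col_rank_eq_0_iff[of P] by auto
  moreover have "Q \<noteq> 0"
  proof
    assume "Q = 0"
    then have "P = mat 1" by (simp add: Q_def)
    then show False using crP rk col_rank_less_iff[of P] by simp
  qed
  ultimately obtain E where E: "Q ** E ** P \<noteq> 0" using ex_two_sided_mult_nz by blast
  obtain m where near: "\<And>X. X - X0 \<in> M m \<Longrightarrow> \<exists>S. P ** X ** S = P \<and> S ** P = S \<and>
      (\<forall>c. c ** P = c \<longrightarrow> c ** P ** X = Q ** X \<longrightarrow> c \<in> M 0)"
    using ex_near_projection[OF R] unfolding P_def[symmetric] Q_def[symmetric] by blast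
  have "reducible (Suc r) (tilde \<psi>) (zeta \<psi>)"
    if schwartz: "schwartz \<psi>" and supp: "\<And>X Y. \<psi> (X, Y) \<noteq> 0 \<Longrightarrow> X - X0 \<in> M m" for \<psi>
  proof -
    obtain N where N: "schwartz_level N \<psi>" using schwartz by (auto simp: schwartz_def)
    define b where "b = max 0 (2 * N)"
    define \<Lambda> where "\<Lambda> k = {c \<in> M k. Q ** c ** P = c}" for k
    have sg: "add_subgroup (\<Lambda> k)" for k
      by (auto simp: add_subgroup_def \<Lambda>_def mat_algebra intro: M_diff)
    have exT: "\<exists>T. transversal T (\<Lambda> k) (\<Lambda> l)" for k l
    proof -
      obtain F :: "('a^'n^'n) set" where F: "finite F" "\<forall>X\<in>M k. \<exists>Y\<in>F. X - Y \<in> M l"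
        using finite_net[of k l] by (elim exE conjE)
      define rep where "rep Y = (SOME x. x \<in> \<Lambda> k \<and> x - Y \<in> M l)" for Y
      show ?thesis
      proof (rule ex_transversal[OF sg])
        show "finite (rep ` F)" using F(1) by simp
        fix x assume x: "x \<in> \<Lambda> k"
        then have "x \<in> M k" by (simp add: \<Lambda>_def)
        then obtain Y where Y: "Y \<in> F" "x - Y \<in> M l" using F(2) by auto
        have "rep Y \<in> \<Lambda> k \<and> rep Y - Y \<in> M l"
          unfolding rep_def by (rule someI[of _ x]) (simp add: x Y)
        then have "x - rep Y \<in> M l" "x - rep Y \<in> \<Lambda> k"
          using M_diff_trans[OF Y(2), of "rep Y"] M_minus_commute add_subgroupD(2)[OF sg x] by blast+
        then have "x - rep Y \<in> \<Lambda> l" by (simp add: \<Lambda>_def)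
        then show "\<exists>y\<in>rep ` F. x - y \<in> \<Lambda> l" using Y(1) by blast
      qed
    qed
    obtain R1 where R1: "transversal R1 (\<Lambda> (-1)) (\<Lambda> b)" using exT by blast
    obtain R2 where R2: "transversal R2 (\<Lambda> b) (\<Lambda> (b + 1))" using exT by blast
    define \<kappa> :: complex where "\<kappa> = of_nat (card R2)"
    have "card R2 \<noteq> 1"
    proof
      assume "card R2 = 1"
      then obtain x0 where x0: "R2 = {x0}" by (auto simp: card_1_singleton_iff)
      \<comment> \<open>A nonzero block element is rescaled to lie in \<open>M b\<close> but not in
        \<open>M (b + 1)\<close>. A single representative cannot serve both its class and that of
        0.\<close>
      obtain k where k: "Q ** E ** P \<in> M k" "Q ** E ** P \<notin> M (k + 1)" using ex_M_boundary[OF E] by blast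
      define c where "c = smat (\<pi> powi (b - k)) (Q ** E ** P)"
      have "Q ** (Q ** E ** P) ** P = Q ** E ** P"
        using block_relations(1)[OF PP Q_def] PP by (metis matrix_mul_assoc)
      then have "Q ** c ** P = c" by (simp add: c_def mat_algebra)
      moreover have "c \<in> M b" "c \<notin> M (b + 1)"
        using k M_smat_powi[of "b - k" "Q ** E ** P" k] M_smat_powi[of "b - k" "Q ** E ** P" "k + 1"]
        by (simp_all add: c_def algebra_simps)
      ultimately have c: "c \<in> \<Lambda> b" "c \<notin> \<Lambda> (b + 1)" by (auto simp: \<Lambda>_def)
      have "c - x0 \<in> \<Lambda> (b + 1)" "0 - x0 \<in> \<Lambda> (b + 1)"
        using R2 c(1) add_subgroupD(1)[OF sg] unfolding transversal_def x0 by blast+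
      then show False using add_subgroupD(2)[OF sg, of "c - x0" "b + 1" "0 - x0"] c(2) by simp
    qed
    then have \<kappa>: "\<kappa> \<noteq> 1" unfolding \<kappa>_def using of_nat_eq_1_iff by blast
    define d where "d = P + smat \<pi> Q"
    define d' where "d' = smat \<pi> P + Q"
    \<comment> \<open>The scalar is split off so that \<open>smat \<pi> g = d\<close> and
      \<open>matrix_inv g = d'\<close>: the operator then moves \<open>t\<close> to
      \<open>\<pi> * t\<close>, although \<open>d\<close> contracts only the \<open>Q\<close>
      part.\<close>
    define g where "g = smat (inverse \<pi>) d"
    have "g ** d' = mat 1"
      unfolding g_def d_def d'_def
      by (simp add: mat_algebra PP block_relations(1-3)[OF PP Q_def]) (simp add: Q_def)
    then have g: "g \<in> GL" "matrix_inv g = d'" using matrix_inv_unique' by (auto simp: GL_iff)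
    have gd: "smat \<pi> g = d" by (simp add: g_def smat_smat)
    have R1V: "Q ** c ** P = c" if "c \<in> R1" for c using R1 that by (auto simp: transversal_def \<Lambda>_def)
    have finR1: "finite R1" using R1 by (simp add: transversal_def)
    have "R1 \<noteq> {}" using R1 add_subgroupD(1)[OF sg] unfolding transversal_def by blast
    then have card1: "of_nat (card R1) \<noteq> (0::complex)" using finR1 by simp
    have inv: "matrix_inv (mat 1 + c) = mat 1 - c" if "c \<in> R1" for c
      using block_relations(8)[OF PP Q_def R1V[OF that] R1V[OF that]]
      by (intro matrix_inv_unique') (simp add: mat_algebra)
    have uG: "mat 1 + c \<in> GL" and uval: "val (det (mat 1 + c)) = 0" if "c \<in> R1" for c
      using det_unipotent_block[OF PP Q_def R1V[OF that]] by auto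
    define \<theta> where "\<theta> = fop g \<kappa> \<psi>"
    have schwartz\<theta>: "schwartz \<theta>" unfolding \<theta>_def by (rule schwartz_fop[OF schwartz g(1)])
    define act where "act c = (\<lambda>(X, Y). \<theta> ((mat 1 + c) ** X, Y ** matrix_inv (mat 1 + c)))" for c
    have SBa: "schwartz (act c)" if "c \<in> R1" for c
      unfolding act_def using uG[OF that] by (intro schwartz_act schwartz\<theta> matrix_inv_GL)
    define \<xi> where "\<xi> p = (\<Sum>c\<in>R1. act c p)" for p
    have "schwartz \<xi>" unfolding \<xi>_def[abs_def] using SBa by (rule schwartz_sum)
    have ta: "tilde (act c) t = tilde \<theta> t" if "c \<in> R1" "t \<noteq> 0" for c t
      using tilde_act[OF schwartz\<theta> uG[OF that(1)], of 1 t] that(2) by (simp add: act_def)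
    have "tilde \<xi> t = of_nat (card R1) * gop \<kappa> (tilde \<psi>) t" if "t \<noteq> 0" for t
      unfolding \<xi>_def[abs_def] using that ta SBa finR1
      by (simp add: tilde_sum \<theta>_def tilde_fop schwartz g(1))
    moreover have Za: "zeta (act c) k = zeta \<theta> k" if "c \<in> R1" for c k
      using zeta_act[OF schwartz\<theta> uG[OF that], of "matrix_inv (mat 1 + c)" k] uval[OF that] by (simp add: act_def)
    then have "zeta \<xi> k = of_nat (card R1) * zop (op_shift g) \<kappa> (zeta \<psi>) k" for k
      unfolding \<xi>_def[abs_def] using SBa finR1
      by (simp add: zeta_sum \<theta>_def zeta_fop schwartz g(1))
    moreover have "vanishing (Suc r) \<xi>"
      unfolding vanishing_def
    proof (intro conjI allI impI)
      show "schwartz \<xi>" by fact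
      fix X Y :: "'a^'n^'n" assume XY: "X ** Y = 0" "Y ** X = 0" "col_rank X < Suc r"
      have "\<xi> (X, Y) = (\<Sum>c\<in>R1. \<psi> (d ** ((mat 1 + c) ** X), Y ** (mat 1 - c) ** d')
          - \<kappa> * \<psi> ((mat 1 + c) ** X, Y ** (mat 1 - c)))"
        unfolding \<xi>_def act_def \<theta>_def fop_def gd g(2) by (intro sum.cong refl) (simp add: inv)
      also have "\<dots> = (\<Sum>c\<in>R1. \<psi> (d ** ((mat 1 + c) ** X), Y ** (mat 1 - c) ** d'))
          - \<kappa> * (\<Sum>c\<in>R1. \<psi> ((mat 1 + c) ** X, Y ** (mat 1 - c)))"
        by (simp add: sum_subtractf sum_distrib_left)
      also have "\<dots> = 0"
      proof -
        have "(\<Sum>c\<in>R1. \<psi> (d ** ((mat 1 + c) ** X), Y ** (mat 1 - c) ** d'))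
            = \<kappa> * (\<Sum>c\<in>R1. \<psi> ((mat 1 + c) ** X, Y ** (mat 1 - c)))"
          unfolding d_def d'_def \<kappa>_def
        proof (rule block_average_vanishes[OF PP Q_def _ N, of b])
          show "\<exists>S. P ** X ** S = P \<and> S ** P = S \<and> (\<forall>c. c ** P = c \<longrightarrow> c ** P ** X = Q ** X \<longrightarrow> c \<in> M 0)"
            if "\<psi> (X, Y) \<noteq> 0" for X Y by (rule near[OF supp[OF that]])
          show "transversal R1 {c \<in> M (- 1). Q ** c ** P = c} {c \<in> M b. Q ** c ** P = c}"
            using R1 by (simp add: \<Lambda>_def)
          show "transversal R2 {c \<in> M b. Q ** c ** P = c} {c \<in> M (b + 1). Q ** c ** P = c}"
            using R2 by (simp add: \<Lambda>_def)
        qed (use XY crP in \<open>auto simp: b_def\<close>)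
        then show ?thesis by simp
      qed
      finally show "\<xi> (X, Y) = 0" .
    qed
    ultimately have "realized (Suc r) (gops [(g, \<kappa>)] (tilde \<psi>)) (zops [(g, \<kappa>)] (zeta \<psi>))"
      unfolding realized_def near0_def using card1
      by (intro exI[of _ "\<lambda>p. inverse (of_nat (card R1)) * \<xi> p"])
        (auto simp: vanishing_scale tilde_scale zeta_scale[abs_def] fun_eq_iff)
    moreover have "admissible [(g, \<kappa>)]" using g \<kappa> by (simp add: admissible_def)
    ultimately show ?thesis unfolding reducible_def by blast
  qed
  then show ?thesis by blast
qed

end

section \<open>Climbing through the ranks to the invertible matrices\<close>

context haar
begin

lemma reducible_if_vanishing: "vanishing r \<phi> \<Longrightarrow> reducible r (tilde \<phi>) (zeta \<phi>)"
  by (rule reducible_if_realized) (auto simp: realized_def)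

text \<open>Compactness cuts \<open>\<phi>\<close> into finitely many multiples of indicators of small balls.\<close>

lemma vanishing_reducible_Suc:
  fixes \<phi> :: "('a^'n^'n) \<times> ('a^'n^'n) \<Rightarrow> complex"
  assumes vanishing: "vanishing r \<phi>" and r: "1 \<le> r" "r < CARD('n)"
  shows "reducible (Suc r) (tilde \<phi>) (zeta \<phi>)"
proof -
  define ball_ind where "ball_ind X1 Y1 m = (\<lambda>(X, Y). if X - X1 \<in> M m \<and> Y - Y1 \<in> M m then 1 else (0::complex))"
    for X1 Y1 :: "'a^'n^'n" and m
  have SBb: "schwartz (ball_ind X Y m)" for X Y m unfolding ball_ind_def by (rule schwartz_ball)
  obtain N where N: "schwartz_level N \<phi>" using vanishing_schwartz[OF vanishing] by (auto simp: schwartz_def)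
  have supp: "X \<in> M (- N) \<and> Y \<in> M (- N)" if "\<phi> (X, Y) \<noteq> 0" for X Y
    using N that unfolding schwartz_level_def by blast
  have const: "\<phi> (X', Y') = \<phi> (X, Y)" if "X' - X \<in> M N" "Y' - Y \<in> M N" for X Y X' Y'
    using N that unfolding schwartz_level_def by blast
  have "\<exists>m. \<forall>X\<in>M (- N). \<forall>Y\<in>M (- N). \<forall>m'\<ge>m.
      \<phi> (X, Y) \<noteq> 0 \<longrightarrow> reducible (Suc r) (tilde (ball_ind X Y m')) (zeta (ball_ind X Y m'))"
  proof (rule uniform_radius)
    fix X0 Y0 :: "'a^'n^'n"
    have A: "X0 ** Y0 = 0 \<Longrightarrow> Y0 ** X0 = 0 \<Longrightarrow> col_rank X0 < r \<Longrightarrow> \<phi> (X0, Y0) = 0"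
      using vanishing by (simp add: vanishing_def)
    \<comment> \<open>Only rank exactly \<open>r\<close> needs an operator. In the first case \<phi>
      vanishes nearby, in the second the balls miss the limit set, and in the last one
      semicontinuity keeps them away from ranks up to \<open>r\<close>.\<close>
    consider "\<phi> (X0, Y0) = 0" | "X0 ** Y0 \<noteq> 0 \<or> Y0 ** X0 \<noteq> 0" | "col_rank X0 = r" | "r < col_rank X0"
      using A by (cases "col_rank X0" r rule: linorder_cases) blast+
    then show "\<exists>m. \<forall>X' Y' m'. X' - X0 \<in> M m \<longrightarrow> Y' - Y0 \<in> M m \<longrightarrow> m \<le> m' \<longrightarrow>
        (\<phi> (X', Y') \<noteq> 0 \<longrightarrow> reducible (Suc r) (tilde (ball_ind X' Y' m')) (zeta (ball_ind X' Y' m')))"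
    proof cases
      case 1
      have "\<phi> (X', Y') = 0" if "X' - X0 \<in> M N" "Y' - Y0 \<in> M N" for X' Y'
        using const[OF that] 1 by (rule trans)
      then show ?thesis by (intro exI[of _ N]) blast
    next
      case 2
      from ball_reducible_outside[OF this, of "Suc r"] obtain m where
        m: "\<forall>X1 Y1 m'. X1 - X0 \<in> M m \<longrightarrow> Y1 - Y0 \<in> M m \<longrightarrow> m \<le> m' \<longrightarrow> vanishing (Suc r) (ball_ind X1 Y1 m')"
        unfolding ball_ind_def by blast
      then show ?thesis using reducible_if_vanishing by (intro exI[of _ m]) simp
    next
      case 3
      obtain m where m: "\<And>\<psi>. schwartz \<psi> \<Longrightarrow> (\<And>X Y. \<psi> (X, Y) \<noteq> 0 \<Longrightarrow> X - X0 \<in> M m) \<Longrightarrow>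
          reducible (Suc r) (tilde \<psi>) (zeta \<psi>)"
        using supported_near_reducible[OF 3 r] by blast
      show ?thesis
      proof (intro exI[of _ m] allI impI)
        fix X' Y' m' assume *: "X' - X0 \<in> M m" "m \<le> m'"
        show "reducible (Suc r) (tilde (ball_ind X' Y' m')) (zeta (ball_ind X' Y' m'))"
        proof (rule m[OF SBb])
          fix X Y assume "ball_ind X' Y' m' (X, Y) \<noteq> 0"
          then have "X - X' \<in> M m'" by (auto simp: ball_ind_def split: if_splits)
          then show "X - X0 \<in> M m" using M_diff_trans[OF M_mono[OF _ *(2)] *(1)] by blast
        qed
      qed
    next
      case 4
      obtain m where m: "\<forall>X. X - X0 \<in> M m \<longrightarrow> col_rank X0 \<le> col_rank X"
        using col_rank_lower_semicontinuous by blast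
      show ?thesis
      proof (intro exI[of _ m] allI impI)
        fix X' Y' m' assume *: "X' - X0 \<in> M m" "m \<le> m'"
        have "\<not> X - X' \<in> M m'" if "col_rank X < Suc r" for X
          using m 4 that M_diff_trans[OF M_mono[OF _ *(2)] *(1), of X] by force
        then have "vanishing (Suc r) (ball_ind X' Y' m')" unfolding vanishing_def using SBb by (auto simp: ball_ind_def)
        then show "reducible (Suc r) (tilde (ball_ind X' Y' m')) (zeta (ball_ind X' Y' m'))" by (rule reducible_if_vanishing)
      qed
    qed
  qed
  then obtain m0 where m0: "\<And>X Y m'. X \<in> M (- N) \<Longrightarrow> Y \<in> M (- N) \<Longrightarrow> m0 \<le> m' \<Longrightarrow>
      \<phi> (X, Y) \<noteq> 0 \<Longrightarrow> reducible (Suc r) (tilde (ball_ind X Y m')) (zeta (ball_ind X Y m'))" by blast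
  \<comment> \<open>The exponent \<open>m0\<close> makes the balls reducible, \<open>N\<close> makes
    \<phi> constant on each of them.\<close>
  define m where "m = max m0 N"
  have sg: "add_subgroup (M m :: ('a^'n^'n) set)" by (auto simp: add_subgroup_def intro: M_diff)
  obtain F :: "('a^'n^'n) set" where F: "finite F" "\<forall>X\<in>M (- N). \<exists>Y\<in>F. X - Y \<in> M m"
    using finite_net[of "- N" m] by (elim exE conjE)
  obtain T where T: "transversal T (M (- N) :: ('a^'n^'n) set) (M m)"
    using ex_transversal[OF sg F(1), of "M (- N)"] F(2) by blast
  have finT: "finite T" "T \<subseteq> M (- N)" using T by (auto simp: transversal_def)
  have dec: "\<phi> p = (\<Sum>(A, D)\<in>T \<times> T. \<phi> (A, D) * ball_ind A D m p)" for p
  proof -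
    obtain X Y where p: "p = (X, Y)" by fastforce
    have one: "\<phi> (A, D) * ball_ind A D m (X, Y) = (if X - A \<in> M m \<and> Y - D \<in> M m then \<phi> (X, Y) else 0)" for A D
      using const[of X A Y D] M_mono[of "X - A" m N] M_mono[of "Y - D" m N] by (auto simp: ball_ind_def m_def)
    show ?thesis
    proof (cases "\<phi> (X, Y) = 0")
      case True
      then have "(\<Sum>(A, D)\<in>T \<times> T. \<phi> (A, D) * ball_ind A D m (X, Y)) = 0"
        by (intro sum.neutral) (auto simp: one)
      then show ?thesis unfolding p True by (rule sym)
    next
      case False
      have XN: "X \<in> M (- N)" "Y \<in> M (- N)" using supp[OF False] by auto
      have "\<exists>!A. A \<in> T \<and> X - A \<in> M m" "\<exists>!D. D \<in> T \<and> Y - D \<in> M m"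
        using T XN unfolding transversal_def by blast+
      then obtain A D where A: "A \<in> T" "X - A \<in> M m" "\<forall>A'. A' \<in> T \<and> X - A' \<in> M m \<longrightarrow> A' = A"
        and D: "D \<in> T" "Y - D \<in> M m" "\<forall>A'. A' \<in> T \<and> Y - A' \<in> M m \<longrightarrow> A' = D"
        by (elim ex1E) blast
      have "(\<Sum>(A, D)\<in>T \<times> T. \<phi> (A, D) * ball_ind A D m (X, Y)) = (\<Sum>i\<in>T \<times> T. if i = (A, D) then \<phi> (X, Y) else 0)"
      proof (intro sum.cong refl)
        fix i assume i: "i \<in> T \<times> T"
        obtain A' D' where AD: "i = (A', D')" by fastforce
        have "X - A' \<in> M m \<longleftrightarrow> A' = A" "Y - D' \<in> M m \<longleftrightarrow> D' = D" using A D i AD by blast+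
        then show "(case i of (A, D) \<Rightarrow> \<phi> (A, D) * ball_ind A D m (X, Y)) = (if i = (A, D) then \<phi> (X, Y) else 0)"
          by (simp add: AD one)
      qed
      also have "\<dots> = \<phi> (X, Y)" using finT(1) A(1) D(1) by (simp add: sum.delta')
      finally have "(\<Sum>(A, D)\<in>T \<times> T. \<phi> (A, D) * ball_ind A D m (X, Y)) = \<phi> (X, Y)" .
      then show ?thesis unfolding p by (rule sym)
    qed
  qed
  have dec': "\<phi> = (\<lambda>p. \<Sum>i\<in>T \<times> T. \<phi> i * ball_ind (fst i) (snd i) m p)"
  proof
    fix p
    have "(\<Sum>(A, D)\<in>T \<times> T. \<phi> (A, D) * ball_ind A D m p) = (\<Sum>i\<in>T \<times> T. \<phi> i * ball_ind (fst i) (snd i) m p)"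
      by (intro sum.cong) auto
    then show "\<phi> p = (\<Sum>i\<in>T \<times> T. \<phi> i * ball_ind (fst i) (snd i) m p)" using dec[of p] by (rule trans[rotated])
  qed
  have "reducible (Suc r) (\<lambda>t. \<Sum>i\<in>T \<times> T. \<phi> i * tilde (ball_ind (fst i) (snd i) m) t)
      (\<lambda>k. \<Sum>i\<in>T \<times> T. \<phi> i * zeta (ball_ind (fst i) (snd i) m) k)"
  proof (rule reducible_sum)
    show "finite (T \<times> T)" using finT by simp
    fix i assume i: "i \<in> T \<times> T"
    obtain A D where AD: "i = (A, D)" by fastforce
    show "reducible (Suc r) (\<lambda>t. \<phi> i * tilde (ball_ind (fst i) (snd i) m) t) (\<lambda>k. \<phi> i * zeta (ball_ind (fst i) (snd i) m) k)"
    proof (cases "\<phi> i = 0")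
      case True
      have "reducible (Suc r) (tilde (\<lambda>_. 0)) (zeta (\<lambda>_. 0))" by (rule reducible_if_vanishing[OF vanishing_zero])
      then show ?thesis using True by (simp add: tilde_zero[abs_def] zeta_zero[abs_def])
    next
      case False
      then have "reducible (Suc r) (tilde (ball_ind A D m)) (zeta (ball_ind A D m))"
        using i finT(2) AD by (intro m0) (auto simp: m_def)
      then show ?thesis unfolding AD by (simp add: reducible_scale)
    qed
  qed
  moreover have "near0 (tilde \<phi>) (\<lambda>t. \<Sum>i\<in>T \<times> T. \<phi> i * tilde (ball_ind (fst i) (snd i) m) t)"
    unfolding near0_def
  proof (intro exI[of _ 0] allI impI)
    fix t :: 'a assume t: "t \<noteq> 0"
    have "tilde \<phi> t = tilde (\<lambda>p. \<Sum>i\<in>T \<times> T. \<phi> i * ball_ind (fst i) (snd i) m p) t"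
      by (rule arg_cong[OF dec', of "\<lambda>f. tilde f t"])
    also have "\<dots> = (\<Sum>i\<in>T \<times> T. tilde (\<lambda>p. \<phi> i * ball_ind (fst i) (snd i) m p) t)"
      using finT t by (intro tilde_sum) (auto intro: schwartz_scale SBb)
    finally show "tilde \<phi> t = (\<Sum>i\<in>T \<times> T. \<phi> i * tilde (ball_ind (fst i) (snd i) m) t)" by (simp add: tilde_scale)
  qed
  moreover have "zeta \<phi> = (\<lambda>k. \<Sum>i\<in>T \<times> T. \<phi> i * zeta (ball_ind (fst i) (snd i) m) k)"
  proof
    fix k
    have "zeta \<phi> k = zeta (\<lambda>p. \<Sum>i\<in>T \<times> T. \<phi> i * ball_ind (fst i) (snd i) m p) k"
      by (rule arg_cong[OF dec', of "\<lambda>f. zeta f k"])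
    also have "\<dots> = (\<Sum>i\<in>T \<times> T. zeta (\<lambda>p. \<phi> i * ball_ind (fst i) (snd i) m p) k)"
      using finT by (intro zeta_sum) (auto intro: schwartz_scale SBb)
    finally show "zeta \<phi> k = (\<Sum>i\<in>T \<times> T. \<phi> i * zeta (ball_ind (fst i) (snd i) m) k)" by (simp add: zeta_scale)
  qed
  ultimately show ?thesis using reducible_near0 by simp
qed

lemma vanishing_1_reducible:
  assumes "vanishing 1 \<phi>" "1 \<le> r" "r \<le> CARD('n)"
  shows "reducible r (tilde \<phi>) (zeta \<phi>)"
  using assms(2,3)
proof (induction r rule: nat_induct_at_least)
  case base
  show ?case by (rule reducible_if_vanishing[OF assms(1)])
next
  case (Suc r)
  then show ?case
    using reducible_trans[of r "tilde \<phi>" "zeta \<phi>" "Suc r"] vanishing_reducible_Suc[of r] by auto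
qed

text \<open>Compactness thickens the vanishing on singular pairs with \<open>X Y = Y X = 0\<close>
  to a neighbourhood of them. The thickening is needed because \<open>(h, t h ^ -1)\<close> has
  products \<open>t\<close>, not 0.\<close>

lemma vanishing_top_det_bound:
  fixes \<psi> :: "('a^'n^'n) \<times> ('a^'n^'n) \<Rightarrow> complex"
  assumes vanishing: "vanishing CARD('n) \<psi>"
  shows "\<exists>m. \<forall>X Y. X ** Y \<in> M m \<longrightarrow> Y ** X \<in> M m \<longrightarrow> v (det X) \<le> q m \<longrightarrow> \<psi> (X, Y) = 0"
proof -
  obtain N where N: "schwartz_level N \<psi>" using vanishing_schwartz[OF vanishing] by (auto simp: schwartz_def)
  have supp: "X \<in> M (- N) \<and> Y \<in> M (- N)" if "\<psi> (X, Y) \<noteq> 0" for X Y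
    using N that unfolding schwartz_level_def by blast
  have const: "\<psi> (X', Y') = \<psi> (X, Y)" if "X' - X \<in> M N" "Y' - Y \<in> M N" for X Y X' Y'
    using N that unfolding schwartz_level_def by blast
  have "\<exists>m. \<forall>X\<in>M (- N). \<forall>Y\<in>M (- N). \<forall>m'\<ge>m.
      X ** Y \<in> M m' \<longrightarrow> Y ** X \<in> M m' \<longrightarrow> v (det X) \<le> q m' \<longrightarrow> \<psi> (X, Y) = 0"
  proof (rule uniform_radius)
    fix X0 Y0 :: "'a^'n^'n"
    have A: "X0 ** Y0 = 0 \<Longrightarrow> Y0 ** X0 = 0 \<Longrightarrow> det X0 = 0 \<Longrightarrow> \<psi> (X0, Y0) = 0"
      using vanishing col_rank_less_iff[of X0] by (simp add: vanishing_def)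
    consider "\<psi> (X0, Y0) = 0" | "X0 ** Y0 \<noteq> 0" | "Y0 ** X0 \<noteq> 0" | "det X0 \<noteq> 0"
      using A by blast
    then show "\<exists>m. \<forall>X' Y' m'. X' - X0 \<in> M m \<longrightarrow> Y' - Y0 \<in> M m \<longrightarrow> m \<le> m' \<longrightarrow>
        X' ** Y' \<in> M m' \<longrightarrow> Y' ** X' \<in> M m' \<longrightarrow> v (det X') \<le> q m' \<longrightarrow> \<psi> (X', Y') = 0"
    proof cases
      case 1
      have "\<psi> (X', Y') = 0" if "X' - X0 \<in> M N" "Y' - Y0 \<in> M N" for X' Y'
        using const[OF that] 1 by (rule trans)
      then show ?thesis by (intro exI[of _ N]) blast
    next
      case 2
      then obtain m where "\<forall>U U' m'. U - X0 \<in> M m \<longrightarrow> U' - Y0 \<in> M m \<longrightarrow> m \<le> m' \<longrightarrow> U ** U' \<notin> M m'"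
        using mult_nz_stable[of X0 Y0] by blast
      then show ?thesis by (intro exI[of _ m]) blast
    next
      case 3
      then obtain m where "\<forall>U U' m'. U - Y0 \<in> M m \<longrightarrow> U' - X0 \<in> M m \<longrightarrow> m \<le> m' \<longrightarrow> U ** U' \<notin> M m'"
        using mult_nz_stable[of Y0 X0] by blast
      then show ?thesis by (intro exI[of _ m]) blast
    next
      case 4
      then have "X0 \<in> GL" by (simp add: GL_iff_det)
      then obtain L where L: "X0 \<in> GL_ball L" using ex_GL_ball by blast
      define m where "m = max (val (det X0) + 1) (max (L + 1) (- L))"
      have "\<not> v (det X') \<le> q m'" if "X' - X0 \<in> M m" "m \<le> m'" for X' m'
      proof -
        have B: "X' \<in> GL_ball L" "val (det X') = val (det X0)"
          using GL_ball_absorb[OF L that(1)] by (simp_all add: m_def)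
        then have "v (det X') = q (val (det X0))"
          using v_eq_q_val[of "det X'"] by (auto simp: GL_ball_def GL_iff_det)
        then show ?thesis using that(2) by (simp add: m_def)
      qed
      then show ?thesis by (intro exI[of _ m]) blast
    qed
  qed
  then obtain m where m: "\<And>X Y m'. X \<in> M (- N) \<Longrightarrow> Y \<in> M (- N) \<Longrightarrow> m \<le> m' \<Longrightarrow>
     X ** Y \<in> M m' \<Longrightarrow> Y ** X \<in> M m' \<Longrightarrow> v (det X) \<le> q m' \<Longrightarrow> \<psi> (X, Y) = 0" by blast
  have "\<psi> (X, Y) = 0" if "X ** Y \<in> M m" "Y ** X \<in> M m" "v (det X) \<le> q m" for X Y
    using m[of X Y m] supp[of X Y] that by blast
  then show ?thesis by blast
qed

text \<open>On the support \<open>det h\<close> is bounded away from 0 by the previous bound, and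
  \<open>h\<close> is bounded. So the inverse of \<open>h\<close> is bounded, \<open>t\<close> times
  it falls into the period lattice for small \<open>t\<close>, and the second argument may be
  replaced by 0. The remaining integral splits by the valuation of \<open>det h\<close>, which takes
  finitely many values.\<close>

lemma vanishing_top:
  fixes \<psi> :: "('a^'n^'n) \<times> ('a^'n^'n) \<Rightarrow> complex"
  assumes vanishing: "vanishing CARD('n) \<psi>"
  shows "\<exists>F. finite F \<and> (\<forall>k. k \<notin> F \<longrightarrow> zeta \<psi> k = 0) \<and> near0 (tilde \<psi>) (\<lambda>_. \<Sum>k\<in>F. zeta \<psi> k)"
proof -
  obtain N where N: "schwartz_level N \<psi>" "N \<ge> 0" using schwartz_levelE[OF vanishing_schwartz[OF vanishing], of 0] by blast
  have supp: "X \<in> M (- N) \<and> Y \<in> M (- N)" if "\<psi> (X, Y) \<noteq> 0" for X Y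
    using N that unfolding schwartz_level_def by blast
  obtain m where m: "\<And>X Y. X ** Y \<in> M m \<Longrightarrow> Y ** X \<in> M m \<Longrightarrow> v (det X) \<le> q m \<Longrightarrow> \<psi> (X, Y) = 0"
    using vanishing_top_det_bound[OF vanishing] by blast
  have det_nz: "v (det h) = q (val (det h))" if "h \<in> GL" for h :: "'a^'n^'n"
    using that by (intro v_eq_q_val) (simp add: GL_iff_det)
  have up: "val (det h) \<le> m" if "h \<in> GL" "\<psi> (h, 0) \<noteq> 0" for h
    using m[of h 0] that det_nz[of h] by fastforce
  have low: "- (int CARD('n) * N) \<le> val (det h)" if "h \<in> GL" "\<psi> (h, 0) \<noteq> 0" for h
  proof -
    have "smat (\<pi> powi N) h \<in> M (N + - N)" using supp[OF that(2)] by (simp only: M_smat_powi)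
    then have "v (det (smat (\<pi> powi N) h)) \<le> 1" by (intro v_det_le_1) simp
    moreover have "v (det (smat (\<pi> powi N) h)) = q (N * int CARD('n)) * q (val (det h))"
      unfolding det_smat v_mult v_power v_power_int det_nz[OF that(1)]
      by (simp only: power_int_mult power_int_of_nat)
    ultimately have "q (N * int CARD('n) + val (det h)) \<le> q 0" by (simp add: q_add)
    then show ?thesis unfolding q_le_iff by (simp add: algebra_simps)
  qed
  define F where "F = {- (int CARD('n) * N)..m}"
  have inF: "val (det h) \<in> F" if "h \<in> GL" "\<psi> (h, 0) \<noteq> 0" for h using up low that by (auto simp: F_def)
  have Z0: "zeta \<psi> k = 0" if "k \<notin> F" for k
  proof -
    have "zeta \<psi> k = (LINT h|\<mu>. 0)"
      unfolding zeta_def using inF that by (intro Bochner_Integration.integral_cong) (auto simp: space_mu)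
    then show ?thesis by simp
  qed
  have "(\<Sum>k\<in>F. zeta \<psi> k) = (LINT h|\<mu>. (\<Sum>k\<in>F. (if val (det h) = k then \<psi> (h, 0) else 0)))"
    unfolding zeta_def by (rule Bochner_Integration.integral_sum[symmetric])
      (intro tame_integrable tame_zeta vanishing_schwartz[OF vanishing])
  also have "\<dots> = (LINT h|\<mu>. \<psi> (h, 0))"
  proof (intro Bochner_Integration.integral_cong refl)
    fix h assume "h \<in> space \<mu>"
    then have "\<psi> (h, 0) = 0" if "val (det h) \<notin> F" using inF[of h] that by (auto simp: space_mu)
    moreover have "finite F" by (simp add: F_def)
    ultimately show "(\<Sum>k\<in>F. (if val (det h) = k then \<psi> (h, 0) else 0)) = \<psi> (h, 0)" by (auto simp: sum.delta)
  qed
  finally have sumF: "(\<Sum>k\<in>F. zeta \<psi> k) = (LINT h|\<mu>. \<psi> (h, 0))" .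
  define L where "L = (int CARD('n) - 1) * (- N) - m"
  define m1 where "m1 = max m (N - L)"
  have "tilde \<psi> t = (LINT h|\<mu>. \<psi> (h, 0))" if t: "t \<noteq> 0" "v t \<le> q m1" for t
  proof -
    have eq: "\<psi> (h, smat t (matrix_inv h)) = \<psi> (h, 0)" if h: "h \<in> GL" for h
    proof (cases "\<psi> (h, smat t (matrix_inv h)) = 0 \<and> \<psi> (h, 0) = 0")
      case False
      have vt: "v t \<le> q m" using t(2) order_trans[of "v t" "q m1" "q m"] by (simp add: m1_def)
      have "h ** smat t (matrix_inv h) = smat t (mat 1)" "smat t (matrix_inv h) ** h = smat t (mat 1)"
        using h by (simp_all add: mat_algebra invertible_matrix_inv GL_iff)
      moreover have "smat t (mat 1) \<in> M m" using M_smat[OF vt M_one] by simp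
      ultimately have "\<not> v (det h) \<le> q m"
        using m[of h "smat t (matrix_inv h)"] m[of h 0] False by auto
      then have "q m \<le> v (det h)" by simp
      moreover have "h \<in> M (- N)" using False supp by blast
      ultimately have "matrix_inv h \<in> M L" unfolding L_def by (intro matrix_inv_M)
      moreover have "v t \<le> q (N - L)" using t(2) order_trans[of "v t" "q m1" "q (N - L)"] by (simp add: m1_def)
      ultimately have "smat t (matrix_inv h) \<in> M (N - L + L)" by (intro M_smat)
      then show ?thesis using N(1) unfolding schwartz_level_def by simp
    qed simp
    \<comment> \<open>Translating by the scalar matrix of \<open>inverse t\<close> moves
      \<open>t\<close> from the first argument to the second, where smallness can be
      exploited.\<close>
    define g where "g = smat (inverse t) (mat 1 :: 'a^'n^'n)"
    have g: "g \<in> GL" using t by (simp add: g_def GL_smat GL_one)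
    have "tilde \<psi> t = (LINT h|\<mu>. \<psi> (smat t (g ** h), matrix_inv (g ** h)))"
      unfolding tilde_def using integral_left_mult[OF g tame_integrand[OF vanishing_schwartz[OF vanishing] t(1)]] by simp
    also have "\<dots> = (LINT h|\<mu>. \<psi> (h, 0))"
    proof (intro Bochner_Integration.integral_cong refl)
      fix h assume "h \<in> space \<mu>"
      then have h: "h \<in> GL" by (simp add: space_mu)
      have "smat t (g ** h) = h" using t by (simp add: g_def smat_mult_left smat_smat)
      moreover have "matrix_inv (g ** h) = smat t (matrix_inv h)"
        using t h by (simp add: g_def smat_mult_left matrix_inv_smat)
      ultimately show "\<psi> (smat t (g ** h), matrix_inv (g ** h)) = \<psi> (h, 0)" using eq[OF h] by simp
    qed
    finally show ?thesis .
  qed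
  then have "near0 (tilde \<psi>) (\<lambda>_. \<Sum>k\<in>F. zeta \<psi> k)" unfolding near0_def sumF by blast
  moreover have "finite F" by (simp add: F_def)
  ultimately show ?thesis using Z0 by blast
qed

end

subsection \<open>Laurent polynomials and right ideals\<close>

text \<open>The value and the derivative at \<open>1\<close> of the Laurent polynomial with coefficients \<open>a\<close>. Both are
  junk if the support of \<open>a\<close> is infinite.\<close>

definition coeff_sum :: "(int \<Rightarrow> complex) \<Rightarrow> complex" where "coeff_sum a = (\<Sum>k\<in>{k. a k \<noteq> 0}. a k)"

definition coeff_moment :: "(int \<Rightarrow> complex) \<Rightarrow> complex" where "coeff_moment a = (\<Sum>k\<in>{k. a k \<noteq> 0}. of_int k * a k)"

abbreviation fin_supp :: "(int \<Rightarrow> complex) \<Rightarrow> bool" where "fin_supp a \<equiv> finite {k. a k \<noteq> 0}"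

lemma coeff_sum_eq: "finite F \<Longrightarrow> {k. a k \<noteq> 0} \<subseteq> F \<Longrightarrow> coeff_sum a = sum a F"
  unfolding coeff_sum_def by (rule sum.mono_neutral_left) auto

lemma coeff_moment_eq: "finite F \<Longrightarrow> {k. a k \<noteq> 0} \<subseteq> F \<Longrightarrow> coeff_moment a = (\<Sum>k\<in>F. of_int k * a k)"
  unfolding coeff_moment_def by (rule sum.mono_neutral_left) auto

lemma fin_supp_add: "fin_supp a \<Longrightarrow> fin_supp b \<Longrightarrow> fin_supp (\<lambda>k. a k + b k)"
  by (rule finite_subset[of _ "{k. a k \<noteq> 0} \<union> {k. b k \<noteq> 0}"]) auto

lemma fin_supp_scale: "fin_supp a \<Longrightarrow> fin_supp (\<lambda>k. c * a k)"
  by (rule finite_subset[of _ "{k. a k \<noteq> 0}"]) auto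

lemma supp_shift: "{k. a (k + e) \<noteq> (0::complex)} = (\<lambda>k. k - e) ` {k. a k \<noteq> 0}" for e :: int
proof (intro set_eqI iffI)
  fix x assume "x \<in> {k. a (k + e) \<noteq> 0}"
  then show "x \<in> (\<lambda>k. k - e) ` {k. a k \<noteq> 0}" by (intro image_eqI[of _ _ "x + e"]) auto
qed auto

lemma fin_supp_shift: "fin_supp a \<Longrightarrow> fin_supp (\<lambda>k. a (k + e))"
  unfolding supp_shift by simp

lemma coeff_sum_add: "fin_supp a \<Longrightarrow> fin_supp b \<Longrightarrow> coeff_sum (\<lambda>k. a k + b k) = coeff_sum a + coeff_sum b"
  by (subst (1 2 3) coeff_sum_eq[of "{k. a k \<noteq> 0} \<union> {k. b k \<noteq> 0}"]) (auto simp: sum.distrib)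

lemma coeff_moment_add: "fin_supp a \<Longrightarrow> fin_supp b \<Longrightarrow> coeff_moment (\<lambda>k. a k + b k) = coeff_moment a + coeff_moment b"
  by (subst (1 2 3) coeff_moment_eq[of "{k. a k \<noteq> 0} \<union> {k. b k \<noteq> 0}"]) (auto simp: sum.distrib algebra_simps)

lemma coeff_sum_scale: "fin_supp a \<Longrightarrow> coeff_sum (\<lambda>k. c * a k) = c * coeff_sum a"
  by (subst (1 2) coeff_sum_eq[of "{k. a k \<noteq> 0}"]) (auto simp: sum_distrib_left)

lemma coeff_moment_scale: "fin_supp a \<Longrightarrow> coeff_moment (\<lambda>k. c * a k) = c * coeff_moment a"
  by (subst (1 2) coeff_moment_eq[of "{k. a k \<noteq> 0}"]) (auto simp: sum_distrib_left algebra_simps)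

lemma coeff_sum_shift: "coeff_sum (\<lambda>k. a (k + e)) = coeff_sum a"
  unfolding coeff_sum_def supp_shift by (subst sum.reindex) (auto simp: inj_on_def)

lemma coeff_moment_shift: "fin_supp a \<Longrightarrow> coeff_moment (\<lambda>k. a (k + e)) = coeff_moment a - of_int e * coeff_sum a"
  unfolding coeff_moment_def coeff_sum_def supp_shift
  by (subst sum.reindex) (auto simp: inj_on_def algebra_simps sum_subtractf sum_distrib_left)

lemma fin_supp_sum: "finite I \<Longrightarrow> (\<And>i. i \<in> I \<Longrightarrow> fin_supp (a i)) \<Longrightarrow> fin_supp (\<lambda>k. \<Sum>i\<in>I. a i k)"
  by (induction I rule: finite_induct) (auto intro: fin_supp_add)

lemma coeff_moment_sum: "finite I \<Longrightarrow> (\<And>i. i \<in> I \<Longrightarrow> fin_supp (a i)) \<Longrightarrow>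
    coeff_moment (\<lambda>k. \<Sum>i\<in>I. a i k) = (\<Sum>i\<in>I. coeff_moment (a i))"
proof (induction I rule: finite_induct)
  case empty
  then show ?case by (simp add: coeff_moment_def)
next
  case (insert i I)
  then show ?case by (simp add: coeff_moment_add fin_supp_sum)
qed

context uniformized
begin

text \<open>These correspond to the right ideals of \<open>M 0\<close> modulo \<open>M 1\<close>, a
  matrix ring over the residue field. Negatives are obtained by multiplying with
  \<open>- mat 1\<close>.\<close>

definition right_ideal :: "('a^'n^'n) set \<Rightarrow> bool" where
  "right_ideal J \<longleftrightarrow> J \<subseteq> M 0 \<and> M 1 \<subseteq> J \<and> (\<forall>x\<in>J. \<forall>y\<in>J. x + y \<in> J) \<and> (\<forall>x\<in>J. \<forall>y\<in>M 0. x ** y \<in> J)"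

text \<open>A generator is an element whose determinant has maximal absolute value: replacing one of its
  columns by a column of another element stays inside the ideal, so Cramer's rule bounds the quotient.\<close>

lemma right_ideal_principal:
  fixes J :: "('a^'n^'n) set"
  assumes J: "right_ideal J"
  shows "\<exists>g\<in>GL. \<forall>x. x \<in> J \<longleftrightarrow> matrix_inv g ** x \<in> M 0"
proof -
  have add: "x + y \<in> J" if "x \<in> J" "y \<in> J" for x y using J that by (simp add: right_ideal_def)
  have mul: "x ** y \<in> J" if "x \<in> J" "y \<in> M 0" for x y using J that by (simp add: right_ideal_def)
  have "smat \<pi> (mat 1) \<in> M (0 + 1)" by (simp only: M_smat_unif M_one)
  then have "smat \<pi> (mat 1) \<in> J" using J by (auto simp: right_ideal_def)
  moreover have "smat \<pi> (mat 1) \<in> GL" by (simp add: GL_smat GL_one)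
  ultimately obtain g where g: "g \<in> J \<inter> GL" "\<And>h. h \<in> J \<inter> GL \<Longrightarrow> nat (val (det g)) \<le> nat (val (det h))"
    using ex_has_least_nat[of "\<lambda>h. h \<in> J \<inter> GL" _ "\<lambda>h. nat (val (det h))"] by blast
  have pos: "0 \<le> val (det h)" if "h \<in> J \<inter> GL" for h
  proof -
    have "v (det h) \<le> 1" using that J by (intro v_det_le_1) (auto simp: right_ideal_def)
    moreover have "v (det h) = q (val (det h))" using that by (intro v_eq_q_val) (simp add: GL_iff_det)
    ultimately have "q (val (det h)) \<le> q 0" by simp
    then show ?thesis by (simp only: q_le_iff)
  qed
  have dg: "det g \<noteq> 0" using g(1) by (simp add: GL_iff_det)
  have min: "v (det h) \<le> v (det g)" if "h \<in> J" for h
  proof (cases "det h = 0")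
    case False
    then have h: "h \<in> J \<inter> GL" using that by (simp add: GL_iff_det)
    have "val (det g) \<le> val (det h)" using g(2)[OF h] pos[OF h] by simp
    then show ?thesis using v_eq_q_val[OF False] v_eq_q_val[OF dg] by simp
  qed simp
  have "matrix_inv g ** x \<in> M 0" if x: "x \<in> J" for x
  proof -
    have "v ((matrix_inv g ** x) $ k $ l) \<le> 1" for k l
    proof -
      define y where "y = column l (matrix_inv g ** x)"
      have gx: "g ** (matrix_inv g ** x) = x"
        using g(1) by (simp add: matrix_mul_assoc invertible_matrix_inv GL_iff)
      have gy: "(g *v y) $ i = x $ i $ l" for i
      proof -
        have "(g *v y) $ i = (g ** (matrix_inv g ** x)) $ i $ l"
          by (simp add: y_def matrix_vector_mult_def matrix_matrix_mult_def column_def)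
        then show ?thesis by (simp only: gx)
      qed
      define D where "D = (\<chi> i j. if j = k then (g *v y) $ i else g $ i $ j)"
      define E1 :: "'a^'n^'n" where "E1 = (\<chi> i j. if i = j \<and> j \<noteq> k then 1 else 0)"
      define E2 :: "'a^'n^'n" where "E2 = (\<chi> i j. if i = l \<and> j = k then 1 else 0)"
      have "E1 \<in> M 0" "E2 \<in> M 0" by (auto simp: M_def E1_def E2_def)
      moreover have "D = g ** E1 + x ** E2"
      proof -
        have "(g ** E1) $ i $ j = (if j = k then 0 else g $ i $ j)" for i j
        proof -
          have "(g ** E1) $ i $ j = (\<Sum>a\<in>UNIV. if a = j then (if j = k then 0 else g $ i $ j) else 0)"
            unfolding matrix_matrix_mult_def E1_def vec_lambda_beta by (intro sum.cong) auto
          then show ?thesis by simp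
        qed
        moreover have "(x ** E2) $ i $ j = (if j = k then x $ i $ l else 0)" for i j
        proof -
          have "(x ** E2) $ i $ j = (\<Sum>a\<in>UNIV. if a = l then (if j = k then x $ i $ l else 0) else 0)"
            unfolding matrix_matrix_mult_def E2_def vec_lambda_beta by (intro sum.cong) auto
          then show ?thesis by simp
        qed
        ultimately show ?thesis by (simp add: vec_eq_iff D_def gy)
      qed
      ultimately have "D \<in> J" using add mul g(1) x by auto
      then have "v (det D) \<le> v (det g)" by (rule min)
      moreover have "det D = y $ k * det g" unfolding D_def by (rule cramer_lemma)
      ultimately have "v (y $ k) \<le> 1" using dg by (simp add: v_mult)
      then show ?thesis by (simp add: y_def column_def)
    qed
    then show ?thesis by (simp add: M_def)
  qed
  moreover have "x \<in> J" if "matrix_inv g ** x \<in> M 0" for x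
  proof -
    have "g ** (matrix_inv g ** x) \<in> J" using mul g(1) that by blast
    then show ?thesis using g(1) by (simp add: matrix_mul_assoc invertible_matrix_inv GL_iff)
  qed
  ultimately show ?thesis using g(1) by blast
qed

text \<open>Containing \<open>M 1\<close>, such an ideal is a union of cosets of \<open>M 1\<close>
  and hence determined by its trace on a finite net.\<close>

lemma finite_right_ideals: "finite {J :: ('a^'n^'n) set. right_ideal J}"
proof -
  obtain F :: "('a^'n^'n) set" where F: "finite F" "\<forall>X\<in>M 0. \<exists>Y\<in>F. X - Y \<in> M 1"
    using finite_net[of 0 1] by (elim exE conjE)
  have J_eq: "J = {x. \<exists>y\<in>F \<inter> J. x - y \<in> M 1}" if J: "right_ideal J" for J
  proof (intro set_eqI iffI)
    fix x assume x: "x \<in> J"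
    then have "x \<in> M 0" using J by (auto simp: right_ideal_def)
    then obtain y where y: "y \<in> F" "x - y \<in> M 1" using F(2) by blast
    then have "y - x \<in> J" using J M_minus_commute[of x y 1] by (auto simp: right_ideal_def)
    then have "x + (y - x) \<in> J" using J x unfolding right_ideal_def by blast
    then show "x \<in> {x. \<exists>y\<in>F \<inter> J. x - y \<in> M 1}" using y by auto
  next
    fix x assume "x \<in> {x. \<exists>y\<in>F \<inter> J. x - y \<in> M 1}"
    then obtain y where y: "y \<in> J" "x - y \<in> M 1" by blast
    then have "x - y \<in> J" using J by (auto simp: right_ideal_def)
    then have "y + (x - y) \<in> J" using J y unfolding right_ideal_def by blast
    then show "x \<in> J" by simp
  qed
  have "inj_on (\<lambda>J. F \<inter> J) {J. right_ideal J}"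
  proof (rule inj_onI)
    fix J J' :: "('a^'n^'n) set" assume "J \<in> {J. right_ideal J}" "J' \<in> {J. right_ideal J}" "F \<inter> J = F \<inter> J'"
    then show "J = J'" using J_eq[of J] J_eq[of J'] by simp
  qed
  moreover have "finite ((\<lambda>J. F \<inter> J) ` {J. right_ideal J})"
    by (rule finite_subset[of _ "Pow F"]) (use F(1) in auto)
  ultimately show ?thesis by (rule finite_imageD[rotated])
qed

definition proper_right_ideals :: "('a^'n^'n) set set" where
  "proper_right_ideals = {J. right_ideal J \<and> mat 1 \<notin> J}"

text \<open>Intersecting with \<open>M 0\<close> gives the empty family its correct value, the unit
  ideal.\<close>

lemma right_ideal_Inter:
  assumes "S \<subseteq> proper_right_ideals" shows "right_ideal (M 0 \<inter> \<Inter>S :: ('a^'n^'n) set)"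
proof -
  have "right_ideal J" if "J \<in> S" for J using assms that by (auto simp: proper_right_ideals_def)
  then show ?thesis
  proof -
    have "x \<in> M 0 \<inter> \<Inter>S" if "x \<in> M 1" for x
      using \<open>\<And>J. J \<in> S \<Longrightarrow> right_ideal J\<close> M_mono[OF that, of 0] that unfolding right_ideal_def by auto blast
    moreover have "x + y \<in> M 0 \<inter> \<Inter>S" if "x \<in> M 0 \<inter> \<Inter>S" "y \<in> M 0 \<inter> \<Inter>S" for x y
      using \<open>\<And>J. J \<in> S \<Longrightarrow> right_ideal J\<close> M_add[of x 0 y] that unfolding right_ideal_def by auto
    moreover have "x ** y \<in> M 0 \<inter> \<Inter>S" if "x \<in> M 0 \<inter> \<Inter>S" "y \<in> M 0" for x y
      using \<open>\<And>J. J \<in> S \<Longrightarrow> right_ideal J\<close> M_mult_0_left[of x y 0] that unfolding right_ideal_def by auto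
    ultimately show ?thesis unfolding right_ideal_def by blast
  qed
qed

text \<open>A unit generates the unit ideal. Conversely, if \<open>h\<close> lies in no proper
  ideal, then \<open>h M 0 + M 1\<close> contains 1, so \<open>h ** a\<close> differs from 1 by an
  element of \<open>M 1\<close> and has a determinant of absolute value 1; integrality then forces
  the same for \<open>h\<close>.\<close>

lemma M_0_avoiding_proper_right_ideals:
  fixes h :: "'a^'n^'n"
  shows "h \<in> GL_ball 0 \<longleftrightarrow> h \<in> M 0 \<and> (\<forall>J\<in>proper_right_ideals. h \<notin> J)"
proof (intro iffI conjI ballI)
  assume h: "h \<in> GL_ball 0"
  then show "h \<in> M 0" by (simp add: GL_ball_def)
  fix J :: "('a^'n^'n) set" assume J: "J \<in> proper_right_ideals"
  show "h \<notin> J"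
  proof
    assume "h \<in> J"
    then have "h ** matrix_inv h \<in> J" using J h by (auto simp: proper_right_ideals_def right_ideal_def GL_ball_def)
    then show False using h J by (simp add: GL_ball_def proper_right_ideals_def invertible_matrix_inv GL_iff)
  qed
next
  assume h: "h \<in> M 0 \<and> (\<forall>J\<in>proper_right_ideals. h \<notin> J)"
  define J where "J = {h ** a + c | a c. a \<in> M 0 \<and> c \<in> M 1}"
  have "right_ideal J"
    unfolding right_ideal_def
  proof (intro conjI ballI subsetI)
    fix x assume "x \<in> J"
    then obtain a c where ac: "x = h ** a + c" "a \<in> M 0" "c \<in> M 1" by (auto simp: J_def)
    then show "x \<in> M 0" using h by (auto intro!: M_add M_mult_0_left intro: M_mono)
    fix y :: "'a^'n^'n"
    { assume "y \<in> J"
      then obtain a' c' where ac': "y = h ** a' + c'" "a' \<in> M 0" "c' \<in> M 1" by (auto simp: J_def)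
      have "x + y = h ** (a + a') + (c + c')" by (simp add: ac ac' matrix_add_ldistrib)
      then show "x + y \<in> J" using ac ac' M_add unfolding J_def by blast }
    { assume y: "y \<in> M 0"
      have "x ** y = h ** (a ** y) + c ** y" by (simp add: ac mat_algebra)
      then show "x ** y \<in> J" using ac y M_mult_0_right M_mult_0_left unfolding J_def by blast }
  next
    fix x :: "'a^'n^'n" assume x: "x \<in> M 1"
    have "x = h ** 0 + x" by simp
    then show "x \<in> J" using x M_0 unfolding J_def by blast
  qed
  moreover have "h \<in> J"
  proof -
    have "h = h ** mat 1 + 0" by simp
    then show ?thesis using M_one M_0 unfolding J_def by blast
  qed
  ultimately have "mat 1 \<in> J" using h by (auto simp: proper_right_ideals_def)
  then obtain a c where ac: "mat 1 = h ** a + c" "a \<in> M 0" "c \<in> M 1" by (auto simp: J_def)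
  then have "h ** a = mat 1 + - c" by (simp add: algebra_simps)
  then have "v (det (h ** a)) = 1" using det_one_plus[OF M_minus[OF ac(3)]] by simp
  then have e: "v (det h) * v (det a) = 1" by (simp add: det_mul v_mult)
  have "v (det a) \<le> 1" using ac(2) by (rule v_det_le_1)
  then have "v (det h) * v (det a) \<le> v (det h)" using v_nonneg by (intro mult_left_le) auto
  then have d1: "1 \<le> v (det h)" using e by simp
  then have "h \<in> GL" by (auto simp: GL_iff_det)
  moreover have "matrix_inv h \<in> M (- 0)" using h d1 by (intro matrix_inv_M0) auto
  ultimately show "h \<in> GL_ball 0" using h by (simp add: GL_ball_def)
qed

lemma val_det_GL_ball_0: assumes "h \<in> GL_ball 0" shows "val (det h) = 0"
proof -
  have h: "h \<in> GL" "h \<in> M 0" "matrix_inv h \<in> M 0" using assms by (auto simp: GL_ball_def)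
  have "det h * det (matrix_inv h) = 1" using h(1) by (metis GL_iff det_I det_mul invertible_matrix_inv(1))
  then have e: "v (det h) * v (det (matrix_inv h)) = 1" by (metis v_1 v_mult)
  have "v (det h) * v (det (matrix_inv h)) \<le> v (det h)"
    using v_det_le_1[OF h(3)] v_nonneg by (intro mult_left_le) auto
  then have "v (det h) = q 0" using v_det_le_1[OF h(2)] e by simp
  then show ?thesis by (rule val_eqI)
qed

end

section \<open>The pole of the zeta series at one and the conclusion\<close>

context haar
begin

definition \<omega> :: "('a^'n^'n) \<times> ('a^'n^'n) \<Rightarrow> complex" where
  "\<omega> = (\<lambda>(X, Y). if X - 0 \<in> M 0 \<and> Y - 0 \<in> M 0 then 1 else 0)"

lemma schwartz_omega: "schwartz \<omega>"
  unfolding \<omega>_def by (rule schwartz_ball)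

text \<open>Inclusion-exclusion over the proper right ideals of \<open>M 0\<close> containing \<open>M 1\<close>, all of which are
  principal, takes the place of Tamagawa's Hecke operator identity for the zeta integral of \<open>\<omega>\<close>.\<close>

lemma zeta_omega_annihilated:
  "\<exists>(I :: ('a^'n^'n) set set set) s e. finite I \<and> sum s I = 0 \<and>
     (\<forall>k. (\<Sum>S\<in>I. s S * zeta \<omega> (k + e S)) = (if k = 0 then of_real vol else 0))"
proof -
  define \<J> where "\<J> = (proper_right_ideals :: ('a^'n^'n) set set)"
  have finJ: "finite \<J>"
    unfolding \<J>_def proper_right_ideals_def by (rule finite_subset[OF _ finite_right_ideals]) auto
  \<comment> \<open>Nonemptiness of the family of ideals makes the alternating sum over its subsets
    0, which is the condition \<open>D (1) = 0\<close>.\<close>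
  have "M 1 \<in> \<J>"
  proof -
    have "mat 1 \<notin> (M 1 :: ('a^'n^'n) set)"
    proof
      assume "mat 1 \<in> (M 1 :: ('a^'n^'n) set)"
      then have "v ((mat 1 :: 'a^'n^'n) $ i $ i) \<le> q 1" for i by (simp add: M_def)
      then show False using unif_less by (simp add: mat_def)
    qed
    then show ?thesis
      unfolding \<J>_def proper_right_ideals_def right_ideal_def using M_mono[of _ 1 0] M_add[of _ 1] M_mult_0_right[of _ 1] by auto
  qed
  then have "(\<Prod>J\<in>\<J>. (-1) + (1::complex)) = 0" using finJ by (auto simp: card_gt_0_iff)
  then have sum0: "(\<Sum>S\<in>Pow \<J>. (-1) ^ card S) = (0::complex)"
    by (subst (asm) prod_add[OF finJ]) simp
  have "\<exists>g\<in>GL. \<forall>x. x \<in> M 0 \<inter> \<Inter>S \<longleftrightarrow> matrix_inv g ** x \<in> M 0" if "S \<in> Pow \<J>" for S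
    using that by (intro right_ideal_principal right_ideal_Inter) (simp add: \<J>_def)
  then obtain g where g: "\<And>S. S \<in> Pow \<J> \<Longrightarrow> g S \<in> GL"
    "\<And>S x. S \<in> Pow \<J> \<Longrightarrow> x \<in> M 0 \<inter> \<Inter>S \<longleftrightarrow> matrix_inv (g S) ** x \<in> M 0" by metis
  \<comment> \<open>The generator \<open>g S\<close> exhibits the indicator of the intersection as a
    translate of \<omega>, and translation shifts zeta coefficients by the valuation of the
    determinant.\<close>
  define e where "e S = val (det (matrix_inv (g S)))" for S
  have key: "(\<Sum>S\<in>Pow \<J>. (-1) ^ card S * zeta \<omega> (k + e S)) = (if k = 0 then of_real vol else 0)" for k
  proof -
    define act where "act S = (\<lambda>(X, Y). \<omega> (matrix_inv (g S) ** X, Y ** mat 1))" for S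
    have SBa: "schwartz (act S)" if "S \<in> Pow \<J>" for S
      unfolding act_def using g(1)[OF that] by (intro schwartz_act schwartz_omega matrix_inv_GL GL_one)
    have "(\<Sum>S\<in>Pow \<J>. (-1) ^ card S * zeta \<omega> (k + e S)) = (\<Sum>S\<in>Pow \<J>. zeta (\<lambda>p. (-1) ^ card S * act S p) k)"
    proof (intro sum.cong refl)
      fix S assume "S \<in> Pow \<J>"
      then have "zeta (act S) k = zeta \<omega> (k + e S)"
        unfolding act_def e_def by (intro zeta_act schwartz_omega matrix_inv_GL g(1))
      then show "(-1) ^ card S * zeta \<omega> (k + e S) = zeta (\<lambda>p. (-1) ^ card S * act S p) k"
        by (simp add: zeta_scale)
    qed
    also have "\<dots> = zeta (\<lambda>p. \<Sum>S\<in>Pow \<J>. (-1) ^ card S * act S p) k"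
      using finJ SBa by (intro zeta_sum[symmetric] schwartz_scale) auto
    also have "\<dots> = (LINT h|\<mu>. (if k = 0 then 1 else 0) * indicator (GL_ball 0) h)"
      unfolding zeta_def
    proof (intro Bochner_Integration.integral_cong refl)
      fix h assume "h \<in> space \<mu>"
      have a: "act S (h, 0) = (if h \<in> M 0 then 1 else 0) * (\<Prod>J\<in>S. if h \<in> J then 1 else 0)"
        if S: "S \<in> Pow \<J>" for S
      proof -
        have "finite S" using S finJ finite_subset by blast
        then have "(\<Prod>J\<in>S. if h \<in> J then 1 else 0) = (if h \<in> \<Inter>S then 1 else (0::complex))"
          by (auto intro!: prod.neutral)
        moreover have "act S (h, 0) = (if h \<in> M 0 \<inter> \<Inter>S then 1 else 0)"
          unfolding g(2)[OF S] by (simp add: act_def \<omega>_def)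
        ultimately show ?thesis by simp
      qed
      have "(\<Sum>S\<in>Pow \<J>. (-1) ^ card S * act S (h, 0)) =
          (if h \<in> M 0 then 1 else 0) * (\<Sum>S\<in>Pow \<J>. (\<Prod>J\<in>S. - (if h \<in> J then 1 else 0)))"
        unfolding sum_distrib_left by (intro sum.cong refl) (simp only: a prod_uminus mult_ac)
      \<comment> \<open>The sum over subfamilies factors into one factor per ideal and is 1 exactly
        when \<open>h\<close> avoids all of them; within \<open>M 0\<close> this singles out
        \<open>GL_ball 0\<close>.\<close>
      also have "(\<Sum>S\<in>Pow \<J>. (\<Prod>J\<in>S. - (if h \<in> J then 1 else (0::complex))))
          = (\<Prod>J\<in>\<J>. - (if h \<in> J then 1 else 0) + 1)"
        by (subst prod_add[OF finJ]) simp
      also have "\<dots> = (if \<forall>J\<in>\<J>. h \<notin> J then 1 else 0)"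
        using finJ by (auto intro!: prod.neutral)
      finally have "(\<Sum>S\<in>Pow \<J>. (-1) ^ card S * act S (h, 0)) = indicator (GL_ball 0) h"
        using M_0_avoiding_proper_right_ideals[of h] by (auto simp: \<J>_def indicator_def)
      then show "(if val (det h) = k then \<Sum>S\<in>Pow \<J>. (-1) ^ card S * act S (h, 0) else 0)
          = (if k = 0 then 1 else 0) * indicator (GL_ball 0) h"
        using val_det_GL_ball_0[of h] by (auto simp: indicator_def)
    qed
    also have "\<dots> = (if k = 0 then of_real vol else 0)"
    proof -
      have "(LINT h|\<mu>. (indicator (GL_ball 0) h :: complex)) = (LINT h|\<mu>. complex_of_real (indicator (GL_ball 0) h))"
        by (intro Bochner_Integration.integral_cong) (auto simp: indicator_def)
      also have "\<dots> = of_real vol"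
        using sets.sets_into_space[OF GL_ball_sets[of 0]] by (simp add: vol_def Int_absorb2)
      finally show ?thesis by simp
    qed
    finally show ?thesis .
  qed
  then show ?thesis using finJ sum0
    by (intro exI[of _ "Pow \<J>"] exI[of _ "\<lambda>S. (-1) ^ card S"] exI[of _ e]) simp
qed

lemma zops_diff: "zops es (\<lambda>k. a k - b k) = (\<lambda>k. zops es a k - zops es b k)"
  using zops_add[of es a "\<lambda>k. (-1) * b k"] zops_scale[of es "-1" b] by simp

lemma fin_supp_zop: assumes "fin_supp a" shows "fin_supp (zop e \<kappa> a)"
  using fin_supp_add[OF fin_supp_shift[OF assms, of e] fin_supp_scale[OF assms, of "- \<kappa>"]]
  by (simp add: zop_def)

lemma coeff_sum_zop: assumes "fin_supp a" shows "coeff_sum (zop e \<kappa> a) = (1 - \<kappa>) * coeff_sum a"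
  using coeff_sum_add[OF fin_supp_shift[OF assms, of e] fin_supp_scale[OF assms, of "- \<kappa>"]]
    coeff_sum_shift[of a e] coeff_sum_scale[OF assms, of "- \<kappa>"]
  by (simp add: zop_def[abs_def] algebra_simps)

text \<open>The product rule at \<open>z = 1\<close> for the factor \<open>z ^ -e - 1\<close>, which
  has value 0 and derivative \<open>-e\<close> there.\<close>

lemma coeff_moment_zop_1: assumes "fin_supp a" shows "coeff_moment (zop e 1 a) = - of_int e * coeff_sum a"
  using coeff_moment_add[OF fin_supp_shift[OF assms, of e] fin_supp_scale[OF assms, of "- 1"]]
    coeff_moment_shift[OF assms, of e] coeff_moment_scale[OF assms, of "- 1"]
  by (simp add: zop_def[abs_def])

lemma fin_supp_zops: "fin_supp a \<Longrightarrow> fin_supp (zops es a)"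
  by (induction es) (auto simp: fin_supp_zop)

lemma coeff_sum_zops: "fin_supp a \<Longrightarrow> coeff_sum (zops es a) = (\<Prod>(g, \<kappa>)\<leftarrow>es. 1 - \<kappa>) * coeff_sum a"
  by (induction es) (auto simp: coeff_sum_zop fin_supp_zops)

lemma admissible_prod_nz: "admissible es \<Longrightarrow> (\<Prod>(g, \<kappa>)\<leftarrow>es. 1 - \<kappa>) \<noteq> 0"
  by (induction es) (auto simp: admissible_def)

lemma zops_shifted_sum:
  "zops es (\<lambda>k. \<Sum>i\<in>I. s i * a (k + e i)) = (\<lambda>k. \<Sum>i\<in>I. s i * zops es a (k + e i))"
proof (induction es)
  case (Cons p es)
  obtain g \<kappa> where p: "p = (g, \<kappa>)" by fastforce
  show ?case
    unfolding p zops_simps Cons.IH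
    by (rule ext) (simp add: zop_def sum_subtractf sum_distrib_left algebra_simps)
qed simp

lemma near0_const_eq_0: assumes "near0 (\<lambda>_. c) (\<lambda>_. 0)" shows "c = 0"
proof -
  obtain m where m: "\<forall>t::'a. t \<noteq> 0 \<longrightarrow> v t \<le> q m \<longrightarrow> c = 0" using assms unfolding near0_def by blast
  then show ?thesis using m[rule_format, of "\<pi> powi m"] by (simp add: v_power_int)
qed

lemma near0_sym: "near0 f g \<Longrightarrow> near0 g f"
  unfolding near0_def by metis

text \<open>From rank 1 upwards admissible operators suffice. Finite support is recorded because
  \<open>coeff_sum\<close> means the value at 1 only then.\<close>

lemma vanishing_1_reduced:
  assumes "vanishing 1 \<phi>"
  obtains es where "admissible es" "fin_supp (zops es (zeta \<phi>))"
    "near0 (gops es (tilde \<phi>)) (\<lambda>_. coeff_sum (zops es (zeta \<phi>)))"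
proof -
  have "reducible CARD('n) (tilde \<phi>) (zeta \<phi>)" by (rule vanishing_1_reducible[OF assms]) simp_all
  then obtain es \<psi> where es: "admissible es" "vanishing CARD('n) \<psi>" "near0 (gops es (tilde \<phi>)) (tilde \<psi>)"
    "zops es (zeta \<phi>) = zeta \<psi>" by (auto simp: reducible_def realized_def)
  obtain F where F: "finite F" "\<forall>k. k \<notin> F \<longrightarrow> zeta \<psi> k = 0" "near0 (tilde \<psi>) (\<lambda>_. \<Sum>k\<in>F. zeta \<psi> k)"
    using vanishing_top[OF es(2)] by blast
  have sub: "{k. zeta \<psi> k \<noteq> 0} \<subseteq> F" using F(2) by auto
  have "coeff_sum (zeta \<psi>) = (\<Sum>k\<in>F. zeta \<psi> k)" by (rule coeff_sum_eq[OF F(1) sub])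
  then have "near0 (gops es (tilde \<phi>)) (\<lambda>_. coeff_sum (zops es (zeta \<phi>)))"
    using near0_trans[OF es(3) F(3)] es(4) by simp
  moreover have "fin_supp (zops es (zeta \<phi>))" unfolding es(4) by (rule finite_subset[OF sub F(1)])
  ultimately show thesis using es(1) that by blast
qed

text \<open>A comparison of orders of vanishing at \<open>z = 1\<close>. The Laurent polynomials
  \<open>D\<close> and \<open>W\<close> both vanish there, so \<open>D W\<close> has vanishing
  derivative; but \<open>D W\<close> is \<open>z ^ -n - 1\<close> times \<open>V\<close>, with
  derivative \<open>-n V (1)\<close>, and \<open>V (1)\<close> is a nonzero multiple of
  \<open>\<phi> (0, 0)\<close>.\<close>

lemma value_at_0_eq_0:
  assumes schwartz: "schwartz \<phi>" and van: "near0 (tilde \<phi>) (\<lambda>_. 0)"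
  shows "\<phi> (0, 0) = 0"
proof -
  define a where "a = \<phi> (0, 0)"
  define e0 where "e0 = op_shift (mat 1 :: 'a^'n^'n)"
  have "e0 = int CARD('n)"
    unfolding e0_def op_shift_def
    by (rule val_eqI) (simp add: det_smat v_power)
  then have e0: "e0 \<noteq> 0" by simp
  define \<phi>0 where "\<phi>0 = fop (mat 1) 1 \<phi>"
  have Fr0: "vanishing 1 \<phi>0"
  proof -
    have "\<phi>0 (0, Y) = 0" for Y by (simp add: \<phi>0_def fop_def matrix_inv_one)
    then have "\<phi>0 (X, Y) = 0" if "col_rank X < 1" for X Y using that col_rank_eq_0_iff[of X] by simp
    then show ?thesis unfolding vanishing_def using schwartz_fop[OF schwartz GL_one, of 1] by (simp add: \<phi>0_def)
  qed
  have Z0: "zeta \<phi>0 = zop e0 1 (zeta \<phi>)" unfolding \<phi>0_def e0_def by (rule zeta_fop[OF schwartz GL_one])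
  have "near0 (tilde \<phi>0) (gop 1 (tilde \<phi>))"
    unfolding near0_def \<phi>0_def using tilde_fop[OF schwartz GL_one] by blast
  moreover have "near0 (gop 1 (tilde \<phi>)) (gop 1 (\<lambda>_. 0))" by (rule near0_gop[OF van])
  moreover have "gop 1 (\<lambda>_. 0) = (\<lambda>_. 0)" by (simp add: gop_def fun_eq_iff)
  ultimately have van0: "near0 (tilde \<phi>0) (\<lambda>_. 0)" using near0_trans by metis
  obtain es where es: "admissible es" "fin_supp (zops es (zeta \<phi>0))"
    "near0 (gops es (tilde \<phi>0)) (\<lambda>_. coeff_sum (zops es (zeta \<phi>0)))" by (rule vanishing_1_reduced[OF Fr0])
  have "gops es (\<lambda>_. 0) = (\<lambda>_. 0)" using gops_scale[of es 0 "\<lambda>_. 0"] by simp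
  then have "near0 (gops es (tilde \<phi>0)) (\<lambda>_. 0)" using near0_gops[OF van0, of es] by simp
  then have ev0: "coeff_sum (zops es (zeta \<phi>0)) = 0"
    using near0_const_eq_0 near0_trans[OF near0_sym[OF es(3)]] by blast
  \<comment> \<open>Zeta coefficients see only second argument 0. Replacing \<phi> by its values
    there, cut off to \<open>Y\<close> in \<open>M 0\<close>, makes the difference with
    \<open>a * \<omega>\<close> vanish at \<open>(0, Y)\<close> for every \<open>Y\<close>, as
    \<open>vanishing 1\<close> requires.\<close>
  define \<phi>1 where "\<phi>1 = (\<lambda>(X, Y). (if Y \<in> M 0 then \<phi> (X, 0) else 0) - a * \<omega> (X, Y))"
  have Fr1: "vanishing 1 \<phi>1"
  proof -
    obtain N where N: "schwartz_level N \<phi>" "N \<ge> 0" using schwartz_levelE[OF schwartz, of 0] by blast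
    have lev: "schwartz_level N (\<lambda>(X, Y). if Y \<in> M 0 then \<phi> (X, 0) else 0)"
      unfolding schwartz_level_def
    proof (intro conjI allI impI)
      fix X Y :: "'a^'n^'n" assume "(case (X, Y) of (X, Y) \<Rightarrow> if Y \<in> M 0 then \<phi> (X, 0) else 0) \<noteq> 0"
      then have Y: "Y \<in> M 0" "\<phi> (X, 0) \<noteq> 0" by (auto split: if_splits)
      show "X \<in> M (- N)" using Y(2) N(1) unfolding schwartz_level_def by blast
      show "Y \<in> M (- N)" using Y(1) by (rule M_mono) (use N(2) in simp)
    next
      fix X Y X' Y' :: "'a^'n^'n" assume d: "X' - X \<in> M N" "Y' - Y \<in> M N"
      have "\<phi> (X', 0) = \<phi> (X, 0)" using N(1) d(1) unfolding schwartz_level_def by simp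
      moreover have "Y' \<in> M 0 \<longleftrightarrow> Y \<in> M 0" using M_shift_iff[of Y' Y 0] M_mono[OF d(2) N(2)] by blast
      ultimately show "(case (X', Y') of (X, Y) \<Rightarrow> if Y \<in> M 0 then \<phi> (X, 0) else 0) =
          (case (X, Y) of (X, Y) \<Rightarrow> if Y \<in> M 0 then \<phi> (X, 0) else 0)" by simp
    qed
    have "schwartz (\<lambda>p. (\<lambda>(X, Y). if Y \<in> M 0 then \<phi> (X, 0) else 0) p - a * \<omega> p)"
      by (intro schwartz_diff schwartz_scale schwartz_omega) (use lev in \<open>auto simp: schwartz_def\<close>)
    then have "schwartz \<phi>1" by (simp add: \<phi>1_def case_prod_unfold)
    moreover have "\<phi>1 (0, Y) = 0" for Y by (simp add: \<phi>1_def a_def \<omega>_def)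
    then have "\<phi>1 (X, Y) = 0" if "col_rank X < 1" for X Y using that col_rank_eq_0_iff[of X] by simp
    ultimately show ?thesis unfolding vanishing_def by simp
  qed
  have Z1: "zeta \<phi>1 = (\<lambda>k. zeta \<phi> k - a * zeta \<omega> k)"
  proof
    fix k
    have "zeta \<phi>1 k = zeta (\<lambda>p. \<phi> p - a * \<omega> p) k"
      unfolding zeta_def by (intro Bochner_Integration.integral_cong refl) (simp add: \<phi>1_def)
    also have "\<dots> = zeta \<phi> k - a * zeta \<omega> k"
      using schwartz schwartz_omega by (simp add: zeta_diff schwartz_scale zeta_scale)
    finally show "zeta \<phi>1 k = zeta \<phi> k - a * zeta \<omega> k" .
  qed
  obtain es1 where es1: "admissible es1" "fin_supp (zops es1 (zeta \<phi>1))" by (rule vanishing_1_reduced[OF Fr1])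
  \<comment> \<open>Defined from the infinite series of \<omega>. Writing that series, times
    \<open>a\<close>, as the difference of those of \<phi> and \<open>\<phi>1\<close> shows that
    \<open>W\<close> is a Laurent polynomial vanishing at 1: \<open>W0\<close> does so by the
    hypothesis on the germ, \<open>W1\<close> because of the factor
    \<open>z ^ -n - 1\<close>.\<close>
  define W where "W = zops es1 (zops es (zop e0 1 (\<lambda>k. a * zeta \<omega> k)))"
  define W0 where "W0 = zops es1 (zops es (zeta \<phi>0))"
  define W1 where "W1 = zops es (zop e0 1 (zops es1 (zeta \<phi>1)))"
  have "(\<lambda>k. a * zeta \<omega> k) = (\<lambda>k. zeta \<phi> k - zeta \<phi>1 k)" by (simp add: Z1 fun_eq_iff)
  then have "W = zops es1 (zops es (\<lambda>k. zeta \<phi>0 k - zop e0 1 (zeta \<phi>1) k))"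
    unfolding W_def Z0 by (simp add: zop_def[abs_def] algebra_simps)
  also have "\<dots> = (\<lambda>k. W0 k - W1 k)"
    unfolding zops_diff W0_def W1_def zops_commute[of es1 es] zops_zop by simp
  finally have W: "W = (\<lambda>k. W0 k + (-1) * W1 k)" by simp
  have fs0: "fin_supp W0" unfolding W0_def by (rule fin_supp_zops[OF es(2)])
  have fs1: "fin_supp W1" unfolding W1_def by (intro fin_supp_zops fin_supp_zop es1(2))
  have fsW: "fin_supp W" unfolding W by (intro fin_supp_add fs0 fin_supp_scale fs1)
  have "coeff_sum W0 = 0" unfolding W0_def using coeff_sum_zops[OF es(2)] ev0 by simp
  moreover have "coeff_sum W1 = 0" unfolding W1_def
    using coeff_sum_zops[OF fin_supp_zop[OF es1(2)]] coeff_sum_zop[OF es1(2)] by simp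
  ultimately have evW: "coeff_sum W = 0"
    unfolding W using coeff_sum_add[OF fs0 fin_supp_scale[OF fs1, of "-1"]] coeff_sum_scale[OF fs1, of "-1"] by simp
  obtain I :: "('a^'n^'n) set set set" and s e where D: "finite I" "sum s I = 0"
    "\<forall>k. (\<Sum>S\<in>I. s S * zeta \<omega> (k + e S)) = (if k = 0 then of_real vol else 0)"
    using zeta_omega_annihilated by (elim exE conjE)
  define \<delta> :: "int \<Rightarrow> complex" where "\<delta> k = (if k = 0 then of_real vol else 0)" for k
  have fsd: "fin_supp \<delta>" by (rule finite_subset[of _ "{0}"]) (auto simp: \<delta>_def)
  have "{k. \<delta> k \<noteq> 0} \<subseteq> {0}" by (auto simp: \<delta>_def)
  then have evd: "coeff_sum \<delta> = of_real vol" using coeff_sum_eq[of "{0}" \<delta>] by (simp add: \<delta>_def)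
  define V where "V = zops es1 (zops es (\<lambda>k. a * \<delta> k))"
  have fsV: "fin_supp V" unfolding V_def by (intro fin_supp_zops fin_supp_scale fsd)
  have "(\<lambda>k. \<Sum>S\<in>I. s S * W (k + e S)) = zops es1 (zops es (zop e0 1 (\<lambda>k. \<Sum>S\<in>I. s S * (a * zeta \<omega> (k + e S)))))"
  proof -
    have "zop e0 1 (\<lambda>k. \<Sum>S\<in>I. s S * (a * zeta \<omega> (k + e S)))
        = (\<lambda>k. \<Sum>S\<in>I. s S * zop e0 1 (\<lambda>k. a * zeta \<omega> k) (k + e S))"
      by (rule ext) (simp add: zop_def sum_subtractf sum_distrib_left algebra_simps)
    then show ?thesis unfolding W_def by (simp only: zops_shifted_sum)
  qed
  also have "(\<lambda>k. \<Sum>S\<in>I. s S * (a * zeta \<omega> (k + e S))) = (\<lambda>k. a * \<delta> k)"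
  proof
    fix k
    have "(\<Sum>S\<in>I. s S * (a * zeta \<omega> (k + e S))) = a * (\<Sum>S\<in>I. s S * zeta \<omega> (k + e S))"
      by (simp add: sum_distrib_left algebra_simps)
    then show "(\<Sum>S\<in>I. s S * (a * zeta \<omega> (k + e S))) = a * \<delta> k" by (simp add: D(3)[rule_format] \<delta>_def)
  qed
  also have "zops es1 (zops es (zop e0 1 (\<lambda>k. a * \<delta> k))) = zop e0 1 V"
    unfolding V_def by (simp add: zops_zop)
  finally have DW: "(\<lambda>k. \<Sum>S\<in>I. s S * W (k + e S)) = zop e0 1 V" .
  \<comment> \<open>Shifting changes the moment by a multiple of \<open>coeff_sum W\<close>, which
    is 0, so all terms share one moment and \<open>sum s I = 0\<close> finishes.\<close>
  have "coeff_moment (\<lambda>k. \<Sum>S\<in>I. s S * W (k + e S)) = (\<Sum>S\<in>I. coeff_moment (\<lambda>k. s S * W (k + e S)))"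
    by (intro coeff_moment_sum D(1) fin_supp_scale fin_supp_shift fsW)
  also have "\<dots> = (\<Sum>S\<in>I. s S * coeff_moment W)"
    by (intro sum.cong refl) (simp add: coeff_moment_scale fin_supp_shift fsW coeff_moment_shift evW)
  also have "\<dots> = 0" using D(2) by (simp add: sum_distrib_right[symmetric])
  finally have "coeff_moment (zop e0 1 V) = 0" unfolding DW .
  then have "of_int e0 * coeff_sum V = 0" using coeff_moment_zop_1[OF fsV, of e0] by simp
  then have "coeff_sum V = 0" using e0 by simp
  moreover have "coeff_sum V = (\<Prod>(g, \<kappa>)\<leftarrow>es1. 1 - \<kappa>) * ((\<Prod>(g, \<kappa>)\<leftarrow>es. 1 - \<kappa>) * (a * of_real vol))"
    unfolding V_def by (simp add: coeff_sum_zops fin_supp_zops fin_supp_scale fsd coeff_sum_scale evd)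
  ultimately show ?thesis
    using admissible_prod_nz[OF es(1)] admissible_prod_nz[OF es1(1)] vol_pos by (simp add: a_def)
qed

end

theorem theoremA9:
  fixes \<phi> :: "('a::{nonarch_local_field,field_char_0} ^ 'n ^ 'n) \<times> ('a ^ 'n ^ 'n) \<Rightarrow> complex"
    and \<mu> :: "('a ^ 'n ^ 'n) measure"
  assumes "haar_measure_GL \<mu>"
    and "\<phi> \<in> Cc_infty"
    and "\<exists>U. open U \<and> 0 \<in> U \<and> (\<forall>t\<in>U. t \<noteq> 0 \<longrightarrow> phi_tilde \<mu> \<phi> t = 0)"
  shows "\<phi> 0 = 0"
proof -
  obtain v :: "'a \<Rightarrow> real" where v: "nonarch_absolute_value v"
    "\<And>U. open U \<longleftrightarrow> (\<forall>x\<in>U. \<exists>e>0. \<forall>y. v (y - x) < e \<longrightarrow> y \<in> U)"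
    using ex_nonarch_absolute_value by blast
  interpret nonarch_valuation v by standard (fact v)+
  obtain \<pi> where "\<pi> \<noteq> 0" "v \<pi> < 1" "\<And>x. v x < 1 \<Longrightarrow> v x \<le> v \<pi>"
    using ex_uniformizer by blast
  then interpret haar v \<pi> \<mu> by unfold_locales (use assms(1) in auto)
  obtain U where U: "open U" "0 \<in> U" "\<forall>t\<in>U. t \<noteq> 0 \<longrightarrow> phi_tilde \<mu> \<phi> t = 0" using assms(3) by blast
  obtain d where d: "d > 0" "\<forall>y. v (y - 0) < d \<longrightarrow> y \<in> U" using U(1,2) v(2) by blast
  obtain m where m: "q m < d" using ex_q_less[OF d(1)] by blast
  have "tilde \<phi> t = 0" if "t \<noteq> 0" "v t \<le> q m" for t
  proof -
    have "t \<in> U" using d(2)[rule_format, of t] that m by simp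
    then show ?thesis using U(3) that(1) phi_tilde_eq_tilde by metis
  qed
  then have "near0 (tilde \<phi>) (\<lambda>_. 0)" unfolding near0_def by blast
  then have "\<phi> (0, 0) = 0" by (rule value_at_0_eq_0[OF Cc_infty_imp_schwartz[OF assms(2)]])
  then show ?thesis by (simp add: zero_prod_def)
qed

end
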